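(* Let $N_{\rm a}\ge 2$ and $d\ge 1$ be integers and let $\mathcal T$ be a finite set of $N_{\rm t}$ communication topologies on the nodes $v_1,\dots,v_{N_{\rm a}}$. Let the $i$-th topology have adjacency matrix $A_i=(a^i_{kj})$ and Laplacian $L_i$, and write $\mathcal T=\mathcal T_{\rm c}\cup\mathcal T_{\rm nc}$ for the partition into connected and non-connected topologies. Let $S\in\mathbb R^{d\times d}$ be the shift matrix (ones on the first upper diagonal, zeros elsewhere), $B=(0,\dots,0,1)^T\in\mathbb R^{d}$, $C=(1,0,\dots,0)\in\mathbb R^{1\times d}$, and let $\phi:\mathbb R^d\to\mathbb R$ be globally Lipschitz. Assume: (1) There is a compact set $W\subset\mathbb R^d$, invariant for $\dot w=Sw+B\phi(w)$, such that the system $\dot w=Sw+B\phi(w)+u$ is input-to-state stable with respect to $u$ relative to $W$. That is, there exist a class-$\mathcal{KL}$ function $\beta$ and a class-$\mathcal K$ function $\gamma$ such that every solution $w(t,\bar w)$ with initial condition $\bar w$ at time $0$ satisfies, for all $t\ge 0$, $$\|w(t,\bar w)\|_W\le\max\Big\{\beta(\|\bar w\|_W,t),\ \gamma\big(\sup_{s\in[0,t)}\|u(s)\|\big)\Big\}.$$ (2) There is $\mu>0$ such that $\mathrm{Re}\,\lambda\ge\mu$ for every $i=1,\dots,N_{\rm t}$ and every nonzero eigenvalue $\lambda$ of $L_i$. Let $T_0>0$, $a>0$ and an integer $n_0\ge 1$ be given. Let $P$ be the symmetric positive definite solution of $$SP+PS^T-2\mu PC^TCP+aI=0,$$ and for $g>0$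 put $K=D_gPC^T$, where $D_g=\mathrm{diag}(g,g^2,\dots,g^d)$. Then there exist $\tau^\star>0$ and $g^\star>0$ such that, for all $\tau\ge\tau^\star$ and all $g\ge g^\star$, the following holds. Let $(\mathcal T_{\sigma(i)})_{i\ge 1}$ be any sequence of topologies in $\mathcal T$, the $i$-th of which is active on a time interval of length $\Delta T_i\ge 0$, with $\mathcal T_{\sigma(i)}\in\mathcal T_{\rm c}$ for $i$ odd and $\mathcal T_{\sigma(i)}\in\mathcal T_{\rm nc}$ for $i$ even, such that (3) $\Delta T_i\le T_0$ for all even $i$; (4) for all $n\in\mathbb N$ and all odd $i_0\in\mathbb N$, $$\sum_{m=0}^{n}\Delta T_{i_0+2m}\ \ge\ \tau\,(n-n_0).$$ Then the compact invariant set $$\mathbf W=\{(w_1,\dots,w_{N_{\rm a}})\in W\times\cdots\times W:\ w_1=w_2=\cdots=w_{N_{\rm a}}\}$$ is globally asymptotically stable for the closed-loop switched network system $$\dot w_k=Sw_k+B\phi(w_k)+K\sum_{j=1}^{N_{\rm a}}a^{\sigma(i)}_{kj}\,(Cw_j-Cw_k),\qquad k=1,\dots,N_{\rm a},$$ where $i$ is the index of the topology interval containing the current time.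
   Context: **Topologies.** Each topology $\mathcal T_i\in\mathcal T$ is a weighted directed graph on the node set $\mathcal V=\{v_1,\dots,v_{N_{\rm a}}\}$ with edge set $\mathcal E_i\subset\mathcal V\times\mathcal V$ and no self-loops. Here $(v_k,v_j)\in\mathcal E_i$ means that information flows from node $j$ to node $k$. The adjacency matrix $A_i=(a^i_{kj})\in\mathbb R^{N_{\rm a}\times N_{\rm a}}$ has nonnegative entries, with $a^i_{kj}>0$ if and only if $(v_k,v_j)\in\mathcal E_i$. The Laplacian $L_i=(\ell^i_{kj})$ is given by $\ell^i_{kj}=-a^i_{kj}$ for $k\ne j$ and $\ell^i_{kk}=\sum_{m=1}^{N_{\rm a}}a^i_{km}$. **Connectedness.** A topology is *connected* if there is a node $v$ from which every other node can be reached by a path. A path from $v_j$ to $v_k$ is a sequence of distinct nodes $v_{\ell_1}=v_j,\dots,v_{\ell_r}=v_k$ with $(v_{\ell_{m+1}},v_{\ell_m})\in\mathcal E_i$ for $m=1,\dots,r-1$. $\mathcal T_{\rm c}$ is the set of connected topologies in $\mathcal T$ and $\mathcal T_{\rm nc}$ is the set of those that are not connected. **Switching.** The topologies act one after another in time starting at $t=0$: the $i$-th element of the sequence is active on $[t_{i-1},t_i)$ with $t_0=0$ and $t_i=t_{i-1}+\Delta T_i$. Intervals of zero length are allowed. The state $(w_1,\dots,w_{N_{\rm a}})\in(\mathbb R^d)^{N_{\rm a}}$ is continuous across switching times. **Notation.** $\|w\|_W=\min_{x\in W}\|w-x\|$. Class-$\mathcal K$ and class-$\mathcal{KL}$ functions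 are the standard comparison functions. A set is globally asymptotically stable if it is Lyapunov stable (solutions starting sufficiently close to the set stay arbitrarily close to it for all $t\ge0$) and the distance of every solution to the set tends to $0$ as $t\to\infty$. *)

theory Defs
  imports "HOL-Analysis.Analysis"
begin

text \<open>
  Coordinates of \<open>\<real>\<^sup>d\<close> are indexed by an arbitrary finite linear order;
  \<open>idx i\<close> is the position of \<open>i\<close> in that order, counted from 1 to \<open>d\<close>.
\<close>

definition idx :: "'d::{finite,linorder} \<Rightarrow> nat" where
  "idx i = card {j. j \<le> i}"

definition shift_mat :: "real ^ 'd::{finite,linorder} ^ 'd::{finite,linorder}" where
  "shift_mat = (\<chi> i j. if idx j = idx i + 1 then 1 else 0)"

definition B_vec :: "real ^ 'd::{finite,linorder}" where
  "B_vec = (\<chi> i. if idx i = CARD('d) then 1 else 0)"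

definition C_mat :: "real ^ 'd::{finite,linorder} ^ 1" where
  "C_mat = (\<chi> i j. if idx j = 1 then 1 else 0)"

definition D_mat :: "real \<Rightarrow> real ^ 'd::{finite,linorder} ^ 'd::{finite,linorder}" where
  "D_mat g = (\<chi> i j. if i = j then g ^ idx i else 0)"

definition gain :: "real \<Rightarrow> real ^ 'd::{finite,linorder} ^ 'd::{finite,linorder} \<Rightarrow> real ^ 1 ^ 'd::{finite,linorder}" where
  "gain g P = D_mat g ** P ** transpose C_mat"

definition sym_pos_def :: "real ^ 'd ^ 'd \<Rightarrow> bool" where
  "sym_pos_def P \<longleftrightarrow> transpose P = P \<and> (\<forall>x. x \<noteq> 0 \<longrightarrow> x \<bullet> (P *v x) > 0)"

text \<open>
  A weighted digraph on the nodes \<open>'n\<close> is given by its adjacency matrix; the pair \<open>(k, j)\<close>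
  is an edge when information flows from \<open>j\<close> to \<open>k\<close>.
\<close>

definition adjacency :: "real ^ 'n ^ 'n \<Rightarrow> bool" where
  "adjacency A \<longleftrightarrow> (\<forall>k j. A $ k $ j \<ge> 0) \<and> (\<forall>k. A $ k $ k = 0)"

definition edges :: "real ^ 'n ^ 'n \<Rightarrow> ('n \<times> 'n) set" where
  "edges A = {(k, j). A $ k $ j > 0}"

definition laplacian :: "real ^ 'n ^ 'n \<Rightarrow> real ^ 'n ^ 'n" where
  "laplacian A = (\<chi> k j. if k = j then (\<Sum>m\<in>UNIV. A $ k $ m) else - A $ k $ j)"

definition topology_path :: "real ^ 'n ^ 'n \<Rightarrow> 'n \<Rightarrow> 'n \<Rightarrow> 'n list \<Rightarrow> bool" where
  "topology_path A j k p \<longleftrightarrow>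
     p \<noteq> [] \<and> distinct p \<and> hd p = j \<and> last p = k \<and>
     (\<forall>m. Suc m < length p \<longrightarrow> (p ! Suc m, p ! m) \<in> edges A)"

definition connected_topology :: "real ^ 'n ^ 'n \<Rightarrow> bool" where
  "connected_topology A \<longleftrightarrow> (\<exists>v. \<forall>u. u \<noteq> v \<longrightarrow> (\<exists>p. topology_path A v u p))"

definition is_eigenvalue :: "real ^ 'n ^ 'n \<Rightarrow> complex \<Rightarrow> bool" where
  "is_eigenvalue M z \<longleftrightarrow>
     (\<exists>v :: complex ^ 'n. v \<noteq> 0 \<and> map_matrix complex_of_real M *v v = z *s v)"

definition locally_finite_times :: "real set \<Rightarrow> bool" where
  "locally_finite_times D \<longleftrightarrow> (\<forall>T. finite (D \<inter> {0..T}))"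

definition piecewise_continuous :: "(real \<Rightarrow> 'a::real_normed_vector) \<Rightarrow> bool" where
  "piecewise_continuous u \<longleftrightarrow>
     (\<exists>D. locally_finite_times D \<and> continuous_on ({0..} - D) u) \<and>
     (\<forall>t\<ge>0. \<exists>l. (u \<longlongrightarrow> l) (at_right t)) \<and>
     (\<forall>t>0. \<exists>l. (u \<longlongrightarrow> l) (at_left t))"

text \<open>
  Solutions on \<open>[0, \<infinity>)\<close> of \<open>w' = f(t, w)\<close>, where \<open>f\<close> may jump in \<open>t\<close>: the state is
  continuous and the equation holds off a locally finite set of times. For \<open>f\<close> continuous
  these are the classical solutions. All right-hand sides used here are globally Lipschitz
  in \<open>w\<close>, so every solution extends to \<open>[0, \<infinity>)\<close>.
\<close>

definition solution :: "(real \<Rightarrow> 'a \<Rightarrow> 'a) \<Rightarrow> (real \<Rightarrow> 'a::real_normed_vector) \<Rightarrow> bool" where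
  "solution f w \<longleftrightarrow>
     continuous_on {0..} w \<and>
     (\<exists>D. locally_finite_times D \<and>
        (\<forall>t\<in>{0..} - D. (w has_vector_derivative f t (w t)) (at t within {0..})))"

definition invariant_set :: "(real \<Rightarrow> 'a \<Rightarrow> 'a) \<Rightarrow> 'a::real_normed_vector set \<Rightarrow> bool" where
  "invariant_set f X \<longleftrightarrow> (\<forall>w. solution f w \<and> w 0 \<in> X \<longrightarrow> (\<forall>t\<ge>0. w t \<in> X))"

text \<open>For a nonempty compact set \<open>X\<close>, \<open>infdist x X\<close> is the minimum of \<open>norm (x - y)\<close> over \<open>y \<in> X\<close>.\<close>

definition lyapunov_stable :: "(real \<Rightarrow> 'a \<Rightarrow> 'a) \<Rightarrow> 'a::real_normed_vector set \<Rightarrow> bool" where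
  "lyapunov_stable f X \<longleftrightarrow>
     (\<forall>\<epsilon>>0. \<exists>\<delta>>0. \<forall>w. solution f w \<and> infdist (w 0) X < \<delta> \<longrightarrow>
        (\<forall>t\<ge>0. infdist (w t) X < \<epsilon>))"

definition globally_attractive :: "(real \<Rightarrow> 'a \<Rightarrow> 'a) \<Rightarrow> 'a::real_normed_vector set \<Rightarrow> bool" where
  "globally_attractive f X \<longleftrightarrow>
     (\<forall>w. solution f w \<longrightarrow> ((\<lambda>t. infdist (w t) X) \<longlongrightarrow> 0) at_top)"

definition globally_asymptotically_stable ::
  "(real \<Rightarrow> 'a \<Rightarrow> 'a) \<Rightarrow> 'a::real_normed_vector set \<Rightarrow> bool" where
  "globally_asymptotically_stable f X \<longleftrightarrow> lyapunov_stable f X \<and> globally_attractive f X"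

definition class_K :: "(real \<Rightarrow> real) \<Rightarrow> bool" where
  "class_K \<gamma> \<longleftrightarrow> continuous_on {0..} \<gamma> \<and> strict_mono_on {0..} \<gamma> \<and> \<gamma> 0 = 0"

definition class_KL :: "(real \<Rightarrow> real \<Rightarrow> real) \<Rightarrow> bool" where
  "class_KL \<beta> \<longleftrightarrow>
     (\<forall>t\<ge>0. class_K (\<lambda>r. \<beta> r t)) \<and>
     (\<forall>r\<ge>0. antimono_on {0..} (\<beta> r) \<and> (\<beta> r \<longlongrightarrow> 0) at_top)"

text \<open>
  Supremum of \<open>norm (u s)\<close> over \<open>s \<in> [0, t)\<close>, taken in \<open>[0, \<infinity>)\<close>: inserting 0 only matters
  for \<open>t = 0\<close>, where it makes the supremum of the empty set equal to 0.
\<close>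

definition sup_norm_upto :: "(real \<Rightarrow> 'a::real_normed_vector) \<Rightarrow> real \<Rightarrow> real" where
  "sup_norm_upto u t = Sup (insert 0 ((\<lambda>s. norm (u s)) ` {0..<t}))"

text \<open>
  Input-to-state stability of \<open>w' = F(w) + u\<close> relative to \<open>W\<close>. Inputs range over the piecewise
  continuous functions, which are bounded on bounded intervals, so the suprema are finite.
\<close>

definition input_to_state_stable ::
  "('a \<Rightarrow> 'a) \<Rightarrow> 'a::real_normed_vector set \<Rightarrow> bool" where
  "input_to_state_stable F W \<longleftrightarrow>
     (\<exists>\<beta> \<gamma>. class_KL \<beta> \<and> class_K \<gamma> \<and>
        (\<forall>u w. piecewise_continuous u \<and> solution (\<lambda>t x. F x + u t) w \<longrightarrow>
           (\<forall>t\<ge>0. infdist (w t) W \<le> max (\<beta> (infdist (w 0) W) t) (\<gamma> (sup_norm_upto u t)))))"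

definition node_dynamics :: "(real ^ 'd::{finite,linorder} \<Rightarrow> real) \<Rightarrow> real ^ 'd::{finite,linorder} \<Rightarrow> real ^ 'd::{finite,linorder}" where
  "node_dynamics \<phi> w = shift_mat *v w + \<phi> w *\<^sub>R B_vec"

definition network_dynamics ::
  "(real ^ 'd::{finite,linorder} \<Rightarrow> real) \<Rightarrow> real ^ 1 ^ 'd::{finite,linorder} \<Rightarrow> real ^ 'n ^ 'n \<Rightarrow>
   real ^ 'd::{finite,linorder} ^ 'n \<Rightarrow> real ^ 'd::{finite,linorder} ^ 'n" where
  "network_dynamics \<phi> K A w =
     (\<chi> k. node_dynamics \<phi> (w $ k) +
        K *v (\<Sum>j\<in>UNIV. (A $ k $ j) *\<^sub>R (C_mat *v (w $ j) - C_mat *v (w $ k))))"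

definition switch_time :: "(nat \<Rightarrow> real) \<Rightarrow> nat \<Rightarrow> real" where
  "switch_time \<Delta>T i = (\<Sum>m=1..i. \<Delta>T m)"

text \<open>
  The intervals \<open>[t\<^sub>i\<^sub>-\<^sub>1, t\<^sub>i)\<close> are disjoint (possibly empty), so the index is unique; it exists for all
  \<open>t \<ge> 0\<close> when the switching times tend to infinity.
\<close>

definition active_index :: "(nat \<Rightarrow> real) \<Rightarrow> real \<Rightarrow> nat" where
  "active_index \<Delta>T t = (THE i. i \<ge> 1 \<and> switch_time \<Delta>T (i - 1) \<le> t \<and> t < switch_time \<Delta>T i)"

definition switched_network ::
  "(real ^ 'd::{finite,linorder} \<Rightarrow> real) \<Rightarrow> real ^ 1 ^ 'd::{finite,linorder} \<Rightarrow> (nat \<Rightarrow> real ^ 'n ^ 'n) \<Rightarrow>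
   (nat \<Rightarrow> nat) \<Rightarrow> (nat \<Rightarrow> real) \<Rightarrow> real \<Rightarrow>
   real ^ 'd::{finite,linorder} ^ 'n \<Rightarrow> real ^ 'd::{finite,linorder} ^ 'n" where
  "switched_network \<phi> K A \<sigma> \<Delta>T t w = network_dynamics \<phi> K (A (\<sigma> (active_index \<Delta>T t))) w"

definition sync_set :: "(real ^ 'd) set \<Rightarrow> (real ^ 'd ^ 'n) set" where
  "sync_set W = {w. (\<forall>k. w $ k \<in> W) \<and> (\<forall>k j. w $ k = w $ j)}"

end

theory Submission
  imports "Jordan_Normal_Form.Schur_Decomposition" Defs
begin

text \<open>
  In the coordinates \<open>\<xi>\<^sub>k = D\<^sub>g\<^sup>-\<^sup>1 (w\<^sub>k - w\<^sub>r)\<close>, \<open>r\<close> a fixed node, the error dynamics is \<open>g\<close> times a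
  linear field independent of \<open>g\<close>, plus a perturbation by \<open>\<phi>\<close> that is Lipschitz uniformly in \<open>g \<ge> 1\<close>.
  For a connected topology the Laplacian, reduced to vectors vanishing at \<open>r\<close>, has spectrum in
  \<open>Re z \<ge> \<mu>\<close>. Real functionals \<open>R\<^sub>i\<close> adapted to a scaled triangular form of it make the sum of
  \<open>R\<^sub>i(\<xi>)\<^sup>T P\<^sup>-\<^sup>1 R\<^sub>i(\<xi>)\<close> a Lyapunov function, so the error decays like \<open>K e\<^sup>-\<^sup>c\<^sup>g\<^sup>t\<close>. For a non-connected
  topology Gronwall gives growth at most \<open>e\<^sup>\<rho>\<^sup>g\<^sup>t\<close>; both exponents are proportional to \<open>g\<close>, so one
  dwell time \<open>\<tau>\<close> with \<open>c \<tau> > \<rho> T\<^sub>0 + ln K\<close> works for all large \<open>g\<close>. Finally node \<open>r\<close> is the input-to-state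
  stable node system driven by a coupling that is bounded by the error.
\<close>

text \<open>A Laplacian of a directed graph need be neither symmetric nor diagonalizable, so a bound
  on its spectrum yields no Lyapunov function directly. Rescaling the triangular form shrinks its
  off-diagonal part at will; a small margin of \<mu> is lost, and half of the term a I of the
  Riccati equation pays for it. The other half gives the decay and dominates the perturbation by
  \<phi> once g is large. The rate c comes from a and P alone, whereas the overshoot K depends on
  the topology and is made uniform over the finite family. The overshoot is paid at every return to
  a connected topology, and a single connected phase may be too short to make up for it. Decay is
  therefore counted over many phases, which is what the average dwell time condition allows, at the
  price of a factor that depends on n0. A larger g speeds up growth as well as decay, so \<tau> has
  to be fixed through K, \<rho> T0 and c before g is chosen. The error is estimated without
  reference to W. Input-to-state stability enters only afterwards and for a single node: the proof
  is a cascade, and no joint Lyapunov function for error and node is built.\<close>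

hide_const (open) Matrix.mat Matrix.row Matrix.col Determinant.det
no_notation vec_index (infixl "$" 100)

section \<open>Adapted functionals of a real matrix\<close>

text \<open>The rows of Q in the Schur decomposition A = P B Q, with Q inverse to P, do the job: Q A
  = B Q says that the values of these rows at x are transformed by the upper triangular B.
  Functionals numbered by naturals replace a change of basis, so the node type never has to be
  ordered.\<close>

lemma complex_triangularization:
  fixes M :: "complex ^ 'n ^ 'n"
  obtains q :: "nat \<Rightarrow> complex ^ 'n" and b :: "nat \<Rightarrow> nat \<Rightarrow> complex" where
    "\<And>i x. i < CARD('n) \<Longrightarrow>
      (\<Sum>k\<in>UNIV. q i $ k * (M *v x) $ k) = (\<Sum>j=i..<CARD('n). b i j * (\<Sum>k\<in>UNIV. q j $ k * x $ k))"
    "\<And>x. (\<And>i. i < CARD('n) \<Longrightarrow> (\<Sum>k\<in>UNIV. q i $ k * x $ k) = 0) \<Longrightarrow> x = 0"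
    "\<And>i. i < CARD('n) \<Longrightarrow> \<exists>v. v \<noteq> 0 \<and> M *v v = b i i *s v"
proof -
  define n where "n = CARD('n)"
  \<comment> \<open>Carries the unordered index type to \<open>{0..<n}\<close>, where triangularity
    makes sense; \<open>pos\<close> below is the inverse.\<close>
  obtain f :: "nat \<Rightarrow> 'n" where f: "bij_betw f {0..<n} UNIV"
    using ex_bij_betw_nat_finite[of "UNIV :: 'n set"] by (auto simp: n_def)
  have sum_f: "(\<Sum>k\<in>UNIV. h k) = (\<Sum>m=0..<n. h (f m))" for h :: "'n \<Rightarrow> complex"
    using sum.reindex_bij_betw[OF f, of h] by simp
  define A where "A = Matrix.mat n n (\<lambda>(i, j). M $ f i $ f j)"
  have A: "A \<in> carrier_mat n n" by (simp add: A_def)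
  obtain es where es: "char_poly A = (\<Prod>e\<leftarrow>es. [:- e, 1:])" "length es = n"
    using char_poly_factorized[OF A] by blast
  obtain B P Q where BPQ: "schur_decomposition A es = (B, P, Q)"
    by (cases "schur_decomposition A es") auto
  have sim: "similar_mat_wit A B P Q" and tri: "upper_triangular B" and diag: "diag_mat B = es"
    using schur_decomposition[OF A es(1) BPQ] by auto
  have B: "B \<in> carrier_mat n n" and P: "P \<in> carrier_mat n n" and Q: "Q \<in> carrier_mat n n"
    and PQ: "P * Q = 1\<^sub>m n" and QP: "Q * P = 1\<^sub>m n" and APBQ: "A = P * B * Q"
    using similar_mat_witD2[OF A sim] by auto
  have QA: "Q * A = B * Q"
  proof -
    have "Q * A = Q * (P * (B * Q))"
      unfolding APBQ using assoc_mult_mat[OF P B Q] by simp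
    also have "\<dots> = (Q * P) * (B * Q)"
      using assoc_mult_mat[OF Q P mult_carrier_mat[OF B Q]] by simp
    finally show ?thesis using left_mult_one_mat[OF mult_carrier_mat[OF B Q]] by (simp add: QP)
  qed
  define pos where "pos = the_inv_into {0..<n} f"
  have pos_f: "pos (f m) = m" if "m < n" for m
    using that f by (simp add: pos_def bij_betw_def the_inv_into_f_f)
  define q :: "nat \<Rightarrow> complex ^ 'n" where "q i = (\<chi> k. Q $$ (i, pos k))" for i
  have q: "(\<Sum>k\<in>UNIV. q i $ k * x $ k) = (\<Sum>m=0..<n. Q $$ (i, m) * x $ f m)" for i x
    unfolding sum_f by (rule sum.cong) (auto simp: q_def pos_f)
  have entry: "(X * Y) $$ (i, j) = (\<Sum>m=0..<n. X $$ (i, m) * Y $$ (m, j))"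
    if "X \<in> carrier_mat n n" "Y \<in> carrier_mat n n" "i < n" "j < n" for X Y :: "complex Matrix.mat" and i j
    using that by (auto simp: scalar_prod_def intro!: sum.cong)
  show ?thesis
  proof (rule that[of q "\<lambda>i j. B $$ (i, j)"], unfold n_def[symmetric])
    fix i x assume i: "i < n"
    have "(\<Sum>k\<in>UNIV. q i $ k * (M *v x) $ k) = (\<Sum>m=0..<n. Q $$ (i, m) * (\<Sum>l=0..<n. A $$ (m, l) * x $ f l))"
      unfolding q matrix_vector_mult_def sum_f by (intro sum.cong) (auto simp: A_def)
    also have "\<dots> = (\<Sum>l=0..<n. (Q * A) $$ (i, l) * x $ f l)"
      unfolding sum_distrib_left
      by (subst sum.swap) (auto simp: entry[OF Q A i] sum_distrib_left sum_distrib_right mult_ac intro!: sum.cong)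
    also have "\<dots> = (\<Sum>j=0..<n. B $$ (i, j) * (\<Sum>m=0..<n. Q $$ (j, m) * x $ f m))"
      unfolding sum_distrib_left QA
      by (subst sum.swap) (auto simp: entry[OF B Q i] sum_distrib_left sum_distrib_right mult_ac intro!: sum.cong)
    also have "\<dots> = (\<Sum>j=i..<n. B $$ (i, j) * (\<Sum>m=0..<n. Q $$ (j, m) * x $ f m))"
      using i tri B by (intro sum.mono_neutral_right) (auto simp: upper_triangular_def)
    finally show "(\<Sum>k\<in>UNIV. q i $ k * (M *v x) $ k) = (\<Sum>j=i..<n. B $$ (i, j) * (\<Sum>k\<in>UNIV. q j $ k * x $ k))"
      unfolding q .
  next
    fix x :: "complex ^ 'n" assume z: "\<And>i. i < n \<Longrightarrow> (\<Sum>k\<in>UNIV. q i $ k * x $ k) = 0"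
    have "x $ f j = 0" if j: "j < n" for j
    proof -
      \<comment> \<open>Inserting 1 = P Q recovers x from the values of the rows of Q.\<close>
      have "x $ f j = (\<Sum>m=0..<n. (P * Q) $$ (j, m) * x $ f m)"
        unfolding PQ using j by (simp add: if_distrib[of "\<lambda>c. c * _"] cong: if_cong)
      also have "\<dots> = (\<Sum>i=0..<n. P $$ (j, i) * (\<Sum>m=0..<n. Q $$ (i, m) * x $ f m))"
        unfolding sum_distrib_left
        by (subst sum.swap) (auto simp: entry[OF P Q j] sum_distrib_left sum_distrib_right mult_ac intro!: sum.cong)
      also have "\<dots> = 0" using z by (simp add: q)
      finally show ?thesis .
    qed
    moreover have "\<exists>j<n. k = f j" for k
      using f by (force simp: bij_betw_def)
    ultimately show "x = 0" by (metis vec_eq_iff zero_index)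
  next
    fix i assume i: "i < n"
    have "es ! i = B $$ (i, i)" using i diag B by (auto simp: diag_mat_def)
    moreover have "es ! i \<in> set es" using i es by simp
    ultimately have "poly (char_poly A) (B $$ (i, i)) = 0"
      unfolding es by (auto simp: poly_prod_list prod_list_zero_iff image_iff intro!: bexI[of _ "es ! i"])
    then obtain v where v: "v \<in> carrier_vec n" "v \<noteq> 0\<^sub>v n" "A *\<^sub>v v = B $$ (i, i) \<cdot>\<^sub>v v"
      using eigenvalue_root_char_poly[OF A] A by (auto simp: eigenvalue_def eigenvector_def)
    define w :: "complex ^ 'n" where "w = (\<chi> k. vec_index v (pos k))"
    have w: "w $ f m = vec_index v m" if "m < n" for m using that by (simp add: w_def pos_f)
    have ex: "\<exists>j<n. k = f j" for k
      using f by (force simp: bij_betw_def)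
    have "w \<noteq> 0"
    proof
      assume "w = 0"
      then have "vec_index v m = 0" if "m < n" for m using w[OF that] by simp
      then have "v = 0\<^sub>v n" using v(1) by (intro eq_vecI) auto
      then show False using v(2) by simp
    qed
    moreover have "(M *v w) $ f m = (B $$ (i, i) *s w) $ f m" if m: "m < n" for m
    proof -
      have "(M *v w) $ f m = (\<Sum>l=0..<n. A $$ (m, l) * vec_index v l)"
        unfolding matrix_vector_mult_def sum_f using m by (auto simp: A_def w intro!: sum.cong)
      also have "\<dots> = vec_index (A *\<^sub>v v) m"
        using m A v(1) by (auto simp: scalar_prod_def intro!: sum.cong)
      also have "\<dots> = B $$ (i, i) * vec_index v m" using m v by simp
      finally show ?thesis using m by (simp add: w)
    qed
    then have "M *v w = B $$ (i, i) *s w" using ex by (metis vec_eq_iff)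
    ultimately show "\<exists>v. v \<noteq> 0 \<and> M *v v = B $$ (i, i) *s v" by blast
  qed
qed

text \<open>Each off-diagonal term costs at most \<eta> |z_i| |z_j|, which is split evenly between
  the two squares.\<close>

lemma triangular_form_lower_bound:
  fixes z :: "nat \<Rightarrow> complex" and b :: "nat \<Rightarrow> nat \<Rightarrow> complex"
  assumes diag: "\<And>i. i < n \<Longrightarrow> \<mu> \<le> Re (b i i)"
    and off: "\<And>i j. i < j \<Longrightarrow> j < n \<Longrightarrow> cmod (b i j) \<le> \<eta>" and "\<eta> \<ge> 0"
  shows "(\<mu> - real n * \<eta>) * (\<Sum>i<n. (cmod (z i))\<^sup>2)
    \<le> (\<Sum>i<n. Re (cnj (z i) * (\<Sum>j=i..<n. b i j * z j)))"
proof -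
  \<comment> \<open>The cost is summed over all j < n and not only over j > i: the double sum is
    then symmetric and collapses to n \<eta> times the sum of squares.\<close>
  have "\<mu> * (cmod (z i))\<^sup>2 - (\<Sum>j<n. \<eta> * ((cmod (z i))\<^sup>2 + (cmod (z j))\<^sup>2) / 2)
      \<le> Re (cnj (z i) * (\<Sum>j=i..<n. b i j * z j))" if i: "i < n" for i
  proof -
    have cross: "- (\<eta> * ((cmod (z i))\<^sup>2 + (cmod (z j))\<^sup>2) / 2) \<le> Re (cnj (z i) * (b i j * z j))"
      if "j \<in> {Suc i..<n}" for j
    proof -
      have "cmod (cnj (z i) * (b i j * z j)) = cmod (b i j) * (cmod (z i) * cmod (z j))"
        by (simp add: norm_mult)
      also have "\<dots> \<le> \<eta> * (cmod (z i) * cmod (z j))"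
        using off that by (intro mult_right_mono) auto
      also have "\<dots> \<le> \<eta> * (((cmod (z i))\<^sup>2 + (cmod (z j))\<^sup>2) / 2)"
        using sum_squares_bound[of "cmod (z i)" "cmod (z j)"] \<open>\<eta> \<ge> 0\<close>
        by (intro mult_left_mono) auto
      finally show ?thesis
        using abs_Re_le_cmod[of "cnj (z i) * (b i j * z j)"] by simp
    qed
    have "Re (cnj (z i) * (\<Sum>j=i..<n. b i j * z j))
        = Re (b i i) * (cmod (z i))\<^sup>2 + (\<Sum>j=Suc i..<n. Re (cnj (z i) * (b i j * z j)))"
    proof -
      have "cnj (z i) * (b i i * z i) = b i i * of_real ((cmod (z i))\<^sup>2)"
        using complex_norm_square[of "z i"] by (simp add: mult.commute mult.left_commute)
      then have "Re (cnj (z i) * (b i i * z i)) = Re (b i i) * (cmod (z i))\<^sup>2"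
        by (simp only: Re_complex_of_real Im_complex_of_real times_complex.sel mult_zero_right diff_zero)
      then show ?thesis
        using i by (simp add: sum.atLeast_Suc_lessThan distrib_left sum_distrib_left del: times_complex.sel)
    qed
    moreover have "\<mu> * (cmod (z i))\<^sup>2 \<le> Re (b i i) * (cmod (z i))\<^sup>2"
      using diag[OF i] by (intro mult_right_mono) auto
    moreover have "- (\<Sum>j<n. \<eta> * ((cmod (z i))\<^sup>2 + (cmod (z j))\<^sup>2) / 2)
        \<le> (\<Sum>j=Suc i..<n. Re (cnj (z i) * (b i j * z j)))"
    proof -
      have "(\<Sum>j=Suc i..<n. \<eta> * ((cmod (z i))\<^sup>2 + (cmod (z j))\<^sup>2) / 2)
          \<le> (\<Sum>j<n. \<eta> * ((cmod (z i))\<^sup>2 + (cmod (z j))\<^sup>2) / 2)"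
        using \<open>\<eta> \<ge> 0\<close> by (intro sum_mono2) auto
      moreover have "- (\<Sum>j=Suc i..<n. \<eta> * ((cmod (z i))\<^sup>2 + (cmod (z j))\<^sup>2) / 2)
          \<le> (\<Sum>j=Suc i..<n. Re (cnj (z i) * (b i j * z j)))"
        unfolding sum_negf[symmetric] by (intro sum_mono cross)
      ultimately show ?thesis by linarith
    qed
    ultimately show ?thesis by linarith
  qed
  then have "(\<Sum>i<n. \<mu> * (cmod (z i))\<^sup>2 - (\<Sum>j<n. \<eta> * ((cmod (z i))\<^sup>2 + (cmod (z j))\<^sup>2) / 2))
      \<le> (\<Sum>i<n. Re (cnj (z i) * (\<Sum>j=i..<n. b i j * z j)))"
    by (intro sum_mono) auto
  moreover have "(\<Sum>i<n. \<Sum>j<n. \<eta> * ((cmod (z i))\<^sup>2 + (cmod (z j))\<^sup>2) / 2)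
      = real n * \<eta> * (\<Sum>i<n. (cmod (z i))\<^sup>2)"
    by (simp add: sum.distrib distrib_left sum_distrib_left[symmetric] sum_divide_distrib[symmetric] add_divide_distrib)
  ultimately show ?thesis
    by (simp add: sum_subtractf sum_distrib_left[symmetric] left_diff_distrib)
qed

lemma scaled_triangularization:
  fixes M :: "complex ^ 'n ^ 'n"
  assumes "\<eta> > 0"
  obtains q :: "nat \<Rightarrow> complex ^ 'n" and b :: "nat \<Rightarrow> nat \<Rightarrow> complex" where
    "\<And>i x. i < CARD('n) \<Longrightarrow>
      (\<Sum>k\<in>UNIV. q i $ k * (M *v x) $ k) = (\<Sum>j=i..<CARD('n). b i j * (\<Sum>k\<in>UNIV. q j $ k * x $ k))"
    "\<And>x. (\<And>i. i < CARD('n) \<Longrightarrow> (\<Sum>k\<in>UNIV. q i $ k * x $ k) = 0) \<Longrightarrow> x = 0"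
    "\<And>i. i < CARD('n) \<Longrightarrow> \<exists>v. v \<noteq> 0 \<and> M *v v = b i i *s v"
    "\<And>i j. i < j \<Longrightarrow> j < CARD('n) \<Longrightarrow> cmod (b i j) \<le> \<eta>"
proof -
  define n where "n = CARD('n)"
  obtain q :: "nat \<Rightarrow> complex ^ 'n" and b where
    q: "\<And>i x. i < n \<Longrightarrow>
      (\<Sum>k\<in>UNIV. q i $ k * (M *v x) $ k) = (\<Sum>j=i..<n. b i j * (\<Sum>k\<in>UNIV. q j $ k * x $ k))"
    and inj: "\<And>x. (\<And>i. i < n \<Longrightarrow> (\<Sum>k\<in>UNIV. q i $ k * x $ k) = 0) \<Longrightarrow> x = 0"
    and ev: "\<And>i. i < n \<Longrightarrow> \<exists>v. v \<noteq> 0 \<and> M *v v = b i i *s v"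
    using complex_triangularization[of M] unfolding n_def by blast
  \<comment> \<open>Dominates every entry of the triangular form; the summand 1 keeps it positive,
    so that dividing by it is harmless.\<close>
  define S where "S = 1 + (\<Sum>i<n. \<Sum>j<n. cmod (b i j))"
  have S1: "S \<ge> 1" by (auto simp: S_def intro!: sum_nonneg)
  have bS: "cmod (b i j) \<le> S" if "i < n" "j < n" for i j
  proof -
    have "cmod (b i j) \<le> (\<Sum>j<n. cmod (b i j))"
      using that by (intro member_le_sum) auto
    also have "\<dots> \<le> (\<Sum>i<n. \<Sum>j<n. cmod (b i j))"
      using that by (intro member_le_sum[of i _ "\<lambda>i. \<Sum>j<n. cmod (b i j)"]) (auto intro: sum_nonneg)
    finally show ?thesis by (simp add: S_def)
  qed
  txt \<open>Rescaling the \<open>i\<close>-th functional by \<open>\<delta>\<^sup>-\<^sup>i\<close> multiplies the entry \<open>(i, j)\<close> by \<open>\<delta>\<^sup>j\<^sup>-\<^sup>i\<close>.\<close>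
  define \<delta> where "\<delta> = min 1 (\<eta> / S)"
  have \<delta>: "\<delta> > 0" "\<delta> \<le> 1" "\<delta> * S \<le> \<eta>"
    using assms S1 by (auto simp: \<delta>_def pos_le_divide_eq[symmetric])
  let ?s = "\<lambda>i::nat. complex_of_real (1 / \<delta> ^ i)"
  have s0: "?s i \<noteq> 0" for i using \<delta> by simp
  have sc: "(\<Sum>k\<in>UNIV. (\<chi> k. ?s i * q i $ k) $ k * x $ k) = ?s i * (\<Sum>k\<in>UNIV. q i $ k * x $ k)"
    for i and x :: "complex ^ 'n"
    by (simp add: sum_distrib_left mult_ac sum_divide_distrib)
  show ?thesis
  proof (rule that[of "\<lambda>i. \<chi> k. ?s i * q i $ k" "\<lambda>i j. ?s i * b i j / ?s j"], unfold n_def[symmetric] sc)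
    fix i and x :: "complex ^ 'n" assume i: "i < n"
    show "?s i * (\<Sum>k\<in>UNIV. q i $ k * (M *v x) $ k)
        = (\<Sum>j=i..<n. ?s i * b i j / ?s j * (?s j * (\<Sum>k\<in>UNIV. q j $ k * x $ k)))"
    proof -
      have "?s i * (b i j * y) = ?s i * b i j / ?s j * (?s j * y)" for j y
        using \<delta>(1) by simp
      then show ?thesis unfolding q[OF i] sum_distrib_left[of "?s i"] by (intro sum.cong) simp_all
    qed
  next
    fix x :: "complex ^ 'n"
    assume 0: "\<And>i. i < n \<Longrightarrow> ?s i * (\<Sum>k\<in>UNIV. q i $ k * x $ k) = 0"
    show "x = 0"
    proof (rule inj)
      fix i assume "i < n"
      from 0[OF this] s0[of i] show "(\<Sum>k\<in>UNIV. q i $ k * x $ k) = 0" by (simp only: mult_eq_0_iff) simp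
    qed
  next
    fix i assume "i < n"
    moreover have "?s i * b i i / ?s i = b i i"
      using s0[of i] by (rule nonzero_mult_div_cancel_left)
    ultimately show "\<exists>v. v \<noteq> 0 \<and> M *v v = (?s i * b i i / ?s i) *s v"
      using ev[of i] by simp
  next
    fix i j assume ij: "i < j" "j < n"
    have "cmod (?s i * b i j / ?s j) = \<delta> ^ (j - i) * cmod (b i j)"
      using \<delta> ij by (simp add: norm_mult norm_divide norm_power power_diff)
    also have "\<delta> ^ (j - i) \<le> \<delta> ^ 1"
      using \<delta> ij by (intro power_decreasing) auto
    then have "\<delta> ^ (j - i) * cmod (b i j) \<le> \<delta> * S"
      using bS[of i j] ij \<delta> by (intro mult_mono) auto
    finally show "cmod (?s i * b i j / ?s j) \<le> \<eta>" using \<delta> by simp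
  qed
qed

text \<open>For real x the real part of cnj (z_i(x)) z_i(N x) is the product of the real parts plus
  the product of the imaginary parts. Splitting each complex functional into these two parts turns
  the complex estimate into one with twice as many real functionals; the boolean in the index
  selects the part.\<close>

lemma adapted_functionals:
  fixes N :: "real ^ 'n ^ 'n"
  assumes spec: "\<And>z. is_eigenvalue N z \<Longrightarrow> \<mu> \<le> Re z" and \<epsilon>: "\<epsilon> > 0"
  obtains I :: "(nat \<times> bool) set" and R :: "nat \<times> bool \<Rightarrow> real ^ 'n" where
    "finite I" "\<And>x. (\<And>i. i \<in> I \<Longrightarrow> R i \<bullet> x = 0) \<Longrightarrow> x = 0"
    "\<And>x. (\<mu> - \<epsilon>) * (\<Sum>i\<in>I. (R i \<bullet> x)\<^sup>2) \<le> (\<Sum>i\<in>I. (R i \<bullet> x) * (R i \<bullet> (N *v x)))"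
proof -
  define n where "n = CARD('n)"
  have n: "real n > 0" by (simp add: n_def)
  \<comment> \<open>Cancels the factor n with which the off-diagonal entries enter the lower
    bound.\<close>
  define \<eta> where "\<eta> = \<epsilon> / real n"
  have \<eta>: "\<eta> > 0" "real n * \<eta> = \<epsilon>" using \<epsilon> n by (auto simp: \<eta>_def)
  define M where "M = map_matrix complex_of_real N"
  obtain q :: "nat \<Rightarrow> complex ^ 'n" and b where
    q: "\<And>i x. i < n \<Longrightarrow>
      (\<Sum>k\<in>UNIV. q i $ k * (M *v x) $ k) = (\<Sum>j=i..<n. b i j * (\<Sum>k\<in>UNIV. q j $ k * x $ k))"
    and inj: "\<And>x. (\<And>i. i < n \<Longrightarrow> (\<Sum>k\<in>UNIV. q i $ k * x $ k) = 0) \<Longrightarrow> x = 0"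
    and ev: "\<And>i. i < n \<Longrightarrow> \<exists>v. v \<noteq> 0 \<and> M *v v = b i i *s v"
    and off: "\<And>i j. i < j \<Longrightarrow> j < n \<Longrightarrow> cmod (b i j) \<le> \<eta>"
    using scaled_triangularization[OF \<eta>(1), of M] unfolding n_def by blast
  have diag: "\<mu> \<le> Re (b i i)" if "i < n" for i
    using ev[OF that] spec unfolding is_eigenvalue_def M_def by blast
  define R where "R p = (\<chi> k. if snd p then Re (q (fst p) $ k) else Im (q (fst p) $ k))" for p :: "nat \<times> bool"
  define c where "c x = (\<chi> k. complex_of_real (x $ k))" for x :: "real ^ 'n"
  define z where "z x i = (\<Sum>k\<in>UNIV. q i $ k * c x $ k)" for x i
  have Mc: "M *v c x = c (N *v x)" for x
    by (simp add: M_def c_def map_matrix_def matrix_vector_mult_def vec_eq_iff)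
  have R: "R (i, True) \<bullet> x = Re (z x i)" "R (i, False) \<bullet> x = Im (z x i)" for i x
    by (simp_all add: R_def z_def c_def inner_vec_def)
  define I :: "(nat \<times> bool) set" where "I = {..<n} \<times> UNIV"
  have sum_I: "(\<Sum>p\<in>I. h p) = (\<Sum>i<n. h (i, True) + h (i, False))" for h :: "nat \<times> bool \<Rightarrow> real"
    using sum.cartesian_product[of "\<lambda>i j. h (i, j)" "UNIV :: bool set" "{..<n}"]
    by (simp add: I_def UNIV_bool add.commute)
  show ?thesis
  proof (rule that[of I R])
    show "finite I" by (simp add: I_def)
  next
    fix x :: "real ^ 'n" assume 0: "\<And>p. p \<in> I \<Longrightarrow> R p \<bullet> x = 0"
    have "z x i = 0" if "i < n" for i
      using 0[of "(i, True)"] 0[of "(i, False)"] that unfolding R by (simp add: I_def complex_eq_iff)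
    then have "c x = 0" by (intro inj) (simp add: z_def)
    then show "x = 0" by (simp add: c_def vec_eq_iff)
  next
    fix x :: "real ^ 'n"
    have "(\<mu> - \<epsilon>) * (\<Sum>i<n. (cmod (z x i))\<^sup>2)
        \<le> (\<Sum>i<n. Re (cnj (z x i) * (\<Sum>j=i..<n. b i j * z x j)))"
      using triangular_form_lower_bound[of n \<mu> b \<eta> "z x"] diag off \<eta> by simp
    also have "\<dots> = (\<Sum>i<n. Re (cnj (z x i) * z (N *v x) i))"
      using q[of _ "c x"] by (intro sum.cong) (auto simp: Mc z_def)
    finally show "(\<mu> - \<epsilon>) * (\<Sum>p\<in>I. (R p \<bullet> x)\<^sup>2) \<le> (\<Sum>p\<in>I. (R p \<bullet> x) * (R p \<bullet> (N *v x)))"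
      unfolding sum_I R by (simp add: cmod_power2)
  qed
qed

section \<open>Laplacians of connected topologies\<close>

text \<open>Stated for a general algebra because eigenvectors have complex entries while the error
  coordinates are real. The absence of self-loops makes the diagonal entry fit the pattern of
  differences.\<close>

lemma laplacian_mult:
  assumes "adjacency A"
  shows "(map_matrix of_real (laplacian A) *v v) $ k
    = (\<Sum>j\<in>UNIV. of_real (A $ k $ j) * (v $ k - v $ j :: 'a :: {real_algebra_1, comm_ring_1}))"
proof -
  have "(map_matrix of_real (laplacian A) *v v) $ k = (\<Sum>j\<in>UNIV. of_real (laplacian A $ k $ j) * v $ j)"
    by (simp add: matrix_vector_mult_def map_matrix_def)
  also have "\<dots> = of_real (\<Sum>m\<in>UNIV. A $ k $ m) * v $ k - (\<Sum>j\<in>UNIV. of_real (A $ k $ j) * v $ j)"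
  proof -
    have "of_real (laplacian A $ k $ j) * v $ j
        = (if j = k then of_real (\<Sum>m\<in>UNIV. A $ k $ m) * v $ k else 0) - of_real (A $ k $ j) * v $ j" for j
      using assms by (simp add: laplacian_def adjacency_def)
    then show ?thesis by (simp only: sum_subtractf sum.delta finite) simp
  qed
  finally show ?thesis
    by (simp add: of_real_sum right_diff_distrib sum_subtractf sum_distrib_right)
qed

text \<open>Maximum principle: at a node with maximal value all summands of the vanishing sum are
  nonnegative, hence zero, so every node feeding it shares the value. The value thus travels from k
  against the edges of a path back to v.\<close>

lemma max_at_root:
  fixes x :: "'n::finite \<Rightarrow> real"
  assumes adj: "adjacency A" and reach: "k \<noteq> v \<longrightarrow> (\<exists>p. topology_path A v k p)"
    and max: "\<And>j. x j \<le> x k"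
    and harm: "\<And>k. (\<Sum>j\<in>UNIV. A $ k $ j * (x k - x j)) = 0"
  shows "x v = x k"
proof (cases "k = v")
  case False
  then obtain p where p: "p \<noteq> []" "hd p = v" "last p = k"
    and edge: "\<And>m. Suc m < length p \<Longrightarrow> (p ! Suc m, p ! m) \<in> edges A"
    using reach by (auto simp: topology_path_def)
  have step: "x j = x k" if "x i = x k" "(i, j) \<in> edges A" for i j
  proof -
    have "\<forall>j\<in>UNIV. A $ i $ j * (x i - x j) = 0"
      using harm[of i] adj max that by (subst sum_nonneg_eq_0_iff[symmetric]) (auto simp: adjacency_def)
    moreover have "A $ i $ j > 0" using that(2) by (simp add: edges_def)
    ultimately show ?thesis using that(1) by (metis UNIV_I eq_iff_diff_eq_0 less_irrefl mult_eq_0_iff)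
  qed
  \<comment> \<open>Here m counts nodes backwards from the end k of the path.\<close>
  have "m < length p \<Longrightarrow> x (p ! (length p - Suc m)) = x k" for m
  proof (induction m)
    case 0
    then show ?case using p by (simp add: last_conv_nth)
  next
    case (Suc m)
    define i where "i = length p - Suc (Suc m)"
    have i: "Suc i = length p - Suc m" "Suc i < length p" using Suc.prems by (auto simp: i_def)
    have "x (p ! Suc i) = x k" using Suc.IH Suc.prems unfolding i(1) by simp
    from step[OF this edge[OF i(2)]] show ?case unfolding i_def .
  qed
  from this[of "length p - 1"] show ?thesis using p by (cases p) auto
qed auto

text \<open>At a maximum \<alpha> is nonnegative and at a minimum nonpositive, so it is 0. The root
  then carries both the maximum and the minimum. Allowing \<alpha> \<noteq> 0 in the hypothesis is
  what excludes a Jordan block of the eigenvalue 0.\<close>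

lemma laplacian_constant_image:
  fixes x :: "'n::finite \<Rightarrow> real"
  assumes adj: "adjacency A" and conn: "connected_topology A"
    and eq: "\<And>k. (\<Sum>j\<in>UNIV. A $ k $ j * (x k - x j)) = \<alpha>"
  shows "x i = x j"
proof -
  have "Max (range x) \<in> range x" "Min (range x) \<in> range x" by (intro Max_in Min_in; simp)+
  then obtain kmax kmin where k: "x kmax = Max (range x)" "x kmin = Min (range x)" by force
  have max: "x j \<le> x kmax" and min: "x kmin \<le> x j" for j unfolding k by simp_all
  have "0 \<le> (\<Sum>j\<in>UNIV. A $ kmax $ j * (x kmax - x j))"
    using adj max by (intro sum_nonneg mult_nonneg_nonneg) (auto simp: adjacency_def)
  moreover have "(\<Sum>j\<in>UNIV. A $ kmin $ j * (x kmin - x j)) \<le> 0"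
    using adj min by (intro sum_nonpos mult_nonneg_nonpos) (auto simp: adjacency_def)
  ultimately have "\<alpha> = 0" using eq[of kmax] eq[of kmin] by simp
  with eq have harm: "(\<Sum>j\<in>UNIV. A $ k $ j * (x k - x j)) = 0" for k by simp
  obtain v where v: "\<And>u. u \<noteq> v \<longrightarrow> (\<exists>p. topology_path A v u p)"
    using conn by (auto simp: connected_topology_def)
  have "x v = x kmax" using max_at_root[OF adj v max harm] .
  moreover have "- x v = - x kmin"
  proof (rule max_at_root[OF adj v])
    fix k
    have "(\<Sum>j\<in>UNIV. A $ k $ j * (- x k - - x j)) = - (\<Sum>j\<in>UNIV. A $ k $ j * (x k - x j))"
      unfolding sum_negf[symmetric] by (intro sum.cong) (auto simp: algebra_simps)
    then show "(\<Sum>j\<in>UNIV. A $ k $ j * (- x k - - x j)) = 0" using harm by simp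
  qed (use min in auto)
  ultimately show ?thesis using max[of i] max[of j] min[of i] min[of j] by linarith
qed

definition reduced_laplacian :: "'n \<Rightarrow> real \<Rightarrow> real ^ 'n ^ 'n \<Rightarrow> real ^ 'n ^ 'n" where
  "reduced_laplacian r \<mu> A =
     (\<chi> k j. laplacian A $ k $ j - laplacian A $ r $ j + (if k = r \<and> j = r then \<mu> else 0))"

text \<open>
  On vectors vanishing at \<open>r\<close> the \<open>\<mu>\<close> entry is invisible; it only moves the
  eigenvalue 0 caused by the vanishing row \<open>r\<close> to \<open>\<mu>\<close>.
\<close>

lemma reduced_laplacian_eigenvalue:
  assumes adj: "adjacency A" and conn: "connected_topology A"
    and spec: "\<And>z. is_eigenvalue (laplacian A) z \<Longrightarrow> z \<noteq> 0 \<Longrightarrow> \<mu> \<le> Re z"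
    and z: "is_eigenvalue (reduced_laplacian r \<mu> A) z"
  shows "\<mu> \<le> Re z"
proof -
  let ?L = "map_matrix complex_of_real (laplacian A)"
  obtain v where v: "v \<noteq> 0" "map_matrix complex_of_real (reduced_laplacian r \<mu> A) *v v = z *s v"
    using z by (auto simp: is_eigenvalue_def)
  have "(map_matrix complex_of_real (reduced_laplacian r \<mu> A) *v v) $ k
      = (?L *v v) $ k - (?L *v v) $ r + (if k = r then of_real \<mu> * v $ r else 0)" for k
  proof -
    have "complex_of_real (reduced_laplacian r \<mu> A $ k $ j) * v $ j
       = of_real (laplacian A $ k $ j) * v $ j - of_real (laplacian A $ r $ j) * v $ j
         + (if j = r then if k = r then of_real \<mu> * v $ r else 0 else 0)" for j
      by (simp add: reduced_laplacian_def algebra_simps)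
    then show ?thesis
      by (simp add: matrix_vector_mult_def map_matrix_def sum.distrib sum_subtractf)
  qed
  then have eq: "(?L *v v) $ k - (?L *v v) $ r + (if k = r then of_real \<mu> * v $ r else 0) = z * v $ k" for k
    using v(2) by (metis vector_smult_component)
  show ?thesis
  proof (cases "v $ r = 0")
    \<comment> \<open>Row r of the difference vanishes, so the eigenvalue equation at r reduces to
      the entry \<mu>.\<close>
    case False
    then have "z = of_real \<mu>" using eq[of r] by simp
    then show ?thesis by simp
  next
    case r: True
    \<comment> \<open>With v vanishing at r, the eigenvalue equation says that L v is z v plus the
      constant \<beta>.\<close>
    define \<beta> where "\<beta> = (?L *v v) $ r"
    have Lv: "(?L *v v) $ k = z * v $ k + \<beta>" for k
      using eq[of k] r by (simp add: \<beta>_def algebra_simps split: if_splits)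
    show ?thesis
    proof (cases "z = 0")
      \<comment> \<open>The real and the imaginary part of v are mapped by L to constants, so they
        are constant themselves, and they vanish at r.\<close>
      case True
      have const: "(\<Sum>j\<in>UNIV. complex_of_real (A $ k $ j) * (v $ k - v $ j)) = \<beta>" for k
        using Lv[of k] True unfolding laplacian_mult[OF adj] by simp
      have "(\<Sum>j\<in>UNIV. A $ k $ j * (Re (v $ k) - Re (v $ j))) = Re \<beta>"
        "(\<Sum>j\<in>UNIV. A $ k $ j * (Im (v $ k) - Im (v $ j))) = Im \<beta>" for k
        unfolding const[of k, symmetric] by simp_all
      from laplacian_constant_image[OF adj conn this(1), of _ r]
        laplacian_constant_image[OF adj conn this(2), of _ r]
      have "v $ k = 0" for k using r by (simp add: complex_eq_iff)
      then show ?thesis using v(1) by (simp add: vec_eq_iff)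
    next
      case False
      \<comment> \<open>L kills constants, so shifting v by \<beta> / z absorbs \<beta> and leaves a
        true eigenvector of L.\<close>
      define x where "x = v + vec (\<beta> / z)"
      have "(?L *v x) $ k = (?L *v v) $ k" for k
        unfolding laplacian_mult[OF adj] by (simp add: x_def)
      then have "?L *v x = z *s x"
        using False by (simp add: vec_eq_iff Lv x_def distrib_left)
      moreover have "x \<noteq> 0"
      proof
        assume "x = 0"
        then have x: "v $ k + \<beta> / z = 0" for k by (simp add: x_def vec_eq_iff)
        from x[of r] r have "\<beta> / z = 0" by simp
        with x have "v $ k = 0" for k by simp
        then show False using v(1) by (simp add: vec_eq_iff)
      qed
      ultimately show ?thesis using spec False by (auto simp: is_eigenvalue_def)
    qed
  qed
qed

section \<open>Decay of the error dynamics under one topology\<close>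

lemma quadratic_upper_bound:
  fixes q :: "'a::euclidean_space \<Rightarrow> real"
  assumes cont: "continuous_on UNIV q" and hom: "\<And>t x. q (t *\<^sub>R x) = t\<^sup>2 * q x"
  obtains m where "m > 0" "\<And>x. q x \<le> m * (norm x)\<^sup>2"
proof -
  have "compact (q ` sphere 0 1)"
    using continuous_on_subset[OF cont] by (intro compact_continuous_image) auto
  then obtain m where m: "\<And>x. norm x = 1 \<Longrightarrow> \<bar>q x\<bar> \<le> m"
    by (force dest!: compact_imp_bounded simp: bounded_iff)
  have "q x \<le> (\<bar>m\<bar> + 1) * (norm x)\<^sup>2" for x
  proof (cases "x = 0")
    case True
    then show ?thesis using hom[of 0 x] by simp
  next
    case False
    have "q x = (norm x)\<^sup>2 * q (x /\<^sub>R norm x)" using hom[of "norm x" "x /\<^sub>R norm x"] False by simp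
    also have "\<dots> \<le> (norm x)\<^sup>2 * (\<bar>m\<bar> + 1)"
      using m[of "x /\<^sub>R norm x"] False by (intro mult_left_mono) auto
    finally show ?thesis by (simp add: mult.commute)
  qed
  then show ?thesis by (intro that[of "\<bar>m\<bar> + 1"]) auto
qed

lemma quadratic_lower_bound:
  fixes q :: "'a::euclidean_space \<Rightarrow> real"
  assumes cont: "continuous_on UNIV q" and hom: "\<And>t x. q (t *\<^sub>R x) = t\<^sup>2 * q x"
    and pos: "\<And>x. x \<noteq> 0 \<Longrightarrow> q x > 0"
  obtains m where "m > 0" "\<And>x. m * (norm x)\<^sup>2 \<le> q x"
proof -
  have "sphere (0 :: 'a) 1 \<noteq> {}" by simp
  then obtain y where y: "norm y = 1" "\<And>x. norm x = 1 \<Longrightarrow> q y \<le> q x"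
    using continuous_attains_inf[of "sphere 0 1" q] continuous_on_subset[OF cont] by auto
  have "q y * (norm x)\<^sup>2 \<le> q x" for x
  proof (cases "x = 0")
    case True
    then show ?thesis using hom[of 0 x] by simp
  next
    case False
    have "q x = (norm x)\<^sup>2 * q (x /\<^sub>R norm x)" using hom[of "norm x" "x /\<^sub>R norm x"] False by simp
    moreover have "(norm x)\<^sup>2 * q y \<le> (norm x)\<^sup>2 * q (x /\<^sub>R norm x)"
      using y(2)[of "x /\<^sub>R norm x"] False by (intro mult_left_mono) auto
    ultimately show ?thesis by (simp add: mult.commute)
  qed
  moreover have "q y > 0" using y(1) by (intro pos) auto
  ultimately show ?thesis using that by blast
qed

text \<open>Weighted by exp (- \<alpha> (u - s)), the function h is nonincreasing. The finite set D
  admits times at which a solution is not differentiable; continuity bridges them.\<close>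

lemma exponential_estimate:
  fixes h h' :: "real \<Rightarrow> real"
  assumes st: "s \<le> t" and D: "finite D" and cont: "continuous_on {s..t} h"
    and deriv: "\<And>u. u \<in> {s<..<t} - D \<Longrightarrow> (h has_vector_derivative h' u) (at u)"
    and bound: "\<And>u. u \<in> {s<..<t} - D \<Longrightarrow> h' u \<le> \<alpha> * h u"
  shows "h t \<le> exp (\<alpha> * (t - s)) * h s"
proof -
  define f where "f u = exp (- \<alpha> * (u - s)) * h u" for u
  \<comment> \<open>Set to 0 on D and outside the open interval, so that f' \<le> 0 everywhere and
    the integral comparison has no exceptional points.\<close>
  define f' where "f' u = (if u \<in> {s<..<t} - D then exp (- \<alpha> * (u - s)) * (h' u - \<alpha> * h u) else 0)" for u
  have "(f has_vector_derivative f' u) (at u)" if "u \<in> {s<..<t} - D" for u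
  proof -
    have "(h has_real_derivative h' u) (at u)"
      using deriv[OF that] by (simp add: has_real_derivative_iff_has_vector_derivative)
    then have "(f has_real_derivative f' u) (at u)"
      unfolding f_def f'_def using that by (auto intro!: derivative_eq_intros simp: algebra_simps)
    then show ?thesis by (simp add: has_real_derivative_iff_has_vector_derivative)
  qed
  moreover have "continuous_on {s..t} f"
    unfolding f_def using cont by (intro continuous_intros)
  ultimately have "(f' has_integral (f t - f s)) {s..t}"
    using st D by (intro fundamental_theorem_of_calculus_interior_strong) auto
  moreover have "f' u \<le> 0" for u
    using bound[of u] by (auto simp: f'_def intro!: mult_nonneg_nonpos)
  ultimately have "f t - f s \<le> 0"
    by - (rule has_integral_le[of f' _ "{s..t}" "\<lambda>_. 0"], auto)
  then have "exp (- \<alpha> * (t - s)) * h t \<le> h s" by (simp add: f_def)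
  then have "exp (\<alpha> * (t - s)) * (exp (- \<alpha> * (t - s)) * h t) \<le> exp (\<alpha> * (t - s)) * h s"
    by (intro mult_left_mono) auto
  then show ?thesis by (simp add: mult.assoc[symmetric] exp_add[symmetric])
qed

text \<open>The only row of \<open>C_mat\<close>, kept as a vector so that the output of a node
  becomes an inner product.\<close>

definition c_vec :: "real ^ 'd::{finite,linorder}" where
  "c_vec = (\<chi> i. if idx i = 1 then 1 else 0)"

text \<open>In Kronecker notation, g (I (x) S - N (x) P C^T C) applied to \<xi>.\<close>

definition error_field ::
  "real \<Rightarrow> real ^ 'd::{finite,linorder} ^ 'd::{finite,linorder} \<Rightarrow> real ^ 'n ^ 'n \<Rightarrow>
   real ^ 'd::{finite,linorder} ^ 'n \<Rightarrow> real ^ 'd::{finite,linorder} ^ 'n" where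
  "error_field g P N \<xi> =
     (\<chi> k. g *\<^sub>R (shift_mat *v \<xi> $ k - (\<Sum>j\<in>UNIV. N $ k $ j * (c_vec \<bullet> \<xi> $ j)) *\<^sub>R (P *v c_vec)))"

text \<open>A differential inequality instead of the equation with \<phi>: the estimates of growth
  and decay then need only the field f and the relative size l of the deviation.\<close>

definition perturbed_solution ::
  "real \<Rightarrow> ('a \<Rightarrow> 'a) \<Rightarrow> real \<Rightarrow> real \<Rightarrow> (real \<Rightarrow> 'a::real_normed_vector) \<Rightarrow> bool" where
  "perturbed_solution l f s t \<xi> \<longleftrightarrow> continuous_on {s..t} \<xi> \<and>
     (\<exists>D \<xi>'. finite D \<and> (\<forall>u\<in>{s<..<t} - D. (\<xi> has_vector_derivative \<xi>' u) (at u) \<and>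
        norm (\<xi>' u - f (\<xi> u)) \<le> l * norm (\<xi> u)))"

text \<open>The rate \<rho> is a bound for the field at g = 1 plus l; since g \<ge> 1, the
  perturbation also fits under a rate proportional to g. No spectral condition enters, so every
  topology is covered.\<close>

lemma error_field_growth:
  fixes P :: "real ^ 'd::{finite,linorder} ^ 'd::{finite,linorder}" and N :: "real ^ 'n ^ 'n"
  assumes "l \<ge> 0"
  obtains \<rho> where "\<rho> > 0" "\<And>g s t \<xi>. g \<ge> 1 \<Longrightarrow> s \<le> t \<Longrightarrow>
    perturbed_solution l (error_field g P N) s t \<xi> \<Longrightarrow> norm (\<xi> t) \<le> exp (\<rho> * g * (t - s)) * norm (\<xi> s)"
proof -
  have lin: "linear (error_field 1 P N)"
    by (rule linearI) (simp_all add: error_field_def vec_eq_iff matrix_vector_right_distrib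
      inner_add_right distrib_left sum.distrib algebra_simps sum_distrib_left matrix_vector_mult_scaleR)
  then obtain K where K: "K > 0" "\<And>\<xi>. norm (error_field 1 P N \<xi>) \<le> K * norm \<xi>"
    using linear_conv_bounded_linear[THEN iffD1, OF lin, THEN bounded_linear.pos_bounded]
    by (metis mult.commute)
  have scale: "error_field g P N \<xi> = g *\<^sub>R error_field 1 P N \<xi>" for g \<xi>
    by (simp add: error_field_def vec_eq_iff)
  define \<rho> where "\<rho> = K + l"
  show ?thesis
  proof (rule that[of \<rho>])
    show "\<rho> > 0" using K assms by (simp add: \<rho>_def)
  next
    fix g s t :: real and \<xi> :: "real \<Rightarrow> real ^ 'd::{finite,linorder} ^ 'n"
    assume g: "g \<ge> 1" and st: "s \<le> t" and sol: "perturbed_solution l (error_field g P N) s t \<xi>"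
    obtain D \<xi>' where cont: "continuous_on {s..t} \<xi>" and D: "finite D"
      and deriv: "\<And>u. u \<in> {s<..<t} - D \<Longrightarrow> (\<xi> has_vector_derivative \<xi>' u) (at u)"
      and near: "\<And>u. u \<in> {s<..<t} - D \<Longrightarrow> norm (\<xi>' u - error_field g P N (\<xi> u)) \<le> l * norm (\<xi> u)"
      using sol unfolding perturbed_solution_def by blast
    \<comment> \<open>The square is estimated because the norm itself is not differentiable at
      0.\<close>
    have "(norm (\<xi> t))\<^sup>2 \<le> exp (2 * \<rho> * g * (t - s)) * (norm (\<xi> s))\<^sup>2"
    proof (rule exponential_estimate[OF st D])
      show "continuous_on {s..t} (\<lambda>u. (norm (\<xi> u))\<^sup>2)" using cont by (intro continuous_intros)
    next
      fix u assume u: "u \<in> {s<..<t} - D"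
      show "((\<lambda>u. (norm (\<xi> u))\<^sup>2) has_vector_derivative 2 * (\<xi> u \<bullet> \<xi>' u)) (at u)"
        unfolding power2_norm_eq_inner
        using bounded_bilinear.has_vector_derivative[OF bounded_bilinear_inner deriv[OF u] deriv[OF u]]
        by (simp add: inner_commute)
      have "norm (\<xi>' u) \<le> norm (error_field g P N (\<xi> u)) + norm (\<xi>' u - error_field g P N (\<xi> u))"
        by (metis add.commute diff_add_cancel norm_triangle_ineq)
      also have "norm (error_field g P N (\<xi> u)) \<le> g * (K * norm (\<xi> u))"
        using g K(2)[of "\<xi> u"] by (simp add: scale[of g])
      also note near[OF u]
      also have "l * norm (\<xi> u) \<le> g * (l * norm (\<xi> u))"
        using mult_right_mono[OF g, of "l * norm (\<xi> u)"] assms by simp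
      finally have "norm (\<xi>' u) \<le> \<rho> * g * norm (\<xi> u)"
        by (simp add: \<rho>_def algebra_simps)
      then have "\<xi> u \<bullet> \<xi>' u \<le> norm (\<xi> u) * (\<rho> * g * norm (\<xi> u))"
        using norm_cauchy_schwarz[of "\<xi> u" "\<xi>' u"] by (meson mult_left_mono norm_ge_zero order_trans)
      then show "2 * (\<xi> u \<bullet> \<xi>' u) \<le> 2 * \<rho> * g * (norm (\<xi> u))\<^sup>2"
        by (simp add: power2_eq_square mult_ac)
    qed
    also have "\<dots> = (exp (\<rho> * g * (t - s)) * norm (\<xi> s))\<^sup>2"
      by (simp add: power_mult_distrib exp_double[symmetric] mult_ac)
    finally show "norm (\<xi> t) \<le> exp (\<rho> * g * (t - s)) * norm (\<xi> s)"
      by (rule power2_le_imp_le) simp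
  qed
qed

text \<open>The functional v acting on each of the d coordinates separately, that is v^T (x)
  I.\<close>

definition combine :: "real ^ 'n \<Rightarrow> real ^ 'd ^ 'n \<Rightarrow> real ^ 'd" where
  "combine v \<xi> = (\<Sum>k\<in>UNIV. v $ k *\<^sub>R \<xi> $ k)"

lemma linear_combine: "linear (combine v)"
  by (rule linearI) (simp_all add: combine_def scaleR_add_right sum.distrib scaleR_sum_right mult.commute)

lemma inner_combine: "c \<bullet> combine v \<xi> = v \<bullet> (\<chi> k. c \<bullet> \<xi> $ k)"
  by (simp add: combine_def inner_sum_right inner_vec_def[of v])

text \<open>The functionals separate points of the node space. Applied coordinate by coordinate,
  this makes the sum of squares a positive definite form in \<xi>, and compactness of the unit
  sphere gives m.\<close>

lemma norm_combine_lower_bound: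
  fixes R :: "'i \<Rightarrow> real ^ 'n"
  assumes I: "finite I" and inj: "\<And>x. (\<And>i. i \<in> I \<Longrightarrow> R i \<bullet> x = 0) \<Longrightarrow> x = 0"
  obtains m where "m > 0" "\<And>\<xi> :: real ^ 'd ^ 'n. m * (norm \<xi>)\<^sup>2 \<le> (\<Sum>i\<in>I. (norm (combine (R i) \<xi>))\<^sup>2)"
proof (rule quadratic_lower_bound)
  show "continuous_on UNIV (\<lambda>\<xi> :: real ^ 'd ^ 'n. \<Sum>i\<in>I. (norm (combine (R i) \<xi>))\<^sup>2)"
    unfolding combine_def by (intro continuous_intros)
  show "(\<Sum>i\<in>I. (norm (combine (R i) (t *\<^sub>R \<xi>)))\<^sup>2) = t\<^sup>2 * (\<Sum>i\<in>I. (norm (combine (R i) \<xi>))\<^sup>2)"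
    for t and \<xi> :: "real ^ 'd ^ 'n"
    by (simp add: linear_cmul[OF linear_combine] power_mult_distrib sum_distrib_left)
  fix \<xi> :: "real ^ 'd ^ 'n" assume "\<xi> \<noteq> 0"
  have "\<exists>i\<in>I. combine (R i) \<xi> \<noteq> 0"
  proof (rule ccontr)
    assume "\<not> ?thesis"
    then have "R i \<bullet> (\<chi> k. axis l 1 \<bullet> \<xi> $ k) = 0" if "i \<in> I" for i l
      using that by (simp flip: inner_combine)
    from inj[OF this] have "(\<chi> k. axis l 1 \<bullet> \<xi> $ k) = 0" for l by blast
    then show False using \<open>\<xi> \<noteq> 0\<close> by (simp add: vec_eq_iff inner_axis')
  qed
  then show "0 < (\<Sum>i\<in>I. (norm (combine (R i) \<xi>))\<^sup>2)"
    using I by (auto intro!: sum_pos2)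
qed (use that in blast)

lemma sym_pos_def_inverse:
  fixes P :: "real ^ 'd ^ 'd"
  assumes "sym_pos_def P"
  obtains Q where "\<And>x. P *v (Q *v x) = x" "\<And>x y. (Q *v x) \<bullet> y = x \<bullet> (Q *v y)"
proof -
  have sym: "(P *v x) \<bullet> y = x \<bullet> (P *v y)" for x y
    using assms dot_lmul_matrix[of x P y] by (simp add: sym_pos_def_def flip: transpose_matrix_vector)
  have "P *v x = 0 \<Longrightarrow> x = 0" for x
    using assms by (metis inner_zero_right less_irrefl sym_pos_def_def)
  then obtain Q where "Q ** P = mat 1"
    using matrix_left_invertible_ker[of P] by blast
  then have PQ: "P ** Q = mat 1" by (simp add: matrix_left_right_inverse)
  then have PQx: "P *v (Q *v x) = x" for x by (simp add: matrix_vector_mul_assoc)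
  moreover have "(Q *v x) \<bullet> y = x \<bullet> (Q *v y)" for x y
    using sym[of "Q *v x" "Q *v y"] by (simp add: PQx)
  ultimately show ?thesis using that by blast
qed

lemma norm_matrix_vector_le:
  obtains K where "K > 0" "\<And>x. norm ((M :: real ^ 'm ^ 'k) *v x) \<le> K * norm x"
  using bounded_linear.pos_bounded[OF matrix_vector_mul_bounded_linear[of M]]
  by (metis mult.commute)

text \<open>Testing the matrix equation with z on both sides merges the two shift terms, by symmetry
  of P. With z the image of a state under the inverse of P, this is the form in which that inverse
  serves as a Lyapunov matrix.\<close>

lemma riccati_inner:
  fixes P :: "real ^ 'd::{finite,linorder} ^ 'd::{finite,linorder}"
  assumes P: "transpose P = P"
    and riccati: "shift_mat ** P + P ** transpose shift_mat
        - (2 * \<mu>) *\<^sub>R (P ** transpose C_mat ** C_mat ** P) + a *\<^sub>R mat 1 = 0"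
  shows "2 * (z \<bullet> (shift_mat *v (P *v z))) = 2 * \<mu> * (c_vec \<bullet> (P *v z))\<^sup>2 - a * (norm z)\<^sup>2"
proof -
  have sym: "(P *v x) \<bullet> y = x \<bullet> (P *v y)" for x y
    using P dot_lmul_matrix[of x P y] by (simp flip: transpose_matrix_vector)
  have C: "(C_mat *v x) \<bullet> (C_mat *v y) = (c_vec \<bullet> x) * (c_vec \<bullet> y)" for x y :: "real ^ 'd::{finite,linorder}"
    by (simp add: inner_vec_def C_mat_def c_vec_def matrix_vector_mult_def)
  have tr: "x \<bullet> (transpose M *v y) = (M *v x) \<bullet> y" for M :: "real ^ 'x ^ 'y" and x y
    by (metis dot_lmul_matrix inner_commute transpose_matrix_vector)
  have "0 = z \<bullet> ((shift_mat ** P + P ** transpose shift_mat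
        - (2 * \<mu>) *\<^sub>R (P ** transpose C_mat ** C_mat ** P) + a *\<^sub>R mat 1) *v z)"
    unfolding riccati by simp
  also have "\<dots> = z \<bullet> (shift_mat *v (P *v z)) + (P *v z) \<bullet> (transpose shift_mat *v z)
      - 2 * \<mu> * ((P *v z) \<bullet> (transpose C_mat *v (C_mat *v (P *v z)))) + a * (z \<bullet> z)"
    by (simp add: matrix_vector_mult_add_rdistrib matrix_vector_mult_diff_rdistrib scaleR_matrix_vector_assoc[symmetric]
        matrix_vector_mul_assoc[symmetric] inner_add_right inner_diff_right sym)
  finally show ?thesis
    unfolding tr C power2_norm_eq_inner by (simp add: inner_commute power2_eq_square)
qed

text \<open>
  The coupling enters only through the scalars \<open>c \<bullet> \<xi>\<^sub>k\<close>, so the scalar inequality for the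
  functionals \<open>R\<^sub>i\<close> can be combined with the Riccati equation without Kronecker products.
\<close>

lemma lyapunov_rate:
  fixes P :: "real ^ 'd::{finite,linorder} ^ 'd::{finite,linorder}" and N :: "real ^ 'n ^ 'n"
    and R :: "'i \<Rightarrow> real ^ 'n" and \<xi> \<eta> :: "real ^ 'd::{finite,linorder} ^ 'n"
  assumes P: "transpose P = P"
    and riccati: "shift_mat ** P + P ** transpose shift_mat
        - (2 * \<mu>) *\<^sub>R (P ** transpose C_mat ** C_mat ** P) + a *\<^sub>R mat 1 = 0"
    and PQ: "\<And>x. P *v (Q *v x) = x"
    and R: "\<And>x. (\<mu> - \<epsilon>) * (\<Sum>i\<in>I. (R i \<bullet> x)\<^sup>2) \<le> (\<Sum>i\<in>I. (R i \<bullet> x) * (R i \<bullet> (N *v x)))"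
    and \<epsilon>: "\<epsilon> \<ge> 0" "4 * \<epsilon> * (norm (P *v c_vec))\<^sup>2 \<le> a" and g: "g \<ge> 0"
  defines "z \<equiv> \<lambda>i. Q *v combine (R i) \<xi>"
  shows "2 * (\<Sum>i\<in>I. z i \<bullet> combine (R i) \<eta>) \<le> (1 - g * a / 2) * (\<Sum>i\<in>I. (norm (z i))\<^sup>2)
    + (\<Sum>i\<in>I. (norm (combine (R i) (\<eta> - error_field g P N \<xi>)))\<^sup>2)"
proof -
  define x where "x = (\<chi> k. c_vec \<bullet> \<xi> $ k)"
  define p where "p = \<eta> - error_field g P N \<xi>"
  have sym: "(P *v x) \<bullet> y = x \<bullet> (P *v y)" for x y
    using P dot_lmul_matrix[of x P y] by (simp flip: transpose_matrix_vector)
  have Pz: "P *v z i = combine (R i) \<xi>" for i by (simp add: z_def PQ)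
  \<comment> \<open>The Riccati term and the coupling see the state through the same scalar
    \<open>R i \<bullet> x\<close>; this is what lets the \<mu> terms cancel.\<close>
  have x: "c_vec \<bullet> (P *v z i) = R i \<bullet> x" for i
    unfolding Pz inner_combine x_def ..
  have comb: "combine (R i) (error_field g P N \<xi>)
      = g *\<^sub>R (shift_mat *v (P *v z i) - (R i \<bullet> (N *v x)) *\<^sub>R (P *v c_vec))" for i
  proof -
    have "shift_mat *v combine (R i) \<xi> = (\<Sum>k\<in>UNIV. R i $ k *\<^sub>R (shift_mat *v \<xi> $ k))"
      unfolding combine_def by (simp add: linear_sum[OF matrix_vector_mul_linear] matrix_vector_mult_scaleR)
    moreover have "error_field g P N \<xi> $ k = g *\<^sub>R (shift_mat *v \<xi> $ k - (N *v x) $ k *\<^sub>R (P *v c_vec))" for k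
      by (simp add: error_field_def matrix_vector_mult_def[of N] x_def)
    ultimately show ?thesis
      unfolding Pz
      by (simp add: combine_def scaleR_diff_right sum_subtractf scaleR_sum_right inner_vec_def[of "R i"]
          scaleR_sum_left mult_ac)
  qed
  have term_bound: "2 * (z i \<bullet> combine (R i) \<eta>) \<le> g * (2 * \<mu> * (R i \<bullet> x)\<^sup>2 - a * (norm (z i))\<^sup>2
      - 2 * ((R i \<bullet> x) * (R i \<bullet> (N *v x)))) + (norm (z i))\<^sup>2 + (norm (combine (R i) p))\<^sup>2" for i
  proof -
    have \<eta>: "combine (R i) \<eta> = combine (R i) (error_field g P N \<xi>) + combine (R i) p"
      unfolding p_def by (simp add: linear_diff[OF linear_combine])
    have "2 * (z i \<bullet> combine (R i) \<eta>) = g * (2 * (z i \<bullet> (shift_mat *v (P *v z i)))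
        - 2 * ((R i \<bullet> (N *v x)) * (z i \<bullet> (P *v c_vec)))) + 2 * (z i \<bullet> combine (R i) p)"
      unfolding \<eta> comb by (simp add: inner_add_right inner_diff_right algebra_simps)
    also have "z i \<bullet> (P *v c_vec) = R i \<bullet> x"
      using x[of i] sym[of "z i" c_vec] by (simp add: inner_commute)
    also note riccati_inner[OF P riccati, of "z i"]
    also note x[of i]
    \<comment> \<open>Young's inequality; the square of \<open>z i\<close> becomes the 1 in the
      factor 1 - g a / 2.\<close>
    also have "2 * (z i \<bullet> combine (R i) p) \<le> (norm (z i))\<^sup>2 + (norm (combine (R i) p))\<^sup>2"
      using norm_cauchy_schwarz[of "z i" "combine (R i) p"]
        sum_squares_bound[of "norm (z i)" "norm (combine (R i) p)"] by linarith
    finally show ?thesis by (simp add: mult_ac)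
  qed
  have "2 * (\<Sum>i\<in>I. z i \<bullet> combine (R i) \<eta>) \<le> (\<Sum>i\<in>I. g * (2 * \<mu> * (R i \<bullet> x)\<^sup>2 - a * (norm (z i))\<^sup>2
      - 2 * ((R i \<bullet> x) * (R i \<bullet> (N *v x)))) + (norm (z i))\<^sup>2 + (norm (combine (R i) p))\<^sup>2)"
    unfolding sum_distrib_left by (intro sum_mono term_bound)
  also have "\<dots> = g * (2 * \<mu> * (\<Sum>i\<in>I. (R i \<bullet> x)\<^sup>2) - a * (\<Sum>i\<in>I. (norm (z i))\<^sup>2)
      - 2 * (\<Sum>i\<in>I. (R i \<bullet> x) * (R i \<bullet> (N *v x)))) + (\<Sum>i\<in>I. (norm (z i))\<^sup>2)
      + (\<Sum>i\<in>I. (norm (combine (R i) p))\<^sup>2)"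
    by (simp add: sum.distrib sum_subtractf sum_distrib_left[symmetric])
  \<comment> \<open>The inequality for R leaves 2 \<epsilon> times the sum of the squares of
    \<open>R i \<bullet> x\<close>. Each of these scalars is the inner product of
    \<open>P *v c_vec\<close> and \<open>z i\<close>, so the choice of \<epsilon> bounds the
    remainder by half of the a term.\<close>
  also have "2 * \<mu> * (\<Sum>i\<in>I. (R i \<bullet> x)\<^sup>2) - a * (\<Sum>i\<in>I. (norm (z i))\<^sup>2)
      - 2 * (\<Sum>i\<in>I. (R i \<bullet> x) * (R i \<bullet> (N *v x))) \<le> - (a / 2) * (\<Sum>i\<in>I. (norm (z i))\<^sup>2)"
  proof -
    have "4 * \<epsilon> * (R i \<bullet> x)\<^sup>2 \<le> a * (norm (z i))\<^sup>2" for i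
    proof -
      have "\<bar>R i \<bullet> x\<bar> \<le> norm (P *v c_vec) * norm (z i)"
        unfolding x[symmetric] sym[symmetric] by (rule Cauchy_Schwarz_ineq2)
      then have "(R i \<bullet> x)\<^sup>2 \<le> (norm (P *v c_vec) * norm (z i))\<^sup>2"
        using power_mono[of "\<bar>R i \<bullet> x\<bar>" _ 2] by simp
      then have "4 * \<epsilon> * (R i \<bullet> x)\<^sup>2 \<le> 4 * \<epsilon> * (norm (P *v c_vec) * norm (z i))\<^sup>2"
        using \<epsilon>(1) by (intro mult_left_mono) auto
      also have "\<dots> \<le> a * (norm (z i))\<^sup>2"
        using mult_right_mono[OF \<epsilon>(2), of "(norm (z i))\<^sup>2"] by (simp add: power_mult_distrib mult_ac)
      finally show ?thesis .
    qed
    then have "4 * \<epsilon> * (\<Sum>i\<in>I. (R i \<bullet> x)\<^sup>2) \<le> a * (\<Sum>i\<in>I. (norm (z i))\<^sup>2)"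
      unfolding sum_distrib_left by (intro sum_mono)
    then show ?thesis using R[of x] by (simp add: left_diff_distrib)
  qed
  then have "g * (2 * \<mu> * (\<Sum>i\<in>I. (R i \<bullet> x)\<^sup>2) - a * (\<Sum>i\<in>I. (norm (z i))\<^sup>2)
      - 2 * (\<Sum>i\<in>I. (R i \<bullet> x) * (R i \<bullet> (N *v x)))) \<le> g * (- (a / 2) * (\<Sum>i\<in>I. (norm (z i))\<^sup>2))"
    using g by (rule mult_left_mono)
  finally show ?thesis by (simp add: p_def algebra_simps)
qed

text \<open>The order of the quantifiers matters: c depends on P and a only and is fixed before N,
  whereas K may depend on N. K is both the overshoot and the threshold for g, which is harmless
  since either may be enlarged.\<close>

lemma error_field_decay:
  fixes P :: "real ^ 'd::{finite,linorder} ^ 'd::{finite,linorder}"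
  assumes P: "sym_pos_def P"
    and riccati: "shift_mat ** P + P ** transpose shift_mat
        - (2 * \<mu>) *\<^sub>R (P ** transpose C_mat ** C_mat ** P) + a *\<^sub>R mat 1 = 0"
    and a: "a > 0" and l: "l \<ge> 0"
  obtains c where "c > 0" "\<And>N :: real ^ 'n ^ 'n. (\<And>z. is_eigenvalue N z \<Longrightarrow> \<mu> \<le> Re z) \<Longrightarrow>
    \<exists>K\<ge>1. \<forall>g\<ge>K. \<forall>s t \<xi>. s \<le> t \<longrightarrow> perturbed_solution l (error_field g P N) s t \<xi> \<longrightarrow>
      norm (\<xi> t) \<le> K * exp (- (c * g * (t - s))) * norm (\<xi> s)"
proof -
  have Pt: "transpose P = P" using P by (simp add: sym_pos_def_def)
  obtain Q where PQ: "\<And>x. P *v (Q *v x) = x" and Q: "\<And>x y. (Q *v x) \<bullet> y = x \<bullet> (Q *v y)"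
    using sym_pos_def_inverse[OF P] by blast
  have quad: "continuous_on UNIV (\<lambda>x. x \<bullet> (M *v x))" "(t *\<^sub>R x) \<bullet> (M *v (t *\<^sub>R x)) = t\<^sup>2 * (x \<bullet> (M *v x))"
    for M :: "real ^ 'd::{finite,linorder} ^ 'd::{finite,linorder}" and x t
    by (auto intro!: continuous_intros bounded_linear.continuous_on[OF matrix_vector_mul_bounded_linear]
        simp: matrix_vector_mult_scaleR power2_eq_square)
  obtain Mp where Mp: "Mp > 0" "\<And>x. x \<bullet> (P *v x) \<le> Mp * (norm x)\<^sup>2"
    using quadratic_upper_bound[OF quad] by blast
  obtain Mq where Mq: "Mq > 0" "\<And>x. x \<bullet> (Q *v x) \<le> Mq * (norm x)\<^sup>2"
    using quadratic_upper_bound[OF quad] by blast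
  have Qpos: "x \<bullet> (Q *v x) > 0" if "x \<noteq> 0" for x
  proof -
    have "Q *v x \<noteq> 0" using that PQ[of x] by auto
    then have "(Q *v x) \<bullet> (P *v (Q *v x)) > 0" using P by (simp add: sym_pos_def_def)
    then show ?thesis by (simp add: PQ inner_commute)
  qed
  obtain mq where mq: "mq > 0" "\<And>x. mq * (norm x)\<^sup>2 \<le> x \<bullet> (Q *v x)"
    using quadratic_lower_bound[OF quad Qpos] by blast
  obtain Kp where Kp: "Kp > 0" "\<And>x. norm (P *v x) \<le> Kp * norm x"
    using norm_matrix_vector_le[of P] by blast
  \<comment> \<open>With Z the sum of the squared norms of the images under Q, V is at most Mp Z.
    The rate g a / 4 in terms of Z therefore gives g a / (4 Mp) = 2 c g in terms of V.\<close>
  define c where "c = a / (8 * Mp)"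
  have c: "c > 0" using a Mp by (simp add: c_def)
  show ?thesis
  proof (rule that[OF c])
    fix N :: "real ^ 'n ^ 'n" assume spec: "\<And>z. is_eigenvalue N z \<Longrightarrow> \<mu> \<le> Re z"
    \<comment> \<open>Small enough to be paid by half of a; the summand 1 avoids dividing by
      0.\<close>
    define \<epsilon> where "\<epsilon> = a / (4 * ((norm (P *v c_vec))\<^sup>2 + 1))"
    have pos: "(norm (P *v c_vec))\<^sup>2 + 1 > 0" by (simp add: add_nonneg_pos)
    have \<epsilon>: "\<epsilon> > 0" "4 * \<epsilon> * (norm (P *v c_vec))\<^sup>2 \<le> a"
    proof -
      show "\<epsilon> > 0" using a pos by (simp add: \<epsilon>_def)
      then have "4 * \<epsilon> * (norm (P *v c_vec))\<^sup>2 \<le> 4 * \<epsilon> * ((norm (P *v c_vec))\<^sup>2 + 1)"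
        by (intro mult_left_mono) auto
      also have "4 * (a / (4 * y)) * y = a" if "y > 0" for y using that by simp
      from this[OF pos] have "4 * \<epsilon> * ((norm (P *v c_vec))\<^sup>2 + 1) = a" by (simp only: \<epsilon>_def)
      finally show "4 * \<epsilon> * (norm (P *v c_vec))\<^sup>2 \<le> a" .
    qed
    obtain I :: "(nat \<times> bool) set" and R where I: "finite I"
      and inj: "\<And>x. (\<And>i. i \<in> I \<Longrightarrow> R i \<bullet> x = 0) \<Longrightarrow> x = 0"
      and R: "\<And>x. (\<mu> - \<epsilon>) * (\<Sum>i\<in>I. (R i \<bullet> x)\<^sup>2) \<le> (\<Sum>i\<in>I. (R i \<bullet> x) * (R i \<bullet> (N *v x)))"
      using adapted_functionals[OF spec \<epsilon>(1)] by blast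
    define U :: "real ^ 'd::{finite,linorder} ^ 'n \<Rightarrow> real" where "U \<xi> = (\<Sum>i\<in>I. (norm (combine (R i) \<xi>))\<^sup>2)" for \<xi>
    define V :: "real ^ 'd::{finite,linorder} ^ 'n \<Rightarrow> real"
      where "V \<xi> = (\<Sum>i\<in>I. combine (R i) \<xi> \<bullet> (Q *v combine (R i) \<xi>))" for \<xi>
    obtain m where m: "m > 0" "\<And>\<xi>. m * (norm \<xi>)\<^sup>2 \<le> U \<xi>"
      using norm_combine_lower_bound[OF I inj] unfolding U_def by blast
    obtain K1 where K1: "K1 > 0" "\<And>\<xi>. U \<xi> \<le> K1 * (norm \<xi>)\<^sup>2"
    proof (rule quadratic_upper_bound)
      show "continuous_on UNIV U" unfolding U_def combine_def by (intro continuous_intros)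
      show "U (t *\<^sub>R \<xi>) = t\<^sup>2 * U \<xi>" for t \<xi>
        by (simp add: U_def linear_cmul[OF linear_combine] power_mult_distrib sum_distrib_left)
    qed blast
    have V_lower: "mq * m * (norm \<xi>)\<^sup>2 \<le> V \<xi>" for \<xi>
    proof -
      have "mq * (m * (norm \<xi>)\<^sup>2) \<le> mq * U \<xi>" using m mq by (intro mult_left_mono) auto
      also have "\<dots> \<le> V \<xi>" unfolding U_def V_def sum_distrib_left by (intro sum_mono mq)
      finally show ?thesis by simp
    qed
    have V_upper: "V \<xi> \<le> Mq * K1 * (norm \<xi>)\<^sup>2" for \<xi>
    proof -
      have "V \<xi> \<le> Mq * U \<xi>" unfolding U_def V_def sum_distrib_left by (intro sum_mono Mq)
      also have "\<dots> \<le> Mq * (K1 * (norm \<xi>)\<^sup>2)" using K1 Mq by (intro mult_left_mono) auto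
      finally show ?thesis by simp
    qed
    \<comment> \<open>Collects the constants of a chain: the deviation is bounded through l and the
      norm of \<xi>, that norm through U, and U through the sum Z below.\<close>
    define K2 where "K2 = K1 * l\<^sup>2 * Kp\<^sup>2 / m"
    have K2: "K2 \<ge> 0" using K1 m by (simp add: K2_def)
    \<comment> \<open>For g beyond the second entry, half of g a / 2 absorbs 1 + K2. The third entry
      is the square root of the ratio between the upper and the lower bound of V.\<close>
    define K where "K = Max {1, 4 * (1 + K2) / a, sqrt (Mq * K1 / (mq * m))}"
    have K: "1 \<le> K" "4 * (1 + K2) / a \<le> K" "sqrt (Mq * K1 / (mq * m)) \<le> K"
      unfolding K_def by (rule Max_ge; simp)+
    have rate: "2 * (\<Sum>i\<in>I. (Q *v combine (R i) \<xi>) \<bullet> combine (R i) \<eta>) \<le> - 2 * c * g * V \<xi>"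
      if g: "g \<ge> K" and near: "norm (\<eta> - error_field g P N \<xi>) \<le> l * norm \<xi>" for g \<xi> \<eta>
    proof -
      define Z where "Z = (\<Sum>i\<in>I. (norm (Q *v combine (R i) \<xi>))\<^sup>2)"
      have Z: "Z \<ge> 0" by (simp add: Z_def sum_nonneg)
      have UZ: "U \<xi> \<le> Kp\<^sup>2 * Z"
        unfolding U_def Z_def sum_distrib_left
      proof (rule sum_mono)
        fix i
        have "norm (combine (R i) \<xi>) \<le> Kp * norm (Q *v combine (R i) \<xi>)"
          using Kp(2)[of "Q *v combine (R i) \<xi>"] by (simp add: PQ)
        then show "(norm (combine (R i) \<xi>))\<^sup>2 \<le> Kp\<^sup>2 * (norm (Q *v combine (R i) \<xi>))\<^sup>2"
          using power_mono[of "norm (combine (R i) \<xi>)" _ 2] by (simp flip: power_mult_distrib)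
      qed
      have VZ: "V \<xi> \<le> Mp * Z"
        unfolding V_def Z_def sum_distrib_left
      proof (rule sum_mono)
        fix i
        show "combine (R i) \<xi> \<bullet> (Q *v combine (R i) \<xi>) \<le> Mp * (norm (Q *v combine (R i) \<xi>))\<^sup>2"
          using Mp(2)[of "Q *v combine (R i) \<xi>"] by (simp add: PQ inner_commute)
      qed
      have "U (\<eta> - error_field g P N \<xi>) \<le> K1 * (l * norm \<xi>)\<^sup>2"
        using K1 near by (intro order_trans[OF K1(2)] mult_left_mono power_mono) auto
      also have "\<dots> = K1 * l\<^sup>2 / m * (m * (norm \<xi>)\<^sup>2)" using m by (simp add: power_mult_distrib)
      also have "\<dots> \<le> K1 * l\<^sup>2 / m * (Kp\<^sup>2 * Z)"
        using m K1 UZ by (intro mult_left_mono order_trans[OF m(2)]) auto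
      also have "\<dots> = K2 * Z" by (simp add: K2_def)
      finally have pert: "U (\<eta> - error_field g P N \<xi>) \<le> K2 * Z" .
      have "2 * (\<Sum>i\<in>I. (Q *v combine (R i) \<xi>) \<bullet> combine (R i) \<eta>) \<le> (1 - g * a / 2) * Z + K2 * Z"
        using lyapunov_rate[OF Pt riccati PQ R less_imp_le[OF \<epsilon>(1)] \<epsilon>(2), of g \<xi> \<eta>] g K(1) pert
        by (simp add: Z_def U_def)
      also have "\<dots> = (1 + K2 - g * a / 2) * Z" by (simp add: algebra_simps)
      also have "\<dots> \<le> (- (g * a / 4)) * Z"
      proof (rule mult_right_mono[OF _ Z])
        have "4 * (1 + K2) / a \<le> g" using K(2) g by linarith
        then show "1 + K2 - g * a / 2 \<le> - (g * a / 4)" using a by (simp add: pos_divide_le_eq)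
      qed
      also have "\<dots> = - 2 * c * g * (Mp * Z)" using Mp by (simp add: c_def)
      also have "\<dots> \<le> - 2 * c * g * V \<xi>"
        using VZ c g K(1) by simp
      finally show ?thesis .
    qed
    show "\<exists>K\<ge>1. \<forall>g\<ge>K. \<forall>s t \<xi>. s \<le> t \<longrightarrow> perturbed_solution l (error_field g P N) s t \<xi> \<longrightarrow>
      norm (\<xi> t) \<le> K * exp (- (c * g * (t - s))) * norm (\<xi> s)"
    proof (intro exI[of _ K] conjI allI impI K(1))
      fix g s t :: real and \<xi> :: "real \<Rightarrow> real ^ 'd::{finite,linorder} ^ 'n"
      assume g: "K \<le> g" and st: "s \<le> t" and sol: "perturbed_solution l (error_field g P N) s t \<xi>"
      obtain D \<xi>' where cont: "continuous_on {s..t} \<xi>" and D: "finite D"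
        and deriv: "\<And>u. u \<in> {s<..<t} - D \<Longrightarrow> (\<xi> has_vector_derivative \<xi>' u) (at u)"
        and near: "\<And>u. u \<in> {s<..<t} - D \<Longrightarrow> norm (\<xi>' u - error_field g P N (\<xi> u)) \<le> l * norm (\<xi> u)"
        using sol unfolding perturbed_solution_def by blast
      have "V (\<xi> t) \<le> exp (- 2 * c * g * (t - s)) * V (\<xi> s)"
      proof (rule exponential_estimate[OF st D])
        show "continuous_on {s..t} (\<lambda>u. V (\<xi> u))"
          unfolding V_def combine_def
          by (intro continuous_intros cont bounded_linear.continuous_on[OF matrix_vector_mul_bounded_linear])
      next
        fix u assume u: "u \<in> {s<..<t} - D"
        have comb: "((\<lambda>u. combine (R i) (\<xi> u)) has_vector_derivative combine (R i) (\<xi>' u)) (at u)" for i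
          by (rule bounded_linear.has_vector_derivative[OF linear_combine[unfolded linear_conv_bounded_linear] deriv[OF u]])
        have "((\<lambda>u. combine (R i) (\<xi> u) \<bullet> (Q *v combine (R i) (\<xi> u))) has_vector_derivative
            2 * ((Q *v combine (R i) (\<xi> u)) \<bullet> combine (R i) (\<xi>' u))) (at u)" for i
          using bounded_bilinear.has_vector_derivative[OF bounded_bilinear_inner comb[of i]
              bounded_linear.has_vector_derivative[OF matrix_vector_mul_bounded_linear[of Q] comb[of i]]]
            Q[of "combine (R i) (\<xi> u)" "combine (R i) (\<xi>' u)"]
          by (simp add: inner_commute)
        then show "((\<lambda>u. V (\<xi> u)) has_vector_derivative
            2 * (\<Sum>i\<in>I. (Q *v combine (R i) (\<xi> u)) \<bullet> combine (R i) (\<xi>' u))) (at u)"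
          unfolding V_def sum_distrib_left by (intro has_vector_derivative_sum)
        show "2 * (\<Sum>i\<in>I. (Q *v combine (R i) (\<xi> u)) \<bullet> combine (R i) (\<xi>' u)) \<le> - 2 * c * g * V (\<xi> u)"
          using rate[OF g near[OF u]] .
      qed
      then have "mq * m * (norm (\<xi> t))\<^sup>2 \<le> exp (- 2 * c * g * (t - s)) * (Mq * K1 * (norm (\<xi> s))\<^sup>2)"
        using V_lower[of "\<xi> t"] V_upper[of "\<xi> s"]
        by (meson exp_ge_zero mult_left_mono order_trans)
      then have "(norm (\<xi> t))\<^sup>2 \<le> Mq * K1 / (mq * m) * (exp (- 2 * c * g * (t - s)) * (norm (\<xi> s))\<^sup>2)"
        using mq(1) m(1) by (simp add: pos_le_divide_eq mult_ac)
      also have "\<dots> \<le> K\<^sup>2 * (exp (- 2 * c * g * (t - s)) * (norm (\<xi> s))\<^sup>2)"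
      proof (rule mult_right_mono)
        show "Mq * K1 / (mq * m) \<le> K\<^sup>2" using K(3) by (rule sqrt_le_D)
      qed simp
      also have "\<dots> = (K * exp (- (c * g * (t - s))) * norm (\<xi> s))\<^sup>2"
        by (simp add: power_mult_distrib exp_double[symmetric] mult_ac)
      finally show "norm (\<xi> t) \<le> K * exp (- (c * g * (t - s))) * norm (\<xi> s)"
      proof (rule power2_le_imp_le)
        show "0 \<le> K * exp (- (c * g * (t - s))) * norm (\<xi> s)" using K(1) by simp
      qed
    qed
  qed
qed

section \<open>Switching with average dwell time\<close>

lemma switch_time_0 [simp]: "switch_time \<Delta>T 0 = 0"
  by (simp add: switch_time_def)

lemma switch_time_Suc [simp]: "switch_time \<Delta>T (Suc i) = switch_time \<Delta>T i + \<Delta>T (Suc i)"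
  by (simp add: switch_time_def)

lemma switch_time_mono:
  assumes nonneg: "\<And>i. i \<ge> 1 \<Longrightarrow> \<Delta>T i \<ge> 0" and "i \<le> j"
  shows "switch_time \<Delta>T i \<le> switch_time \<Delta>T j"
  unfolding switch_time_def using assms by (intro sum_mono2) auto

lemma active_index_eq:
  assumes nonneg: "\<And>i. i \<ge> 1 \<Longrightarrow> \<Delta>T i \<ge> 0"
    and i: "i \<ge> 1" "switch_time \<Delta>T (i - 1) \<le> t" "t < switch_time \<Delta>T i"
  shows "active_index \<Delta>T t = i"
  unfolding active_index_def
proof (rule the_equality)
  fix j assume j: "1 \<le> j \<and> switch_time \<Delta>T (j - 1) \<le> t \<and> t < switch_time \<Delta>T j"
  have "\<not> j < i" using switch_time_mono[of \<Delta>T j "i - 1", OF nonneg] i j by force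
  moreover have "\<not> i < j" using switch_time_mono[of \<Delta>T i "j - 1", OF nonneg] i j by force
  ultimately show "j = i" by simp
qed (use i in auto)

text \<open>The sum up to n contains n + 1 phases, so counting m phases shifts the offset from n0 to
  n0 + 1. For m = 0 the left side is nonpositive.\<close>

lemma odd_dwell_time:
  fixes \<Delta>T :: "nat \<Rightarrow> real"
  assumes \<tau>: "\<tau> > 0" and dwell: "\<And>n. (\<Sum>m=0..n. \<Delta>T (1 + 2 * m)) \<ge> \<tau> * (real n - real n0)"
  shows "\<tau> * (real m - real (n0 + 1)) \<le> (\<Sum>j<m. \<Delta>T (1 + 2 * j))"
proof (cases m)
  case 0
  then show ?thesis using \<tau> by (simp add: mult_nonneg_nonpos)
next
  case (Suc n)
  then show ?thesis using dwell[of n] by (simp add: atLeast0AtMost lessThan_Suc_atMost)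
qed

lemma switch_time_even:
  assumes nonneg: "\<And>i. i \<ge> 1 \<Longrightarrow> \<Delta>T i \<ge> 0"
  shows "(\<Sum>j<m. \<Delta>T (1 + 2 * j)) \<le> switch_time \<Delta>T (2 * m)"
proof (induction m)
  case (Suc m)
  have "0 \<le> \<Delta>T (Suc (Suc (2 * m)))" by (intro nonneg) simp
  then show ?case using Suc by simp
qed simp

text \<open>Odd phases alone have unbounded total length, which excludes an accumulation of
  switching times although phases of length 0 are allowed.\<close>

lemma switch_time_at_top:
  assumes nonneg: "\<And>i. i \<ge> 1 \<Longrightarrow> \<Delta>T i \<ge> 0"
    and \<tau>: "\<tau> > 0" and dwell: "\<And>n. (\<Sum>m=0..n. \<Delta>T (1 + 2 * m)) \<ge> \<tau> * (real n - real n0)"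
  shows "\<exists>m. t < switch_time \<Delta>T (2 * m)"
proof -
  obtain m :: nat where "t / \<tau> + real (n0 + 1) < real m" using reals_Archimedean2 by blast
  then have "t < \<tau> * (real m - real (n0 + 1))" using \<tau> by (simp add: field_simps)
  also have "\<dots> \<le> switch_time \<Delta>T (2 * m)"
    using odd_dwell_time[OF \<tau> dwell] switch_time_even[OF nonneg] by (rule order_trans)
  finally show ?thesis ..
qed

text \<open>Periods, each an odd phase followed by an even one, are the unit in which decay is
  counted.\<close>

lemma ex_switch_period:
  assumes nonneg: "\<And>i. i \<ge> 1 \<Longrightarrow> \<Delta>T i \<ge> 0"
    and unbounded: "\<And>t. \<exists>m. t < switch_time \<Delta>T (2 * m)" and t: "t \<ge> 0"
  shows "\<exists>m. switch_time \<Delta>T (2 * m) \<le> t \<and> t < switch_time \<Delta>T (2 * m + 2)"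
proof -
  define m where "m = (LEAST m. t < switch_time \<Delta>T (2 * m))"
  have m: "t < switch_time \<Delta>T (2 * m)" unfolding m_def using unbounded by (rule LeastI_ex)
  then obtain n where n: "m = Suc n" using t by (cases m) auto
  then have "\<not> t < switch_time \<Delta>T (2 * n)" using not_less_Least[of n "\<lambda>m. t < switch_time \<Delta>T (2 * m)"] by (simp add: m_def)
  then show ?thesis using m n by (intro exI[of _ n]) auto
qed

lemma ex_switch_index:
  assumes unbounded: "\<And>t. \<exists>m. t < switch_time \<Delta>T (2 * m)" and t: "t \<ge> 0"
  obtains i where "i \<ge> 1" "switch_time \<Delta>T (i - 1) \<le> t" "t < switch_time \<Delta>T i"
proof -
  define i where "i = (LEAST i. t < switch_time \<Delta>T i)"
  obtain m where "t < switch_time \<Delta>T (2 * m)" using unbounded by blast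
  then have i: "t < switch_time \<Delta>T i" unfolding i_def by (rule LeastI)
  then obtain j where j: "i = Suc j" using t by (cases i) auto
  then have "\<not> t < switch_time \<Delta>T j" using not_less_Least[of j "\<lambda>i. t < switch_time \<Delta>T i"] by (simp add: i_def)
  with i j show ?thesis by (intro that[of i]; simp)
qed

text \<open>The interval is closed on the right here: for a left limit at t the index active just
  before t counts.\<close>

lemma ex_switch_index_left:
  assumes unbounded: "\<And>t. \<exists>m. t < switch_time \<Delta>T (2 * m)" and t: "t > 0"
  obtains i where "i \<ge> 1" "switch_time \<Delta>T (i - 1) < t" "t \<le> switch_time \<Delta>T i"
proof -
  define i where "i = (LEAST i. t \<le> switch_time \<Delta>T i)"
  obtain m where "t < switch_time \<Delta>T (2 * m)" using unbounded by blast
  then have "t \<le> switch_time \<Delta>T (2 * m)" by simp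
  then have i: "t \<le> switch_time \<Delta>T i" unfolding i_def by (rule LeastI)
  then obtain j where j: "i = Suc j" using t by (cases i) auto
  then have "\<not> t \<le> switch_time \<Delta>T j" using not_less_Least[of j "\<lambda>i. t \<le> switch_time \<Delta>T i"] by (simp add: i_def)
  with i j show ?thesis by (intro that[of i]; simp)
qed

lemma locally_finite_switch_times:
  assumes nonneg: "\<And>i. i \<ge> 1 \<Longrightarrow> \<Delta>T i \<ge> 0"
    and unbounded: "\<And>t. \<exists>m. t < switch_time \<Delta>T (2 * m)"
  shows "locally_finite_times (range (switch_time \<Delta>T))"
  unfolding locally_finite_times_def
proof
  fix t
  obtain m where m: "t < switch_time \<Delta>T (2 * m)" using unbounded by blast
  have "range (switch_time \<Delta>T) \<inter> {0..t} \<subseteq> switch_time \<Delta>T ` {..2 * m}"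
  proof
    fix s assume "s \<in> range (switch_time \<Delta>T) \<inter> {0..t}"
    then obtain i where i: "s = switch_time \<Delta>T i" "switch_time \<Delta>T i \<le> t" by auto
    then have "i \<le> 2 * m" using m switch_time_mono[of \<Delta>T "2 * m" i, OF nonneg] by (cases "i \<le> 2 * m") auto
    then show "s \<in> switch_time \<Delta>T ` {..2 * m}" using i by auto
  qed
  then show "finite (range (switch_time \<Delta>T) \<inter> {0..t})" by (rule finite_subset) simp
qed

text \<open>Every completed period costs K exp (b T0), while the gain of its odd phase may be
  negligible. The gains are therefore multiplied over all m odd phases before the dwell time bound
  is used, which yields exp (- c \<tau> (m - n0 - 1)). The contraction hypothesis keeps a factor exp
  (-1) per period, and the prefactor K exp (b T0) covers the unfinished last period.\<close>

lemma average_dwell_time_decay: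
  fixes X :: "real \<Rightarrow> real"
  assumes nonneg: "\<And>i. i \<ge> 1 \<Longrightarrow> \<Delta>T i \<ge> 0"
    and even_le: "\<And>i. i \<ge> 1 \<Longrightarrow> even i \<Longrightarrow> \<Delta>T i \<le> T0"
    and \<tau>: "\<tau> > 0" and dwell: "\<And>n. (\<Sum>m=0..n. \<Delta>T (1 + 2 * m)) \<ge> \<tau> * (real n - real n0)"
    and X: "\<And>t. X t \<ge> 0"
    and odd_decay: "\<And>i t. odd i \<Longrightarrow> switch_time \<Delta>T (i - 1) \<le> t \<Longrightarrow> t \<le> switch_time \<Delta>T i \<Longrightarrow>
      X t \<le> K * exp (- (c * (t - switch_time \<Delta>T (i - 1)))) * X (switch_time \<Delta>T (i - 1))"
    and even_growth: "\<And>i t. i \<ge> 1 \<Longrightarrow> even i \<Longrightarrow> switch_time \<Delta>T (i - 1) \<le> t \<Longrightarrow> t \<le> switch_time \<Delta>T i \<Longrightarrow>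
      X t \<le> exp (b * (t - switch_time \<Delta>T (i - 1))) * X (switch_time \<Delta>T (i - 1))"
    and c: "c \<ge> 0" and b: "b \<ge> 0" and K: "K \<ge> 1"
    and contraction: "K * exp (b * T0) \<le> exp (c * \<tau> - 1)"
    and t: "switch_time \<Delta>T (2 * m) \<le> t" "t \<le> switch_time \<Delta>T (2 * m + 2)"
  shows "X t \<le> K * exp (b * T0 + c * \<tau> * real (n0 + 1)) * exp (- real m) * X 0"
proof -
  let ?S = "switch_time \<Delta>T"
  define E where "E = exp (b * T0)"
  have T0: "T0 \<ge> 0" using even_le[of 2] nonneg[of 2] by simp
  have E: "E \<ge> 1" using b T0 by (simp add: E_def)
  have odd_part: "X t \<le> K * exp (- (c * (t - ?S (2 * m)))) * X (?S (2 * m))"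
    if "?S (2 * m) \<le> t" "t \<le> ?S (2 * m + 1)" for m t
    using odd_decay[of "2 * m + 1" t] that by simp
  have even_part: "X t \<le> E * X (?S (2 * m + 1))"
    if "?S (2 * m + 1) \<le> t" "t \<le> ?S (2 * m + 2)" for m t
  proof -
    have "X t \<le> exp (b * (t - ?S (2 * m + 1))) * X (?S (2 * m + 1))"
      using even_growth[of "2 * m + 2" t] that by simp
    also have "exp (b * (t - ?S (2 * m + 1))) \<le> E"
      using that even_le[of "2 * m + 2"] b by (auto simp: E_def intro!: mult_left_mono)
    then have "exp (b * (t - ?S (2 * m + 1))) * X (?S (2 * m + 1)) \<le> E * X (?S (2 * m + 1))"
      using X by (intro mult_right_mono)
    finally show ?thesis .
  qed
  have one_step: "X (?S (2 * m + 1)) \<le> K * exp (- (c * \<Delta>T (1 + 2 * m))) * X (?S (2 * m))" for m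
    using odd_part[of m "?S (2 * m + 1)"] nonneg[of "1 + 2 * m"] by simp
  \<comment> \<open>Inside a period the decay is discarded; what is wanted is one bound for every t
    in it.\<close>
  have period: "X t \<le> K * E * X (?S (2 * m))" if t: "?S (2 * m) \<le> t" "t \<le> ?S (2 * m + 2)" for m t
  proof (cases "t \<le> ?S (2 * m + 1)")
    case True
    have "X t \<le> K * exp (- (c * (t - ?S (2 * m)))) * X (?S (2 * m))" using odd_part t True by blast
    also have "\<dots> \<le> K * E * X (?S (2 * m))"
      using K E X c t by (intro mult_right_mono mult_left_mono) (auto intro: order_trans[of _ 1])
    finally show ?thesis .
  next
    case False
    have "K * exp (- (c * \<Delta>T (1 + 2 * m))) * X (?S (2 * m)) \<le> K * 1 * X (?S (2 * m))"
      using K X c nonneg by (intro mult_right_mono mult_left_mono) auto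
    with one_step[of m] have "X (?S (2 * m + 1)) \<le> K * X (?S (2 * m))" by simp
    then have "E * X (?S (2 * m + 1)) \<le> E * (K * X (?S (2 * m)))" using E by (intro mult_left_mono) auto
    with even_part[of m t] False t show ?thesis by (simp add: mult_ac)
  qed
  have start: "X (?S (2 * m)) \<le> (K * E) ^ m * exp (- (c * (\<Sum>j<m. \<Delta>T (1 + 2 * j)))) * X 0" for m
  proof (induction m)
    case (Suc m)
    have "X (?S (2 * Suc m)) \<le> E * X (?S (2 * m + 1))"
      using even_part[of m "?S (2 * Suc m)"] nonneg[of "2 * m + 2"] by simp
    also have "\<dots> \<le> E * (K * exp (- (c * \<Delta>T (1 + 2 * m))) * X (?S (2 * m)))"
      using one_step E by (intro mult_left_mono) auto
    also have "\<dots> \<le> E * (K * exp (- (c * \<Delta>T (1 + 2 * m))) *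
        ((K * E) ^ m * exp (- (c * (\<Sum>j<m. \<Delta>T (1 + 2 * j)))) * X 0))"
      using Suc E K by (intro mult_left_mono) auto
    also have "\<dots> = (K * E) ^ Suc m * (exp (- (c * (\<Sum>j<m. \<Delta>T (1 + 2 * j)))) * exp (- (c * \<Delta>T (1 + 2 * m)))) * X 0"
      by (simp only: power_Suc mult_ac)
    also have "exp (- (c * (\<Sum>j<m. \<Delta>T (1 + 2 * j)))) * exp (- (c * \<Delta>T (1 + 2 * m)))
        = exp (- (c * (\<Sum>j<Suc m. \<Delta>T (1 + 2 * j))))"
      unfolding exp_add[symmetric] by (simp add: distrib_left)
    finally show ?case .
  qed simp
  have "X (?S (2 * m)) \<le> exp (c * \<tau> * real (n0 + 1)) * exp (- real m) * X 0"
  proof -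
    have "(K * E) ^ m \<le> exp (c * \<tau> - 1) ^ m"
      using contraction K E by (intro power_mono) (auto simp: E_def)
    moreover have "exp (- (c * (\<Sum>j<m. \<Delta>T (1 + 2 * j)))) \<le> exp (- (c * (\<tau> * (real m - real (n0 + 1)))))"
      using odd_dwell_time[OF \<tau> dwell, of m] c by (auto intro: mult_left_mono)
    ultimately have "(K * E) ^ m * exp (- (c * (\<Sum>j<m. \<Delta>T (1 + 2 * j))))
        \<le> exp (c * \<tau> - 1) ^ m * exp (- (c * (\<tau> * (real m - real (n0 + 1)))))"
      by (intro mult_mono) auto
    also have "\<dots> = exp (c * \<tau> * real (n0 + 1)) * exp (- real m)"
      by (simp add: exp_of_nat_mult[symmetric] exp_add[symmetric] algebra_simps)
    finally show ?thesis using start[of m] X[of 0] by (meson mult_right_mono order_trans)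
  qed
  then have "K * E * X (?S (2 * m)) \<le> K * E * (exp (c * \<tau> * real (n0 + 1)) * exp (- real m) * X 0)"
    using K E by (intro mult_left_mono) auto
  with period[OF t] show ?thesis by (simp add: E_def exp_add mult_ac)
qed

text \<open>Odd phases may be arbitrarily long, so decay is known per period and not per unit of
  time. For convergence it suffices that the number of completed periods tends to infinity with
  t.\<close>

lemma period_bound_imp_decay:
  fixes X :: "real \<Rightarrow> real"
  assumes nonneg: "\<And>i. i \<ge> 1 \<Longrightarrow> \<Delta>T i \<ge> 0"
    and unbounded: "\<And>t. \<exists>m. t < switch_time \<Delta>T (2 * m)"
    and X: "\<And>t. X t \<ge> 0"
    and bound: "\<And>m t. switch_time \<Delta>T (2 * m) \<le> t \<Longrightarrow> t \<le> switch_time \<Delta>T (2 * m + 2) \<Longrightarrow>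
      X t \<le> M * exp (- real m)"
  shows "\<And>t. t \<ge> 0 \<Longrightarrow> X t \<le> M" and "(X \<longlongrightarrow> 0) at_top"
proof -
  have M: "M \<ge> 0" using bound[of 0 0] X[of 0] nonneg[of 1] nonneg[of 2] by (simp add: numeral_2_eq_2)
  fix t :: real assume "t \<ge> 0"
  from ex_switch_period[OF nonneg unbounded this] obtain m
    where "switch_time \<Delta>T (2 * m) \<le> t" "t < switch_time \<Delta>T (2 * m + 2)" by blast
  then have "X t \<le> M * exp (- real m)" using bound by simp
  also have "\<dots> \<le> M * 1" using M by (intro mult_left_mono) auto
  finally show "X t \<le> M" by simp
next
  have M: "M \<ge> 0" using bound[of 0 0] X[of 0] nonneg[of 1] nonneg[of 2] by (simp add: numeral_2_eq_2)
  show "(X \<longlongrightarrow> 0) at_top"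
  proof (rule tendstoI)
    fix e :: real assume e: "e > 0"
    have "(\<lambda>m. M * exp (- real m)) \<longlonglongrightarrow> M * 0"
      by (intro tendsto_mult tendsto_const filterlim_compose[OF exp_at_bot]
          filterlim_compose[OF filterlim_uminus_at_bot_at_top] filterlim_real_sequentially)
    then have "eventually (\<lambda>m. M * exp (- real m) < e) sequentially"
      using e by (auto dest: order_tendstoD)
    then obtain m0 where m0: "\<And>m. m \<ge> m0 \<Longrightarrow> M * exp (- real m) < e"
      by (auto simp: eventually_sequentially)
    have "dist (X t) 0 < e" if t: "t \<ge> max 0 (switch_time \<Delta>T (2 * m0))" for t
    proof -
      from t have "t \<ge> 0" by simp
      from ex_switch_period[OF nonneg unbounded this] obtain m
        where m: "switch_time \<Delta>T (2 * m) \<le> t" "t < switch_time \<Delta>T (2 * m + 2)" by blast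
      have "m0 \<le> m"
      proof (rule ccontr)
        assume "\<not> m0 \<le> m"
        then have "switch_time \<Delta>T (2 * m + 2) \<le> switch_time \<Delta>T (2 * m0)"
          by (intro switch_time_mono nonneg) auto
        then show False using m t by simp
      qed
      then show ?thesis using bound[of m t] m m0[of m] X[of t] by simp
    qed
    then show "eventually (\<lambda>t. dist (X t) 0 < e) at_top"
      unfolding eventually_at_top_linorder by blast
  qed
qed

section \<open>High-gain coordinates of the network\<close>

lemma idx_bounds:
  fixes i :: "'d::{finite,linorder}"
  shows "1 \<le> idx i" "idx i \<le> CARD('d)"
proof -
  have "card {i} \<le> card {j. j \<le> i}" by (intro card_mono) auto
  then show "1 \<le> idx i" by (simp add: idx_def)
  show "idx i \<le> CARD('d)" unfolding idx_def by (intro card_mono) auto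
qed

definition sync_error :: "real \<Rightarrow> 'n \<Rightarrow> real ^ 'd::{finite,linorder} ^ 'n \<Rightarrow> real ^ 'd::{finite,linorder} ^ 'n" where
  "sync_error g r w = (\<chi> k i. (w $ k $ i - w $ r $ i) / g ^ idx i)"

lemma linear_sync_error: "linear (sync_error g r)"
  by (rule linearI) (simp_all add: sync_error_def vec_eq_iff add_divide_distrib[symmetric] right_diff_distrib algebra_simps diff_divide_distrib)

lemma C_mat_mult: "(C_mat *v x) $ 1 = c_vec \<bullet> x"
  by (simp add: C_mat_def c_vec_def matrix_vector_mult_def inner_vec_def)

text \<open>\<open>c_vec\<close> picks the coordinate with \<open>idx i = 1\<close>, where the
  scaling is the first power of g.\<close>

lemma c_vec_sync_error:
  assumes "g > 0"
  shows "c_vec \<bullet> w $ j - c_vec \<bullet> w $ k = g * (c_vec \<bullet> sync_error g r w $ j - c_vec \<bullet> sync_error g r w $ k)"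
proof -
  have "c_vec \<bullet> w $ j - c_vec \<bullet> w $ k
      = (\<Sum>i\<in>UNIV. g * (c_vec $ i * (sync_error g r w $ j $ i - sync_error g r w $ k $ i)))"
    unfolding inner_vec_def sum_subtractf[symmetric] using assms
    by (intro sum.cong) (auto simp: c_vec_def sync_error_def diff_divide_distrib[symmetric])
  then show ?thesis
    by (simp add: sum_distrib_left[symmetric] inner_vec_def right_diff_distrib sum_subtractf)
qed

lemma gain_mult:
  fixes P :: "real ^ 'd::{finite,linorder} ^ 'd::{finite,linorder}"
  shows "(gain g P *v y) $ i = g ^ idx i * y $ 1 * (P *v c_vec) $ i"
proof -
  have "transpose C_mat *v y = y $ 1 *\<^sub>R (c_vec :: real ^ 'd::{finite,linorder})"
    by (simp add: vec_eq_iff transpose_def C_mat_def c_vec_def matrix_vector_mult_def)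
  moreover have "(D_mat g *v x) $ i = g ^ idx i * x $ i" for x :: "real ^ 'd::{finite,linorder}"
    by (simp add: D_mat_def matrix_vector_mult_def if_distrib[of "\<lambda>c. c * _"] cong: if_cong)
  ultimately show ?thesis
    by (simp add: gain_def matrix_vector_mul_assoc[symmetric] matrix_vector_mult_scaleR)
qed

text \<open>The linear terms gain exactly one factor g. The shift reads coordinate
  \<open>idx i + 1\<close> and writes \<open>idx i\<close>; in the coupling, the gain cancels the
  scaling and the measured output contributes g. The nonlinearity enters in the last coordinate and
  keeps the divisor g^d. The number \<mu> is arbitrary here since
  \<open>\<xi> $ r = 0\<close>.\<close>

lemma sync_error_network_dynamics:
  fixes \<phi> :: "real ^ 'd::{finite,linorder} \<Rightarrow> real" and w :: "real ^ 'd::{finite,linorder} ^ 'n" and r :: 'n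
  assumes g: "g > 0" and A: "adjacency A"
  defines "\<xi> \<equiv> sync_error g r w"
  shows "sync_error g r (network_dynamics \<phi> (gain g P) A w)
    = error_field g P (reduced_laplacian r \<mu> A) \<xi>
      + (\<chi> k. ((\<phi> (w $ k) - \<phi> (w $ r)) / g ^ CARD('d)) *\<^sub>R B_vec)"
proof -
  define y where "y k = (\<Sum>j\<in>UNIV. A $ k $ j * (c_vec \<bullet> \<xi> $ j - c_vec \<bullet> \<xi> $ k))" for k
  have coupling: "(\<Sum>j\<in>UNIV. (A $ k $ j) *\<^sub>R (C_mat *v (w $ j) - C_mat *v (w $ k))) $ 1 = g * y k" for k
  proof -
    have "(\<Sum>j\<in>UNIV. (A $ k $ j) *\<^sub>R (C_mat *v (w $ j) - C_mat *v (w $ k))) $ 1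
        = (\<Sum>j\<in>UNIV. A $ k $ j * (c_vec \<bullet> w $ j - c_vec \<bullet> w $ k))"
      by (simp add: C_mat_mult)
    also have "\<dots> = g * y k"
      unfolding c_vec_sync_error[OF g, of w _ k r] y_def \<xi>_def sum_distrib_left
      by (intro sum.cong) (auto simp: mult_ac)
    finally show ?thesis .
  qed
  have \<xi>r: "\<xi> $ r = 0" by (simp add: \<xi>_def sync_error_def vec_eq_iff)
  have N: "(\<Sum>j\<in>UNIV. reduced_laplacian r \<mu> A $ k $ j * (c_vec \<bullet> \<xi> $ j)) = y r - y k" for k
  proof -
    have L: "(\<Sum>j\<in>UNIV. laplacian A $ k $ j * (c_vec \<bullet> \<xi> $ j)) = - y k" for k
    proof -
      have "(\<Sum>j\<in>UNIV. laplacian A $ k $ j * (c_vec \<bullet> \<xi> $ j))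
          = (map_matrix of_real (laplacian A) *v (\<chi> k. c_vec \<bullet> \<xi> $ k)) $ k"
        by (simp add: map_matrix_def matrix_vector_mult_def)
      also have "\<dots> = (\<Sum>j\<in>UNIV. A $ k $ j * (c_vec \<bullet> \<xi> $ k - c_vec \<bullet> \<xi> $ j))"
        unfolding laplacian_mult[OF A] by simp
      also have "\<dots> = - y k"
        unfolding y_def sum_negf[symmetric] by (intro sum.cong) (auto simp: algebra_simps)
      finally show ?thesis .
    qed
    have "reduced_laplacian r \<mu> A $ k $ j * (c_vec \<bullet> \<xi> $ j)
        = laplacian A $ k $ j * (c_vec \<bullet> \<xi> $ j) - laplacian A $ r $ j * (c_vec \<bullet> \<xi> $ j)" for j
      using \<xi>r by (auto simp: reduced_laplacian_def algebra_simps)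
    then show ?thesis by (simp add: sum_subtractf L)
  qed
  have shift: "((shift_mat *v (w $ k)) $ i - (shift_mat *v (w $ r)) $ i) / g ^ idx i
      = g * (shift_mat *v \<xi> $ k) $ i" for k i
  proof -
    have "((shift_mat *v (w $ k)) $ i - (shift_mat *v (w $ r)) $ i) / g ^ idx i
        = (\<Sum>j\<in>UNIV. shift_mat $ i $ j * (w $ k $ j - w $ r $ j) / g ^ idx i)"
      by (simp add: matrix_vector_mult_def sum_subtractf[symmetric] sum_divide_distrib right_diff_distrib)
    also have "\<dots> = (\<Sum>j\<in>UNIV. g * (shift_mat $ i $ j * \<xi> $ k $ j))"
      using g by (intro sum.cong) (auto simp: shift_mat_def \<xi>_def sync_error_def)
    finally show ?thesis by (simp add: matrix_vector_mult_def sum_distrib_left)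
  qed
  have B: "x * B_vec $ i / g ^ idx i = x / g ^ CARD('d) * B_vec $ i" for x and i :: 'd
    by (simp add: B_vec_def)
  have "sync_error g r (network_dynamics \<phi> (gain g P) A w) $ k $ i
      = ((shift_mat *v (w $ k)) $ i - (shift_mat *v (w $ r)) $ i) / g ^ idx i
        + (\<phi> (w $ k) - \<phi> (w $ r)) * B_vec $ i / g ^ idx i
        + g * (y k - y r) * (P *v c_vec) $ i" for k i
  proof -
    have "network_dynamics \<phi> (gain g P) A w $ k $ i
        = (shift_mat *v (w $ k)) $ i + \<phi> (w $ k) * B_vec $ i + g ^ idx i * (g * y k) * (P *v c_vec) $ i" for k
      by (simp add: network_dynamics_def node_dynamics_def gain_mult coupling del: sum_component)
    then show ?thesis
      using g by (simp add: sync_error_def field_simps)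
  qed
  note se = this[unfolded shift B]
  have ef: "error_field g P (reduced_laplacian r \<mu> A) \<xi> $ k $ i
      = g * (shift_mat *v \<xi> $ k) $ i - g * ((y r - y k) * (P *v c_vec) $ i)" for k i
    by (simp add: error_field_def N right_diff_distrib)
  show ?thesis
    unfolding vec_eq_iff by (intro allI) (simp add: se ef algebra_simps)
qed

lemma norm_le_scaled_sync_error:
  fixes w :: "real ^ 'd::{finite,linorder} ^ 'n"
  assumes g: "g \<ge> 1"
  shows "norm (w $ k - w $ r) \<le> g ^ CARD('d) * norm (sync_error g r w $ k)"
proof -
  have "norm (w $ k - w $ r) \<le> norm (g ^ CARD('d) *\<^sub>R sync_error g r w $ k)"
  proof (rule norm_le_componentwise_cart)
    fix i
    have "\<bar>w $ k $ i - w $ r $ i\<bar> = g ^ idx i * \<bar>sync_error g r w $ k $ i\<bar>"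
      using g by (simp add: sync_error_def abs_mult)
    also have "\<dots> \<le> g ^ CARD('d) * \<bar>sync_error g r w $ k $ i\<bar>"
      using g idx_bounds(2) by (intro mult_right_mono power_increasing) auto
    finally show "norm ((w $ k - w $ r) $ i) \<le> norm ((g ^ CARD('d) *\<^sub>R sync_error g r w $ k) $ i)"
      using g by (simp add: abs_mult)
  qed
  then show ?thesis using g by simp
qed

text \<open>The divisor g^d compensates the largest scaling hidden in w_k - w_r, because no power
  g^(idx i) exceeds g^d when g \<ge> 1. This is why the bound is free of g.\<close>

lemma norm_sync_perturbation:
  fixes \<phi> :: "real ^ 'd::{finite,linorder} \<Rightarrow> real" and w :: "real ^ 'd::{finite,linorder} ^ 'n"
  assumes g: "g \<ge> 1" and lip: "L-lipschitz_on UNIV \<phi>"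
  shows "norm (\<chi> k. ((\<phi> (w $ k) - \<phi> (w $ r)) / g ^ CARD('d)) *\<^sub>R (B_vec :: real ^ 'd::{finite,linorder}))
    \<le> L * norm (B_vec :: real ^ 'd::{finite,linorder}) * norm (sync_error g r w)"
proof -
  have L: "L \<ge> 0" using lip by (rule lipschitz_on_nonneg)
  let ?b = "norm (B_vec :: real ^ 'd::{finite,linorder})"
  have "norm (\<chi> k. ((\<phi> (w $ k) - \<phi> (w $ r)) / g ^ CARD('d)) *\<^sub>R (B_vec :: real ^ 'd::{finite,linorder}))
      \<le> norm ((L * ?b) *\<^sub>R sync_error g r w)"
  proof (rule norm_le_componentwise_cart)
    fix k
    have "\<bar>\<phi> (w $ k) - \<phi> (w $ r)\<bar> \<le> L * norm (w $ k - w $ r)"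
      using lipschitz_onD[OF lip, of "w $ k" "w $ r"] by (simp add: dist_norm)
    also have "\<dots> \<le> L * (g ^ CARD('d) * norm (sync_error g r w $ k))"
      using L by (intro mult_left_mono norm_le_scaled_sync_error g)
    finally have "\<bar>\<phi> (w $ k) - \<phi> (w $ r)\<bar> / g ^ CARD('d) \<le> L * norm (sync_error g r w $ k)"
      using g by (simp add: pos_divide_le_eq mult_ac)
    then have "\<bar>\<phi> (w $ k) - \<phi> (w $ r)\<bar> / g ^ CARD('d) * ?b \<le> L * norm (sync_error g r w $ k) * ?b"
      by (rule mult_right_mono) simp
    then show "norm ((\<chi> k. ((\<phi> (w $ k) - \<phi> (w $ r)) / g ^ CARD('d)) *\<^sub>R (B_vec :: real ^ 'd::{finite,linorder})) $ k)
        \<le> norm (((L * ?b) *\<^sub>R sync_error g r w) $ k)"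
      using L g by (simp add: abs_mult mult_ac)
  qed
  then show ?thesis using L by (simp add: abs_mult)
qed

lemma has_vector_derivative_interior:
  assumes "(w has_vector_derivative D) (at t within {0..})" "t > (0::real)"
  shows "(w has_vector_derivative D) (at t)"
  using assms at_within_interior[of t "{0..}"] by simp

lemma sync_error_perturbed_solution:
  fixes \<phi> :: "real ^ 'd::{finite,linorder} \<Rightarrow> real" and w :: "real \<Rightarrow> real ^ 'd::{finite,linorder} ^ 'n"
  assumes g: "g \<ge> 1" and lip: "L-lipschitz_on UNIV \<phi>" and A: "adjacency (A (\<sigma> i))"
    and sol: "solution (switched_network \<phi> (gain g P) A \<sigma> \<Delta>T) w"
    and nonneg: "\<And>i. i \<ge> 1 \<Longrightarrow> \<Delta>T i \<ge> 0"
    and i: "i \<ge> 1" "switch_time \<Delta>T (i - 1) \<le> t" "t \<le> switch_time \<Delta>T i"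
  shows "perturbed_solution (L * norm (B_vec :: real ^ 'd::{finite,linorder}))
    (error_field g P (reduced_laplacian r \<mu> (A (\<sigma> i)))) (switch_time \<Delta>T (i - 1)) t (\<lambda>t. sync_error g r (w t))"
proof -
  let ?s = "switch_time \<Delta>T (i - 1)"
  have s0: "0 \<le> ?s" using switch_time_mono[of \<Delta>T 0 "i - 1", OF nonneg] by simp
  have lin: "bounded_linear (sync_error g r :: real ^ 'd::{finite,linorder} ^ 'n \<Rightarrow> _)"
    using linear_sync_error by (simp add: linear_conv_bounded_linear)
  obtain D where D: "locally_finite_times D" and cont: "continuous_on {0..} w"
    and deriv: "\<And>u. u \<in> {0..} - D \<Longrightarrow>
      (w has_vector_derivative switched_network \<phi> (gain g P) A \<sigma> \<Delta>T u (w u)) (at u within {0..})"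
    using sol unfolding solution_def by blast
  define \<xi>' where "\<xi>' u = sync_error g r (network_dynamics \<phi> (gain g P) (A (\<sigma> i)) (w u))" for u
  show ?thesis
    unfolding perturbed_solution_def
  \<comment> \<open>A locally finite set is finite within \<open>{0..t}\<close>; the switching times
    that bound the phase are excluded by the open interval.\<close>
  proof (intro conjI exI[of _ "D \<inter> {0..t}"] exI[of _ \<xi>'] ballI)
    show "continuous_on {?s..t} (\<lambda>t. sync_error g r (w t))"
      using s0 by (intro bounded_linear.continuous_on[OF lin] continuous_on_subset[OF cont]) auto
    show "finite (D \<inter> {0..t})" using D by (simp add: locally_finite_times_def)
    fix u assume u: "u \<in> {?s<..<t} - D \<inter> {0..t}"
    then have u0: "u > 0" "u \<in> {0..} - D" using s0 by auto
    have "active_index \<Delta>T u = i" using u i by (intro active_index_eq nonneg) auto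
    then have "(w has_vector_derivative network_dynamics \<phi> (gain g P) (A (\<sigma> i)) (w u)) (at u)"
      using has_vector_derivative_interior[OF deriv[OF u0(2)] u0(1)] by (simp add: switched_network_def)
    then show "((\<lambda>t. sync_error g r (w t)) has_vector_derivative \<xi>' u) (at u)"
      unfolding \<xi>'_def by (rule bounded_linear.has_vector_derivative[OF lin])
    show "norm (\<xi>' u - error_field g P (reduced_laplacian r \<mu> (A (\<sigma> i))) (sync_error g r (w u)))
        \<le> L * norm (B_vec :: real ^ 'd::{finite,linorder}) * norm (sync_error g r (w u))"
      using sync_error_network_dynamics[of g "A (\<sigma> i)" r \<phi> P "w u" \<mu>] g A
        norm_sync_perturbation[OF g lip, of "w u" r]
      by (simp add: \<xi>'_def)
  qed
qed

section \<open>Input-to-state stability\<close>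

text \<open>Off the switching times the active index is locally constant, so the continuity of one
  \<open>F i\<close> is inherited. At a switching time the one-sided limits come from the
  nondegenerate phases adjacent to it.\<close>

lemma piecewise_continuous_switched:
  fixes F :: "nat \<Rightarrow> real \<Rightarrow> 'a::real_normed_vector"
  assumes nonneg: "\<And>i. i \<ge> 1 \<Longrightarrow> \<Delta>T i \<ge> 0"
    and unbounded: "\<And>t. \<exists>m. t < switch_time \<Delta>T (2 * m)"
    and F: "\<And>i. continuous_on {0..} (F i)"
  shows "piecewise_continuous (\<lambda>t. F (active_index \<Delta>T t) t)"
  unfolding piecewise_continuous_def
proof (intro conjI allI impI exI[of _ "range (switch_time \<Delta>T)"])
  have active: "active_index \<Delta>T s = i" if "i \<ge> 1" "switch_time \<Delta>T (i - 1) \<le> s" "s < switch_time \<Delta>T i" for i s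
    using nonneg that by (rule active_index_eq)
  have isCont: "isCont (F i) t" if "t > 0" for i t
    using continuous_on_interior[OF F[of i]] that by simp
  show "locally_finite_times (range (switch_time \<Delta>T))"
    using locally_finite_switch_times[OF nonneg unbounded] .
  show "continuous_on ({0..} - range (switch_time \<Delta>T)) (\<lambda>t. F (active_index \<Delta>T t) t)"
    unfolding continuous_on_eq_continuous_within
  proof
    fix t assume t: "t \<in> {0..} - range (switch_time \<Delta>T)"
    then obtain i where i: "i \<ge> 1" "switch_time \<Delta>T (i - 1) \<le> t" "t < switch_time \<Delta>T i"
      using ex_switch_index[of \<Delta>T t, OF unbounded] by auto
    \<comment> \<open>The origin is a switching time, so t is positive and \<open>F i\<close> is
      continuous at t from both sides.\<close>
    have "switch_time \<Delta>T (i - 1) \<noteq> t" "t \<noteq> switch_time \<Delta>T 0" using t by blast+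
    then have t': "switch_time \<Delta>T (i - 1) < t" "t > 0" using i t by auto
    have "\<forall>\<^sub>F s in nhds t. F (active_index \<Delta>T s) s = F i s"
      using eventually_nhds_in_open[of "{switch_time \<Delta>T (i - 1)<..<switch_time \<Delta>T i}" t] i t'
      by (auto elim!: eventually_mono simp: active)
    from isCont_cong[OF this] isCont[OF t'(2), of i]
    have "isCont (\<lambda>t. F (active_index \<Delta>T t) t) t" by blast
    then show "continuous (at t within {0..} - range (switch_time \<Delta>T)) (\<lambda>t. F (active_index \<Delta>T t) t)"
      by (rule continuous_at_imp_continuous_at_within)
  qed
  show "\<exists>l. ((\<lambda>t. F (active_index \<Delta>T t) t) \<longlongrightarrow> l) (at_right t)" if t: "0 \<le> t" for t
  proof -
    obtain i where i: "i \<ge> 1" "switch_time \<Delta>T (i - 1) \<le> t" "t < switch_time \<Delta>T i"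
      using ex_switch_index[of \<Delta>T t, OF unbounded t] by blast
    have ev: "\<forall>\<^sub>F s in at_right t. F i s = F (active_index \<Delta>T s) s"
      unfolding eventually_at_right[OF i(3)] using i active by (intro exI[of _ "switch_time \<Delta>T i"]) auto
    have "(F i \<longlongrightarrow> F i t) (at t within {0..})"
      using F[of i] t by (simp add: continuous_on_def)
    then have lim: "(F i \<longlongrightarrow> F i t) (at_right t)"
      by (rule tendsto_within_subset) (use t in auto)
    show ?thesis using Lim_transform_eventually[OF lim ev] by blast
  qed
  show "\<exists>l. ((\<lambda>t. F (active_index \<Delta>T t) t) \<longlongrightarrow> l) (at_left t)" if t: "0 < t" for t
  proof -
    obtain i where i: "i \<ge> 1" "switch_time \<Delta>T (i - 1) < t" "t \<le> switch_time \<Delta>T i"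
      using ex_switch_index_left[of \<Delta>T t, OF unbounded t] by blast
    have ev: "\<forall>\<^sub>F s in at_left t. F i s = F (active_index \<Delta>T s) s"
      unfolding eventually_at_left[OF i(2)] using i active by (intro exI[of _ "switch_time \<Delta>T (i - 1)"]) auto
    have lim: "(F i \<longlongrightarrow> F i t) (at_left t)"
      using isCont[OF t, of i] unfolding isCont_def by (rule tendsto_within_subset) simp
    show ?thesis using Lim_transform_eventually[OF lim ev] by blast
  qed
qed

section \<open>Restarting inputs and solutions at a later time\<close>

lemma locally_finite_times_shift:
  assumes "locally_finite_times D" "T \<ge> 0"
  shows "locally_finite_times {t. t + T \<in> D}"
  unfolding locally_finite_times_def
proof
  fix t
  have "{t. t + T \<in> D} \<inter> {0..t} \<subseteq> (\<lambda>s. s - T) ` (D \<inter> {0..t + T})"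
  proof
    fix s assume "s \<in> {t. t + T \<in> D} \<inter> {0..t}"
    then have "s + T \<in> D \<inter> {0..t + T}" "s = (s + T) - T" using \<open>T \<ge> 0\<close> by auto
    then show "s \<in> (\<lambda>s. s - T) ` (D \<inter> {0..t + T})" by blast
  qed
  moreover have "finite (D \<inter> {0..t + T})" using assms(1) by (simp add: locally_finite_times_def)
  ultimately show "finite ({t. t + T \<in> D} \<inter> {0..t})" using finite_imageI finite_subset by blast
qed

lemma piecewise_continuous_shift:
  assumes u: "piecewise_continuous u" and T: "T \<ge> 0"
  shows "piecewise_continuous (\<lambda>t. u (t + T))"
proof -
  obtain D where D: "locally_finite_times D" "continuous_on ({0..} - D) u"
    using u unfolding piecewise_continuous_def by blast
  have "continuous_on ({0..} - {t. t + T \<in> D}) (\<lambda>t. u (t + T))"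
    by (rule continuous_on_compose2[OF D(2)]) (use T in \<open>auto intro!: continuous_intros\<close>)
  moreover have "\<exists>l. ((\<lambda>t. u (t + T)) \<longlongrightarrow> l) (at_right t)" if t: "t \<ge> 0" for t
  proof -
    obtain l where "(u \<longlongrightarrow> l) (at_right (t + T))"
      using u add_nonneg_nonneg[OF t T] unfolding piecewise_continuous_def by blast
    moreover have "at_right (t + T) = filtermap (\<lambda>s. s + T) (at_right t)"
      using filtermap_at_right_shift[of "- T" t] by simp
    ultimately show ?thesis by (auto simp: filterlim_def filtermap_filtermap)
  qed
  moreover have "\<exists>l. ((\<lambda>t. u (t + T)) \<longlongrightarrow> l) (at_left t)" if t: "t > 0" for t
  proof -
    obtain l where "(u \<longlongrightarrow> l) (at_left (t + T))"
      using u add_pos_nonneg[OF t T] unfolding piecewise_continuous_def by blast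
    moreover have "at_left (t + T) = filtermap (\<lambda>s. s + T) (at_left t)"
      using filtermap_at_left_shift[of "- T" t] by simp
    ultimately show ?thesis by (auto simp: filterlim_def filtermap_filtermap)
  qed
  ultimately show ?thesis
    using locally_finite_times_shift[OF D(1) T] unfolding piecewise_continuous_def by blast
qed

lemma solution_shift:
  assumes sol: "solution f w" and T: "T \<ge> 0"
  shows "solution (\<lambda>t. f (t + T)) (\<lambda>t. w (t + T))"
proof -
  obtain D where D: "locally_finite_times D" and cont: "continuous_on {0..} w"
    and deriv: "\<And>t. t \<in> {0..} - D \<Longrightarrow> (w has_vector_derivative f t (w t)) (at t within {0..})"
    using sol unfolding solution_def by blast
  have "continuous_on {0..} (\<lambda>t. w (t + T))"
    by (rule continuous_on_compose2[OF cont]) (use T in \<open>auto intro!: continuous_intros\<close>)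
  moreover have "((\<lambda>t. w (t + T)) has_vector_derivative f (t + T) (w (t + T))) (at t within {0..})"
    if t: "t \<in> {0..} - {t. t + T \<in> D}" for t
  proof -
    have "((\<lambda>t. t + T) has_vector_derivative 1) (at t within {0..})"
      by (auto intro!: derivative_eq_intros)
    moreover have "(w has_vector_derivative f (t + T) (w (t + T))) (at (t + T) within (\<lambda>t. t + T) ` {0..})"
      by (rule has_vector_derivative_within_subset[OF deriv]) (use t T in auto)
    ultimately show ?thesis
      using vector_diff_chain_within[of "\<lambda>t. t + T" 1 t "{0..}" w] by (simp add: o_def)
  qed
  ultimately show ?thesis
    using locally_finite_times_shift[OF D T] unfolding solution_def by blast
qed

section \<open>Comparison functions and consequences of input-to-state stability\<close>

lemma class_K_mono:
  assumes "class_K \<gamma>" "0 \<le> x" "x \<le> y"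
  shows "\<gamma> x \<le> \<gamma> y"
  using assms unfolding class_K_def by (cases "x = y") (auto simp: strict_mono_on_def intro: less_imp_le)

lemma class_K_small:
  assumes "class_K \<gamma>" "e > 0"
  obtains \<eta> where "\<eta> > 0" "\<gamma> \<eta> < e"
proof -
  have lim: "\<forall>x\<in>{0..}. (\<gamma> \<longlongrightarrow> \<gamma> x) (at x within {0..})" and \<gamma>0: "\<gamma> 0 = 0"
    using assms by (simp_all add: class_K_def continuous_on_def)
  have "(\<gamma> \<longlongrightarrow> \<gamma> 0) (at 0 within {0..})" by (rule bspec[OF lim]) simp
  then have "\<forall>\<^sub>F x in at 0 within {0..}. dist (\<gamma> x) 0 < e" using tendstoD[OF _ assms(2)] \<gamma>0 by fastforce
  then obtain d where d: "d > 0" "\<And>x. x \<ge> 0 \<Longrightarrow> x \<noteq> 0 \<Longrightarrow> dist x 0 < d \<Longrightarrow> dist (\<gamma> x) 0 < e"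
    unfolding eventually_at by auto
  then show ?thesis using d(2)[of "d / 2"] by (intro that[of "d / 2"]) (simp_all add: abs_less_iff)
qed

lemma sup_norm_upto_bounds:
  assumes B: "B \<ge> 0" and u: "\<And>s. 0 \<le> s \<Longrightarrow> norm (u s) \<le> B"
  shows "0 \<le> sup_norm_upto u t" "sup_norm_upto u t \<le> B"
proof -
  have bound: "x \<le> B" if "x \<in> insert 0 ((\<lambda>s. norm (u s)) ` {0..<t})" for x
    using that B u by auto
  then show "sup_norm_upto u t \<le> B" unfolding sup_norm_upto_def by (intro cSup_least) auto
  show "0 \<le> sup_norm_upto u t"
    unfolding sup_norm_upto_def using bound by (intro cSup_upper bdd_aboveI[of _ B]) auto
qed

text \<open>Monotonicity of \<gamma> trades the supremum for an arbitrary bound B of the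
  input.\<close>

lemma input_to_state_stable_bound:
  assumes "input_to_state_stable F W"
  obtains \<beta> \<gamma> where "class_KL \<beta>" "class_K \<gamma>"
    "\<And>u w B t. piecewise_continuous u \<Longrightarrow> solution (\<lambda>t x. F x + u t) w \<Longrightarrow> 0 \<le> B \<Longrightarrow>
      (\<And>s. 0 \<le> s \<Longrightarrow> norm (u s) \<le> B) \<Longrightarrow> 0 \<le> t \<Longrightarrow>
      infdist (w t) W \<le> max (\<beta> (infdist (w 0) W) t) (\<gamma> B)"
proof -
  obtain \<beta> \<gamma> where KL: "class_KL \<beta>" and K: "class_K \<gamma>"
    and iss: "\<And>u w t. piecewise_continuous u \<Longrightarrow> solution (\<lambda>t x. F x + u t) w \<Longrightarrow> 0 \<le> t \<Longrightarrow>
      infdist (w t) W \<le> max (\<beta> (infdist (w 0) W) t) (\<gamma> (sup_norm_upto u t))"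
    using assms unfolding input_to_state_stable_def by blast
  show ?thesis
  proof (rule that[OF KL K])
    fix u w B and t :: real
    assume u: "piecewise_continuous u" "solution (\<lambda>t x. F x + u t) w" "0 \<le> t"
      and B: "0 \<le> B" "\<And>s. 0 \<le> s \<Longrightarrow> norm (u s) \<le> B"
    have "\<gamma> (sup_norm_upto u t) \<le> \<gamma> B"
      using sup_norm_upto_bounds[of B u t] B by (intro class_K_mono[OF K]) auto
    then show "infdist (w t) W \<le> max (\<beta> (infdist (w 0) W) t) (\<gamma> B)"
      using iss[OF u] by linarith
  qed
qed

text \<open>Started at time 0, the estimate would keep the contribution of the largest input for
  ever. It is restarted at a time T' after which the input stays within \<eta>, so that both terms
  of the maximum fall below e.\<close>

lemma input_to_state_stable_converging_input:
  assumes iss: "input_to_state_stable F W" and u: "piecewise_continuous u" "(u \<longlongrightarrow> 0) at_top"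
    and w: "solution (\<lambda>t x. F x + u t) w"
  shows "((\<lambda>t. infdist (w t) W) \<longlongrightarrow> 0) at_top"
proof (rule tendstoI)
  fix e :: real assume e: "e > 0"
  obtain \<beta> \<gamma> where KL: "class_KL \<beta>" and K: "class_K \<gamma>"
    and bound: "\<And>u w B t. piecewise_continuous u \<Longrightarrow> solution (\<lambda>t x. F x + u t) w \<Longrightarrow> 0 \<le> B \<Longrightarrow>
      (\<And>s. 0 \<le> s \<Longrightarrow> norm (u s) \<le> B) \<Longrightarrow> 0 \<le> t \<Longrightarrow>
      infdist (w t) W \<le> max (\<beta> (infdist (w 0) W) t) (\<gamma> B)"
    using input_to_state_stable_bound[OF iss] by blast
  obtain \<eta> where \<eta>: "\<eta> > 0" "\<gamma> \<eta> < e" using class_K_small[OF K e] .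
  have "\<forall>\<^sub>F t in at_top. norm (u t) < \<eta>" using u(2) \<eta>(1) by (auto dest: tendstoD)
  then obtain T where T: "\<And>t. t \<ge> T \<Longrightarrow> norm (u t) < \<eta>" by (auto simp: eventually_at_top_linorder)
  define T' where "T' = max T 0"
  have T': "T' \<ge> 0" "T' \<ge> T" by (auto simp: T'_def)
  have "(\<beta> (infdist (w T') W) \<longlongrightarrow> 0) at_top"
    using KL infdist_nonneg by (auto simp: class_KL_def)
  then have "\<forall>\<^sub>F t in at_top. \<beta> (infdist (w T') W) t < e"
    using e by (auto dest: order_tendstoD)
  then have "\<forall>\<^sub>F t in at_top. infdist (w (t + T')) W < e"
    using eventually_ge_at_top[of 0]
  proof eventually_elim
    case (elim t)
    have "norm (u (s + T')) \<le> \<eta>" if "0 \<le> s" for s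
      using T[of "s + T'"] T' that by simp
    then have "infdist (w (t + T')) W \<le> max (\<beta> (infdist (w (0 + T')) W) t) (\<gamma> \<eta>)"
      using bound[OF piecewise_continuous_shift[OF u(1) T'(1)] solution_shift[OF w T'(1)]] \<eta>(1) elim(2) by simp
    then show ?case using elim \<eta> by simp
  qed
  then obtain S where S: "\<And>t. t \<ge> S \<Longrightarrow> infdist (w (t + T')) W < e"
    by (auto simp: eventually_at_top_linorder)
  have "dist (infdist (w t) W) 0 < e" if "t \<ge> S + T'" for t
    using S[of "t - T'"] that infdist_nonneg[of "w t" W] by simp
  then show "\<forall>\<^sub>F t in at_top. dist (infdist (w t) W) 0 < e"
    unfolding eventually_at_top_linorder by blast
qed

text \<open>As \<beta> decreases in time, its value at time 0 controls the transient; that value and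
  \<gamma> are small near 0 by continuity.\<close>

lemma input_to_state_stable_small_input:
  assumes iss: "input_to_state_stable F W" and e: "e > 0"
  obtains \<delta> \<eta> where "\<delta> > 0" "\<eta> > 0"
    "\<And>u w t. piecewise_continuous u \<Longrightarrow> solution (\<lambda>t x. F x + u t) w \<Longrightarrow> infdist (w 0) W \<le> \<delta> \<Longrightarrow>
      (\<And>s. 0 \<le> s \<Longrightarrow> norm (u s) \<le> \<eta>) \<Longrightarrow> 0 \<le> t \<Longrightarrow> infdist (w t) W < e"
proof -
  obtain \<beta> \<gamma> where KL: "class_KL \<beta>" and K: "class_K \<gamma>"
    and bound: "\<And>u w B t. piecewise_continuous u \<Longrightarrow> solution (\<lambda>t x. F x + u t) w \<Longrightarrow> 0 \<le> B \<Longrightarrow>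
      (\<And>s. 0 \<le> s \<Longrightarrow> norm (u s) \<le> B) \<Longrightarrow> 0 \<le> t \<Longrightarrow>
      infdist (w t) W \<le> max (\<beta> (infdist (w 0) W) t) (\<gamma> B)"
    using input_to_state_stable_bound[OF iss] by blast
  have K0: "class_K (\<lambda>r. \<beta> r 0)" using KL by (simp add: class_KL_def)
  obtain \<delta> where \<delta>: "\<delta> > 0" "\<beta> \<delta> 0 < e" using class_K_small[OF K0 e] .
  obtain \<eta> where \<eta>: "\<eta> > 0" "\<gamma> \<eta> < e" using class_K_small[OF K e] .
  show ?thesis
  proof (rule that[OF \<delta>(1) \<eta>(1)])
    fix u w and t :: real
    assume u: "piecewise_continuous u" "solution (\<lambda>t x. F x + u t) w" and init: "infdist (w 0) W \<le> \<delta>"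
      and small: "\<And>s. 0 \<le> s \<Longrightarrow> norm (u s) \<le> \<eta>" and t: "0 \<le> t"
    have "antimono_on {0..} (\<beta> (infdist (w 0) W))" using KL infdist_nonneg by (auto simp: class_KL_def)
    then have "\<beta> (infdist (w 0) W) t \<le> \<beta> (infdist (w 0) W) 0"
      using t by (auto simp: monotone_on_def)
    also have "\<dots> \<le> \<beta> \<delta> 0" using class_K_mono[OF K0 infdist_nonneg init] .
    finally show "infdist (w t) W < e" using bound[OF u _ small t] \<delta> \<eta> by simp
  qed
qed

section \<open>The switched network\<close>

text \<open>Finitely many thresholds have a common upper bound. Each \<open>Q i\<close> has to
  survive enlarging its argument, hence the form of the hypothesis.\<close>

lemma finite_uniform_at_top:
  fixes Q :: "'i \<Rightarrow> real \<Rightarrow> bool"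
  assumes "finite S" and "\<And>i. i \<in> S \<Longrightarrow> \<exists>k. \<forall>k'\<ge>k. Q i k'"
  obtains K where "\<And>i k. i \<in> S \<Longrightarrow> k \<ge> K \<Longrightarrow> Q i k"
proof -
  have "\<forall>\<^sub>F k in at_top. \<forall>i\<in>S. Q i k"
    using assms by (intro eventually_ball_finite) (auto simp: eventually_at_top_linorder)
  then show ?thesis using that by (auto simp: eventually_at_top_linorder)
qed

text \<open>M may depend on g, \<tau> and the switching but is chosen before w, as Lyapunov
  stability requires; the threshold for \<tau> is chosen before g.\<close>

lemma sync_error_decay:
  fixes A :: "nat \<Rightarrow> real ^ 'n ^ 'n" and \<phi> :: "real ^ 'd::{finite,linorder} \<Rightarrow> real"
    and P :: "real ^ 'd::{finite,linorder} ^ 'd::{finite,linorder}" and r :: 'n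
  assumes topologies: "\<And>i. i \<in> {1..Nt} \<Longrightarrow> adjacency (A i)"
    and lip: "L-lipschitz_on UNIV \<phi>"
    and spectrum: "\<And>i z. i \<in> {1..Nt} \<Longrightarrow> is_eigenvalue (laplacian (A i)) z \<Longrightarrow> z \<noteq> 0 \<Longrightarrow> \<mu> \<le> Re z"
    and T0: "T0 > 0" and a: "a > 0" and P: "sym_pos_def P"
    and riccati: "shift_mat ** P + P ** transpose shift_mat
        - (2 * \<mu>) *\<^sub>R (P ** transpose C_mat ** C_mat ** P) + a *\<^sub>R mat 1 = 0"
  obtains \<tau>s gs where "\<tau>s > 0" "gs \<ge> 1"
    "\<And>\<tau> g \<sigma> \<Delta>T. \<lbrakk>\<tau> \<ge> \<tau>s; g \<ge> gs; \<And>i. i \<ge> 1 \<Longrightarrow> \<sigma> i \<in> {1..Nt}; \<And>i. i \<ge> 1 \<Longrightarrow> \<Delta>T i \<ge> 0;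
      \<And>i. i \<ge> 1 \<Longrightarrow> odd i \<Longrightarrow> connected_topology (A (\<sigma> i));
      \<And>i. i \<ge> 1 \<Longrightarrow> even i \<Longrightarrow> \<Delta>T i \<le> T0;
      \<And>n. (\<Sum>m=0..n. \<Delta>T (1 + 2 * m)) \<ge> \<tau> * (real n - real n0)\<rbrakk> \<Longrightarrow>
      \<exists>M. \<forall>w. solution (switched_network \<phi> (gain g P) A \<sigma> \<Delta>T) w \<longrightarrow>
        (\<forall>t\<ge>0. norm (sync_error g r (w t)) \<le> M * norm (sync_error g r (w 0))) \<and>
        ((\<lambda>t. norm (sync_error g r (w t))) \<longlongrightarrow> 0) at_top"
proof -
  define l where "l = L * norm (B_vec :: real ^ 'd::{finite,linorder})"
  have l: "l \<ge> 0" using lipschitz_on_nonneg[OF lip] by (simp add: l_def)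
  let ?N = "\<lambda>i. reduced_laplacian r \<mu> (A i)"
  obtain c where c: "c > 0" and decay: "\<And>N :: real ^ 'n ^ 'n. (\<And>z. is_eigenvalue N z \<Longrightarrow> \<mu> \<le> Re z) \<Longrightarrow>
    \<exists>K\<ge>1. \<forall>g\<ge>K. \<forall>s t \<xi>. s \<le> t \<longrightarrow> perturbed_solution l (error_field g P N) s t \<xi> \<longrightarrow>
      norm (\<xi> t) \<le> K * exp (- (c * g * (t - s))) * norm (\<xi> s)"
    using error_field_decay[OF P riccati a l] by blast
  \<comment> \<open>K occurs as threshold and as overshoot, and the condition survives enlarging it,
    so that one K serves all topologies; for non-connected ones it is void.\<close>
  define Q where "Q i K \<longleftrightarrow> (connected_topology (A i) \<longrightarrow> (\<forall>g\<ge>K. \<forall>s t \<xi>. s \<le> t \<longrightarrow>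
      perturbed_solution l (error_field g P (?N i)) s t \<xi> \<longrightarrow>
      norm (\<xi> t) \<le> K * exp (- (c * g * (t - s))) * norm (\<xi> s)))" for i K
  have "\<exists>k. \<forall>k'\<ge>k. Q i k'" if i: "i \<in> {1..Nt}" for i
  proof (cases "connected_topology (A i)")
    case True
    have "\<mu> \<le> Re z" if "is_eigenvalue (?N i) z" for z
      using reduced_laplacian_eigenvalue[OF topologies[OF i] True _ that] spectrum[OF i] by blast
    then have "\<exists>K\<ge>1. \<forall>g\<ge>K. \<forall>s t \<xi>. s \<le> t \<longrightarrow> perturbed_solution l (error_field g P (?N i)) s t \<xi> \<longrightarrow>
      norm (\<xi> t) \<le> K * exp (- (c * g * (t - s))) * norm (\<xi> s)" by (rule decay)
    then obtain K where K: "\<forall>g\<ge>K. \<forall>s t \<xi>. s \<le> t \<longrightarrow> perturbed_solution l (error_field g P (?N i)) s t \<xi> \<longrightarrow>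
      norm (\<xi> t) \<le> K * exp (- (c * g * (t - s))) * norm (\<xi> s)" by (elim exE conjE)
    have "Q i k" if k: "k \<ge> K" for k
      unfolding Q_def
    proof (intro impI allI)
      fix g s t :: real and \<xi> :: "real \<Rightarrow> real ^ 'd::{finite,linorder} ^ 'n"
      assume "k \<le> g" "s \<le> t" "perturbed_solution l (error_field g P (?N i)) s t \<xi>"
      then have "norm (\<xi> t) \<le> K * exp (- (c * g * (t - s))) * norm (\<xi> s)" using K k by simp
      also have "\<dots> \<le> k * exp (- (c * g * (t - s))) * norm (\<xi> s)"
        using k by (intro mult_right_mono) auto
      finally show "norm (\<xi> t) \<le> k * exp (- (c * g * (t - s))) * norm (\<xi> s)" .
    qed
    then show ?thesis by blast
  qed (simp add: Q_def)
  then obtain K0 where K0: "\<And>i k. i \<in> {1..Nt} \<Longrightarrow> k \<ge> K0 \<Longrightarrow> Q i k"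
    using finite_uniform_at_top[of "{1..Nt}" Q] by blast
  define K where "K = max 1 K0"
  have K: "K \<ge> 1" and odd_decay: "\<And>i g s t \<xi>. i \<in> {1..Nt} \<Longrightarrow> connected_topology (A i) \<Longrightarrow> g \<ge> K \<Longrightarrow> s \<le> t \<Longrightarrow>
      perturbed_solution l (error_field g P (?N i)) s t \<xi> \<Longrightarrow>
      norm (\<xi> t) \<le> K * exp (- (c * g * (t - s))) * norm (\<xi> s)"
    using K0[of _ K] unfolding K_def Q_def by auto
  define G where "G i \<rho> \<longleftrightarrow> (\<forall>g s t \<xi>. g \<ge> 1 \<longrightarrow> s \<le> t \<longrightarrow>
    perturbed_solution l (error_field g P (?N i)) s t \<xi> \<longrightarrow> norm (\<xi> t) \<le> exp (\<rho> * g * (t - s)) * norm (\<xi> s))" for i \<rho>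
  have "\<exists>k. \<forall>k'\<ge>k. G i k'" for i
  proof (rule error_field_growth[OF l, of P "?N i"])
    fix \<rho> assume \<rho>: "\<And>g s t \<xi>. g \<ge> 1 \<Longrightarrow> s \<le> t \<Longrightarrow> perturbed_solution l (error_field g P (?N i)) s t \<xi> \<Longrightarrow>
      norm (\<xi> t) \<le> exp (\<rho> * g * (t - s)) * norm (\<xi> s)"
    have "G i k" if k: "k \<ge> \<rho>" for k
      unfolding G_def
    proof (intro impI allI)
      fix g s t :: real and \<xi> :: "real \<Rightarrow> real ^ 'd::{finite,linorder} ^ 'n"
      assume *: "1 \<le> g" "s \<le> t" "perturbed_solution l (error_field g P (?N i)) s t \<xi>"
      have "norm (\<xi> t) \<le> exp (\<rho> * g * (t - s)) * norm (\<xi> s)" using \<rho>[OF *] .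
      also have "\<dots> \<le> exp (k * g * (t - s)) * norm (\<xi> s)"
        using k * by (intro mult_right_mono) (auto intro!: mult_right_mono)
      finally show "norm (\<xi> t) \<le> exp (k * g * (t - s)) * norm (\<xi> s)" .
    qed
    then show ?thesis by blast
  qed
  then obtain \<rho>0 where \<rho>0: "\<And>i k. i \<in> {1..Nt} \<Longrightarrow> k \<ge> \<rho>0 \<Longrightarrow> G i k"
    using finite_uniform_at_top[of "{1..Nt}" G] by blast
  define \<rho> where "\<rho> = max 0 \<rho>0"
  have \<rho>: "\<rho> \<ge> 0" and growth: "\<And>i g s t \<xi>. i \<in> {1..Nt} \<Longrightarrow> g \<ge> 1 \<Longrightarrow> s \<le> t \<Longrightarrow>
      perturbed_solution l (error_field g P (?N i)) s t \<xi> \<Longrightarrow> norm (\<xi> t) \<le> exp (\<rho> * g * (t - s)) * norm (\<xi> s)"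
    using \<rho>0[of _ \<rho>] unfolding \<rho>_def G_def by auto
  \<comment> \<open>Makes c \<tau>s the sum of ln K for the overshoot, \<rho> T0 for the growth in
    an even phase, and 1 for the decay left per period.\<close>
  define \<tau>s where "\<tau>s = (ln K + \<rho> * T0 + 1) / c"
  have lnK: "ln K \<ge> 0" using K by simp
  have \<tau>s: "\<tau>s > 0" using c lnK \<rho> T0 by (auto simp: \<tau>s_def intro!: divide_pos_pos add_nonneg_pos)
  show ?thesis
  proof (rule that[OF \<tau>s K])
    fix \<tau> g :: real and \<sigma> :: "nat \<Rightarrow> nat" and \<Delta>T :: "nat \<Rightarrow> real"
    assume \<tau>: "\<tau> \<ge> \<tau>s" and g: "g \<ge> K" and \<sigma>: "\<And>i. i \<ge> 1 \<Longrightarrow> \<sigma> i \<in> {1..Nt}"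
      and nonneg: "\<And>i. i \<ge> 1 \<Longrightarrow> \<Delta>T i \<ge> 0"
      and conn: "\<And>i. i \<ge> 1 \<Longrightarrow> odd i \<Longrightarrow> connected_topology (A (\<sigma> i))"
      and even_le: "\<And>i. i \<ge> 1 \<Longrightarrow> even i \<Longrightarrow> \<Delta>T i \<le> T0"
      and dwell: "\<And>n. (\<Sum>m=0..n. \<Delta>T (1 + 2 * m)) \<ge> \<tau> * (real n - real n0)"
    have \<tau>0: "\<tau> > 0" and g1: "g \<ge> 1" using \<tau> \<tau>s g K by auto
    have contraction: "K * exp (\<rho> * g * T0) \<le> exp (c * g * \<tau> - 1)"
    proof -
      \<comment> \<open>Only the growth term carries a factor g; as g \<ge> 1, ln K + 1 may be
        multiplied by g too, and the same \<tau> serves every g.\<close>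
      have "ln K + \<rho> * g * T0 + 1 \<le> g * (ln K + \<rho> * T0 + 1)"
        using mult_right_mono[OF g1, of "ln K + 1"] lnK by (simp add: algebra_simps)
      also have "\<dots> = g * (c * \<tau>s)" using c by (simp add: \<tau>s_def)
      also have "\<dots> \<le> g * (c * \<tau>)" using \<tau> c g1 by (intro mult_left_mono) auto
      finally have "exp (ln K + \<rho> * g * T0) \<le> exp (c * g * \<tau> - 1)" by (simp add: mult_ac)
      then show ?thesis using K by (simp add: exp_add)
    qed
    define M where "M = K * exp (\<rho> * g * T0 + c * g * \<tau> * real (n0 + 1))"
    have unbounded: "\<exists>m. t < switch_time \<Delta>T (2 * m)" for t
      using switch_time_at_top[of \<Delta>T \<tau> n0 t, OF nonneg \<tau>0 dwell] .
    show "\<exists>M. \<forall>w. solution (switched_network \<phi> (gain g P) A \<sigma> \<Delta>T) w \<longrightarrow>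
        (\<forall>t\<ge>0. norm (sync_error g r (w t)) \<le> M * norm (sync_error g r (w 0))) \<and>
        ((\<lambda>t. norm (sync_error g r (w t))) \<longlongrightarrow> 0) at_top"
    proof (intro exI[of _ M] allI impI)
      fix w assume sol: "solution (switched_network \<phi> (gain g P) A \<sigma> \<Delta>T) w"
      define X where "X t = norm (sync_error g r (w t))" for t
      have pert: "perturbed_solution l (error_field g P (?N (\<sigma> i))) (switch_time \<Delta>T (i - 1)) t (\<lambda>t. sync_error g r (w t))"
        if "i \<ge> 1" "switch_time \<Delta>T (i - 1) \<le> t" "t \<le> switch_time \<Delta>T i" for i t
        unfolding l_def using that \<sigma>[OF that(1)]
        by (intro sync_error_perturbed_solution[OF g1 lip _ sol nonneg] topologies)
      have bound: "X t \<le> M * X 0 * exp (- real m)"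
        if t: "switch_time \<Delta>T (2 * m) \<le> t" "t \<le> switch_time \<Delta>T (2 * m + 2)" for m t
      proof -
        have "X t \<le> K * exp (\<rho> * g * T0 + c * g * \<tau> * real (n0 + 1)) * exp (- real m) * X 0"
        proof (rule average_dwell_time_decay[OF nonneg even_le \<tau>0 dwell])
          fix i t assume i: "odd i" "switch_time \<Delta>T (i - 1) \<le> t" "t \<le> switch_time \<Delta>T i"
          then have "i \<ge> 1" by (cases i) auto
          then show "X t \<le> K * exp (- (c * g * (t - switch_time \<Delta>T (i - 1)))) * X (switch_time \<Delta>T (i - 1))"
            unfolding X_def using i by (intro odd_decay[OF \<sigma> conn g _ pert])
        next
          fix i t assume i: "1 \<le> i" "even i" "switch_time \<Delta>T (i - 1) \<le> t" "t \<le> switch_time \<Delta>T i"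
          then show "X t \<le> exp (\<rho> * g * (t - switch_time \<Delta>T (i - 1))) * X (switch_time \<Delta>T (i - 1))"
            unfolding X_def by (intro growth[OF \<sigma> g1 _ pert])
        qed (use c g1 \<rho> K contraction t in \<open>auto simp: X_def\<close>)
        then show ?thesis by (simp add: M_def mult_ac)
      qed
      have "X t \<le> M * X 0" if "t \<ge> 0" for t
        using period_bound_imp_decay(1)[of \<Delta>T X "M * X 0" t, OF nonneg unbounded _ bound that] by (simp add: X_def)
      moreover have "(X \<longlongrightarrow> 0) at_top"
        using period_bound_imp_decay(2)[of \<Delta>T X "M * X 0", OF nonneg unbounded _ bound] by (simp add: X_def)
      ultimately show "(\<forall>t\<ge>0. norm (sync_error g r (w t)) \<le> M * norm (sync_error g r (w 0))) \<and>
        ((\<lambda>t. norm (sync_error g r (w t))) \<longlongrightarrow> 0) at_top"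
        unfolding X_def by blast
    qed
  qed
qed

text \<open>The influence of the other nodes on node k, to be read as the input of the isolated
  node.\<close>

definition coupling ::
  "real ^ 1 ^ 'd::{finite,linorder} \<Rightarrow> real ^ 'n ^ 'n \<Rightarrow> 'n \<Rightarrow> real ^ 'd::{finite,linorder} ^ 'n \<Rightarrow> real ^ 'd::{finite,linorder}" where
  "coupling K A k w = K *v (\<Sum>j\<in>UNIV. (A $ k $ j) *\<^sub>R (C_mat *v (w $ j) - C_mat *v (w $ k)))"

lemma network_dynamics_coupling:
  "network_dynamics \<phi> K A w $ k = node_dynamics \<phi> (w $ k) + coupling K A k w"
  by (simp add: network_dynamics_def coupling_def)

text \<open>Only differences of outputs enter, and these are g times differences of scaled errors.
  Summing the weights of row r over all topologies makes H independent of i, while it may depend on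
  g.\<close>

lemma coupling_bound:
  fixes A :: "nat \<Rightarrow> real ^ 'n ^ 'n" and K :: "real ^ 1 ^ 'd::{finite,linorder}"
  assumes g: "g > 0"
  obtains H where "H \<ge> 0" "\<And>i w. i \<in> {1..Nt::nat} \<Longrightarrow> norm (coupling K (A i) r w) \<le> H * norm (sync_error g r w)"
proof -
  obtain B where B: "B > 0" "\<And>x. norm (K *v x) \<le> B * norm x"
    using norm_matrix_vector_le[of K] by blast
  define c where "c = norm (c_vec :: real ^ 'd::{finite,linorder})"
  define S where "S = (\<Sum>i=1..Nt. \<Sum>j\<in>UNIV. \<bar>A i $ r $ j\<bar>)"
  have S: "S \<ge> 0" unfolding S_def by (intro sum_nonneg) auto
  show ?thesis
  proof (rule that[of "B * (S * (g * (c * 2)))"])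
    show "0 \<le> B * (S * (g * (c * 2)))" using B S g by (simp add: c_def)
    fix i and w :: "real ^ 'd::{finite,linorder} ^ 'n" assume i: "i \<in> {1..Nt}"
    let ?\<xi> = "sync_error g r w"
    have diff: "norm (C_mat *v (w $ j) - C_mat *v (w $ r)) \<le> g * (c * (2 * norm ?\<xi>))" for j
    proof -
      have "norm (C_mat *v (w $ j) - C_mat *v (w $ r)) = \<bar>c_vec \<bullet> w $ j - c_vec \<bullet> w $ r\<bar>"
        by (simp add: norm_vec_def L2_set_def C_mat_mult)
      also have "\<dots> = g * \<bar>c_vec \<bullet> (?\<xi> $ j - ?\<xi> $ r)\<bar>"
        unfolding c_vec_sync_error[OF g, of w j r r] using g by (simp add: abs_mult inner_diff_right)
      also have "\<bar>c_vec \<bullet> (?\<xi> $ j - ?\<xi> $ r)\<bar> \<le> c * norm (?\<xi> $ j - ?\<xi> $ r)"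
        unfolding c_def by (rule Cauchy_Schwarz_ineq2)
      also have "norm (?\<xi> $ j - ?\<xi> $ r) \<le> 2 * norm ?\<xi>"
        using norm_triangle_ineq4[of "?\<xi> $ j" "?\<xi> $ r"] Finite_Cartesian_Product.norm_nth_le[of ?\<xi> j]
          Finite_Cartesian_Product.norm_nth_le[of ?\<xi> r] by linarith
      finally show ?thesis using g by (simp add: c_def mult_left_mono)
    qed
    have "norm (\<Sum>j\<in>UNIV. (A i $ r $ j) *\<^sub>R (C_mat *v (w $ j) - C_mat *v (w $ r)))
        \<le> (\<Sum>j\<in>UNIV. \<bar>A i $ r $ j\<bar> * (g * (c * (2 * norm ?\<xi>))))"
      using diff by (intro sum_norm_le) (auto intro!: mult_left_mono)
    also have "\<dots> = (\<Sum>j\<in>UNIV. \<bar>A i $ r $ j\<bar>) * (g * (c * (2 * norm ?\<xi>)))"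
      by (rule sum_distrib_right[symmetric])
    also have "\<dots> \<le> S * (g * (c * (2 * norm ?\<xi>)))"
    proof (rule mult_right_mono)
      show "(\<Sum>j\<in>UNIV. \<bar>A i $ r $ j\<bar>) \<le> S"
        unfolding S_def using i by (intro member_le_sum[of i _ "\<lambda>i. \<Sum>j\<in>UNIV. \<bar>A i $ r $ j\<bar>"]) (auto intro: sum_nonneg)
    qed (use g in \<open>simp add: c_def\<close>)
    finally have "B * norm (\<Sum>j\<in>UNIV. (A i $ r $ j) *\<^sub>R (C_mat *v (w $ j) - C_mat *v (w $ r)))
        \<le> B * (S * (g * (c * (2 * norm ?\<xi>))))" using B by (intro mult_left_mono) auto
    then show "norm (coupling K (A i) r w) \<le> B * (S * (g * (c * 2))) * norm ?\<xi>"
      unfolding coupling_def using B(2) by (simp add: mult.assoc) (meson order_trans)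
  qed
qed

section \<open>The synchronization set and the distance to it\<close>

lemma sync_set_eq_image: "(sync_set W :: (real ^ 'd ^ 'n) set) = (\<lambda>x. \<chi> k. x) ` W" (is "?L = ?R")
proof
  show "?L \<subseteq> ?R"
  proof
    fix w :: "real ^ 'd ^ 'n" assume w: "w \<in> sync_set W"
    then have "w = (\<chi> k. w $ undefined)" "w $ undefined \<in> W"
      by (auto simp: sync_set_def vec_eq_iff)
    then show "w \<in> ?R" by blast
  qed
qed (auto simp: sync_set_def)

lemma compact_sync_set:
  fixes W :: "(real ^ 'd) set"
  assumes "compact W"
  shows "compact (sync_set W :: (real ^ 'd ^ 'n) set)"
  unfolding sync_set_eq_image using assms by (intro compact_continuous_image continuous_intros)

text \<open>The point x of W nearest to \<open>w $ r\<close>, repeated at all nodes, lies in the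
  synchronization set; its distance to w is bounded node by node.\<close>

lemma infdist_sync_set_le:
  fixes w :: "real ^ 'd::{finite,linorder} ^ 'n"
  assumes W: "compact W" "W \<noteq> {}" and g: "g \<ge> 1"
  shows "infdist w (sync_set W) \<le> real CARD('n) * (infdist (w $ r) W + g ^ CARD('d) * norm (sync_error g r w))"
proof -
  obtain x where x: "x \<in> W" "infdist (w $ r) W = dist (w $ r) x"
    using infdist_attains_inf[OF compact_imp_closed[OF W(1)] W(2)] by blast
  have "infdist w (sync_set W) \<le> dist w (\<chi> k. x)"
    using x(1) by (intro infdist_le) (auto simp: sync_set_def)
  also have "\<dots> \<le> (\<Sum>k\<in>UNIV. norm ((w - (\<chi> k. x)) $ k))"
    unfolding dist_norm norm_vec_def by (rule L2_set_le_sum) simp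
  also have "\<dots> \<le> (\<Sum>k\<in>(UNIV :: 'n set). infdist (w $ r) W + g ^ CARD('d) * norm (sync_error g r w))"
  proof (rule sum_mono)
    fix k
    have "norm ((w - (\<chi> k. x)) $ k) \<le> norm (w $ k - w $ r) + dist (w $ r) x"
      using norm_triangle_ineq[of "w $ k - w $ r" "w $ r - x"] by (simp add: dist_norm)
    moreover have "g ^ CARD('d) * norm (sync_error g r w $ k) \<le> g ^ CARD('d) * norm (sync_error g r w)"
      using g by (intro mult_left_mono Finite_Cartesian_Product.norm_nth_le) auto
    ultimately show "norm ((w - (\<chi> k. x)) $ k) \<le> infdist (w $ r) W + g ^ CARD('d) * norm (sync_error g r w)"
      using norm_le_scaled_sync_error[OF g, of w k r] x(2) by linarith
  qed
  finally show ?thesis by simp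
qed

text \<open>The error is linear and vanishes on \<open>sync_set W\<close>, so its value at w equals
  that at w minus the nearest point of the set. With the preceding estimate, the distance to the set
  and the pair of node distance and error control each other.\<close>

lemma le_infdist_sync_set:
  fixes W :: "(real ^ 'd::{finite,linorder}) set" and r :: "'n::finite"
  assumes W: "compact W" "W \<noteq> {}"
  obtains H where "H > 0" "\<And>w. norm (sync_error g r w) \<le> H * infdist w (sync_set W)"
    "\<And>w :: real ^ 'd::{finite,linorder} ^ 'n. infdist (w $ r) W \<le> infdist w (sync_set W)"
proof -
  obtain H where H: "H > 0" "\<And>w :: real ^ 'd::{finite,linorder} ^ 'n. norm (sync_error g r w) \<le> norm w * H"
    using bounded_linear.pos_bounded[OF linear_sync_error[of g r, unfolded linear_conv_bounded_linear]] by blast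
  have nearest: "\<exists>y\<in>sync_set W. infdist w (sync_set W) = dist w y" for w :: "real ^ 'd::{finite,linorder} ^ 'n"
    using infdist_attains_inf[OF compact_imp_closed[OF compact_sync_set[OF W(1)]], of w]
    by (auto simp: sync_set_eq_image W(2))
  show ?thesis
  proof (rule that[OF H(1)])
    fix w :: "real ^ 'd::{finite,linorder} ^ 'n"
    obtain y where y: "y \<in> sync_set W" "infdist w (sync_set W) = dist w y" using nearest by blast
    have "y $ k = y $ r" for k using y(1) by (simp add: sync_set_def)
    then have "sync_error g r y = 0" by (simp add: sync_error_def vec_eq_iff)
    then have "sync_error g r w = sync_error g r (w - y)" by (simp add: linear_diff[OF linear_sync_error])
    then show "norm (sync_error g r w) \<le> H * infdist w (sync_set W)"
      using H(2)[of "w - y"] y(2) by (simp add: dist_norm mult.commute)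
    have "infdist (w $ r) W \<le> dist (w $ r) (y $ r)" using y(1) by (intro infdist_le) (simp add: sync_set_def)
    also have "\<dots> \<le> dist w y" by (rule dist_vec_nth_le)
    finally show "infdist (w $ r) W \<le> infdist w (sync_set W)" using y(2) by simp
  qed
qed

text \<open>h takes the whole state as a separate argument; freezing it along w turns the influence
  of the other nodes into a function of time, as an input has to be.\<close>

lemma solution_component:
  assumes "solution f w" and "\<And>t x. f t x $ k = h t (x $ k) x"
  shows "solution (\<lambda>t y. h t y (w t)) (\<lambda>t. w t $ k)"
proof -
  obtain D where D: "locally_finite_times D" and cont: "continuous_on {0..} w"
    and deriv: "\<And>t. t \<in> {0..} - D \<Longrightarrow> (w has_vector_derivative f t (w t)) (at t within {0..})"
    using assms(1) unfolding solution_def by blast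
  have "((\<lambda>t. w t $ k) has_vector_derivative h t (w t $ k) (w t)) (at t within {0..})" if "t \<in> {0..} - D" for t
    using bounded_linear.has_vector_derivative[OF bounded_linear_vec_nth deriv[OF that], of k] by (simp add: assms(2))
  then show ?thesis using D cont unfolding solution_def by (blast intro: continuous_on_component)
qed

text \<open>A cascade: the hypothesis \<open>error\<close> controls the error on its own, the error
  bounds the input u of node r, and input-to-state stability then controls the distance of that node
  to W.\<close>

lemma switched_network_stable:
  fixes A :: "nat \<Rightarrow> real ^ 'n ^ 'n" and \<phi> :: "real ^ 'd::{finite,linorder} \<Rightarrow> real"
    and K :: "real ^ 1 ^ 'd::{finite,linorder}" and r :: 'n
  assumes W: "compact W" "W \<noteq> {}" and W_invariant: "invariant_set (\<lambda>t. node_dynamics \<phi>) W"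
    and iss: "input_to_state_stable (node_dynamics \<phi>) W"
    and g: "g \<ge> 1" and \<sigma>: "\<And>i. i \<ge> 1 \<Longrightarrow> \<sigma> i \<in> {1..Nt}"
    and nonneg: "\<And>i. i \<ge> 1 \<Longrightarrow> \<Delta>T i \<ge> 0"
    and unbounded: "\<And>t. \<exists>m. t < switch_time \<Delta>T (2 * m)"
    and error: "\<And>w. solution (switched_network \<phi> K A \<sigma> \<Delta>T) w \<Longrightarrow>
        (\<forall>t\<ge>0. norm (sync_error g r (w t)) \<le> M * norm (sync_error g r (w 0))) \<and>
        ((\<lambda>t. norm (sync_error g r (w t))) \<longlongrightarrow> 0) at_top"
  shows "invariant_set (switched_network \<phi> K A \<sigma> \<Delta>T) (sync_set W)"
    "globally_asymptotically_stable (switched_network \<phi> K A \<sigma> \<Delta>T) (sync_set W)"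
proof -
  let ?f = "switched_network \<phi> K A \<sigma> \<Delta>T" and ?n = "real CARD('n)"
  define u where "u w t = coupling K (A (\<sigma> (active_index \<Delta>T t))) r (w t)" for w t
  have n: "?n > 0" by simp
  have u_pc: "piecewise_continuous (u w)" if sol: "solution ?f w" for w
  proof -
    have "continuous_on {0..} w" using sol by (simp add: solution_def)
    then have "continuous_on {0..} (\<lambda>t. coupling K (A (\<sigma> i)) r (w t))" for i
      unfolding coupling_def
      by (intro bounded_linear.continuous_on[OF matrix_vector_mul_bounded_linear] continuous_intros)
    then show ?thesis
      unfolding u_def
      using piecewise_continuous_switched[of \<Delta>T "\<lambda>i t. coupling K (A (\<sigma> i)) r (w t)", OF nonneg unbounded] by simp
  qed
  have node: "solution (\<lambda>t x. node_dynamics \<phi> x + u w t) (\<lambda>t. w t $ r)" if sol: "solution ?f w" for w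
    using solution_component[OF sol, of r "\<lambda>t y x. node_dynamics \<phi> y + coupling K (A (\<sigma> (active_index \<Delta>T t))) r x"]
    by (simp add: switched_network_def network_dynamics_coupling u_def)
  obtain H where H: "H \<ge> 0" and couple: "\<And>i w. i \<in> {1..Nt} \<Longrightarrow> norm (coupling K (A i) r w) \<le> H * norm (sync_error g r w)"
    using coupling_bound[of g Nt K A r] g by auto
  have u_le: "norm (u w t) \<le> H * norm (sync_error g r (w t))" if t: "t \<ge> 0" for w t
  proof -
    obtain i where "i \<ge> 1" "switch_time \<Delta>T (i - 1) \<le> t" "t < switch_time \<Delta>T i"
      using ex_switch_index[of \<Delta>T t, OF unbounded t] by blast
    then have "active_index \<Delta>T t \<ge> 1" using active_index_eq[of \<Delta>T i t, OF nonneg] by simp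
    then show ?thesis unfolding u_def by (intro couple \<sigma>)
  qed
  obtain H' where H': "H' > 0" "\<And>w. norm (sync_error g r w) \<le> H' * infdist w (sync_set W)"
    and node_dist: "\<And>w :: real ^ 'd::{finite,linorder} ^ 'n. infdist (w $ r) W \<le> infdist w (sync_set W)"
    using le_infdist_sync_set[OF W, of g r] by blast
  have synced: "w t $ k = w t $ r" if "sync_error g r (w t) = 0" for w t k
    using norm_le_scaled_sync_error[OF g, of "w t" k r] that by simp
  show "invariant_set ?f (sync_set W)"
    unfolding invariant_set_def
  proof (intro allI impI)
    fix w and t :: real assume w: "solution ?f w \<and> w 0 \<in> sync_set W" and t: "0 \<le> t"
    \<comment> \<open>The error stays at its initial value 0, so the input vanishes and node r
      follows the unforced system, for which W is invariant.\<close>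
    have "norm (sync_error g r (w 0)) = 0" using H'(2)[of "w 0"] w by simp
    then have zero: "sync_error g r (w s) = 0" if "s \<ge> 0" for s
      using error[of w] w that by fastforce
    have "u w s = 0" if "s \<ge> 0" for s using u_le[OF that, of w] zero[OF that] by simp
    then have "solution (\<lambda>t. node_dynamics \<phi>) (\<lambda>t. w t $ r)"
      using node[of w] w unfolding solution_def by auto
    moreover have "w 0 $ r \<in> W" using w by (simp add: sync_set_def)
    ultimately have "w t $ r \<in> W" using W_invariant t unfolding invariant_set_def by blast
    moreover have "w t $ k = w t $ r" for k using zero[OF t] by (rule synced)
    ultimately show "w t \<in> sync_set W" unfolding sync_set_def mem_Collect_eq by metis
  qed
  have "lyapunov_stable ?f (sync_set W)"
    unfolding lyapunov_stable_def
  proof (intro allI impI)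
    fix \<epsilon> :: real assume \<epsilon>: "\<epsilon> > 0"
    \<comment> \<open>The distance is at most n times a sum of two terms, each of which is kept
      within e.\<close>
    define e where "e = \<epsilon> / (2 * ?n)"
    have e: "e > 0" using \<epsilon> n by (simp add: e_def)
    obtain \<delta>0 \<eta> where \<delta>0: "\<delta>0 > 0" and \<eta>: "\<eta> > 0"
      and small: "\<And>u w t. piecewise_continuous u \<Longrightarrow> solution (\<lambda>t x. node_dynamics \<phi> x + u t) w \<Longrightarrow>
        infdist (w 0) W \<le> \<delta>0 \<Longrightarrow> (\<And>s. 0 \<le> s \<Longrightarrow> norm (u s) \<le> \<eta>) \<Longrightarrow> 0 \<le> t \<Longrightarrow> infdist (w t) W < e"
      using input_to_state_stable_small_input[OF iss e] by blast
    \<comment> \<open>The sign of M is not known, hence |M| + 1.\<close>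
    define M' where "M' = (\<bar>M\<bar> + 1) * H'"
    have M': "M' > 0" using H' by (simp add: M'_def add_nonneg_pos)
    \<comment> \<open>Three demands: on the initial distance of node r, on the size of its input,
      and on the share of the error in the final distance. The summand 1 in H + 1 avoids dividing by
      0.\<close>
    define \<delta> where "\<delta> = min \<delta>0 (min (\<eta> / ((H + 1) * M')) (e / (g ^ CARD('d) * M')))"
    have gd: "g ^ CARD('d) > 0" using g by simp
    have \<delta>: "\<delta> > 0" "\<delta> \<le> \<delta>0" "\<delta> \<le> \<eta> / ((H + 1) * M')" "\<delta> \<le> e / (g ^ CARD('d) * M')"
      using \<delta>0 \<eta> e H M' gd by (auto simp: \<delta>_def)
    show "\<exists>\<delta>>0. \<forall>w. solution ?f w \<and> infdist (w 0) (sync_set W) < \<delta> \<longrightarrow> (\<forall>t\<ge>0. infdist (w t) (sync_set W) < \<epsilon>)"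
    proof (intro exI[of _ \<delta>] conjI allI impI \<delta>(1))
      fix w and t :: real assume w: "solution ?f w \<and> infdist (w 0) (sync_set W) < \<delta>" and t: "0 \<le> t"
      have sync: "norm (sync_error g r (w s)) \<le> M' * \<delta>" if "s \<ge> 0" for s
      proof -
        have "norm (sync_error g r (w s)) \<le> M * norm (sync_error g r (w 0))" using error w that by blast
        also have "\<dots> \<le> (\<bar>M\<bar> + 1) * (H' * \<delta>)"
        proof (rule mult_mono)
          have "H' * infdist (w 0) (sync_set W) \<le> H' * \<delta>" using w H' by (intro mult_left_mono) auto
          with H'(2)[of "w 0"] show "norm (sync_error g r (w 0)) \<le> H' * \<delta>" by linarith
        qed auto
        finally show ?thesis by (simp add: M'_def mult_ac)
      qed
      have "norm (u w s) \<le> \<eta>" if "s \<ge> 0" for s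
      proof -
        have "norm (u w s) \<le> (H + 1) * (M' * \<delta>)"
          using H sync[OF that] by (intro order_trans[OF u_le[OF that]] mult_mono) auto
        also have "\<dots> \<le> \<eta>" using \<delta>(3) H M' by (simp add: pos_le_divide_eq mult_ac)
        finally show ?thesis .
      qed
      moreover have "infdist (w 0 $ r) W \<le> \<delta>0" using node_dist[of "w 0"] w \<delta>(2) by linarith
      ultimately have "infdist (w t $ r) W < e"
        using small[OF u_pc node, of w t] w t by simp
      moreover have "g ^ CARD('d) * norm (sync_error g r (w t)) \<le> e"
      proof -
        have "g ^ CARD('d) * norm (sync_error g r (w t)) \<le> g ^ CARD('d) * (M' * \<delta>)"
          using sync[OF t] gd by (intro mult_left_mono) auto
        also have "\<dots> \<le> e" using \<delta>(4) gd M' by (simp add: pos_le_divide_eq mult_ac)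
        finally show ?thesis .
      qed
      ultimately have "?n * (infdist (w t $ r) W + g ^ CARD('d) * norm (sync_error g r (w t))) < ?n * (2 * e)"
        using n by (intro mult_strict_left_mono) auto
      also have "\<dots> = \<epsilon>" using n by (simp add: e_def)
      finally show "infdist (w t) (sync_set W) < \<epsilon>"
        using infdist_sync_set_le[OF W g, of "w t" r] by linarith
    qed
  qed
  moreover have "globally_attractive ?f (sync_set W)"
    unfolding globally_attractive_def
  proof (intro allI impI)
    fix w assume sol: "solution ?f w"
    have err: "((\<lambda>t. norm (sync_error g r (w t))) \<longlongrightarrow> 0) at_top" using error[OF sol] by blast
    have "(u w \<longlongrightarrow> 0) at_top"
    proof (rule Lim_null_comparison)
      show "\<forall>\<^sub>F t in at_top. norm (u w t) \<le> H * norm (sync_error g r (w t))"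
        using eventually_ge_at_top[of 0] by eventually_elim (rule u_le)
      show "((\<lambda>t. H * norm (sync_error g r (w t))) \<longlongrightarrow> 0) at_top"
        using tendsto_mult_right_zero[OF err] .
    qed
    then have "((\<lambda>t. infdist (w t $ r) W) \<longlongrightarrow> 0) at_top"
      by (rule input_to_state_stable_converging_input[OF iss u_pc[OF sol] _ node[OF sol]])
    then have lim: "((\<lambda>t. ?n * (infdist (w t $ r) W + g ^ CARD('d) * norm (sync_error g r (w t)))) \<longlongrightarrow> 0) at_top"
      by (intro tendsto_mult_right_zero tendsto_add_zero err)
    show "((\<lambda>t. infdist (w t) (sync_set W)) \<longlongrightarrow> 0) at_top"
      by (rule Lim_null_comparison[OF _ lim]) (simp add: infdist_sync_set_le[OF W g] infdist_nonneg)
  qed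
  ultimately show "globally_asymptotically_stable ?f (sync_set W)"
    by (simp add: globally_asymptotically_stable_def)
qed

theorem proposition2:
  fixes A :: "nat \<Rightarrow> real ^ 'n ^ 'n"
    and Nt n0 :: nat
    and \<phi> :: "real ^ 'd::{finite,linorder} \<Rightarrow> real"
    and W :: "(real ^ 'd::{finite,linorder}) set"
    and P :: "real ^ 'd::{finite,linorder} ^ 'd::{finite,linorder}"
    and \<mu> T0 a :: real
  assumes nodes: "CARD('n) \<ge> 2"
    and topologies: "\<forall>i\<in>{1..Nt}. adjacency (A i)"
    and lipschitz: "\<exists>L. L-lipschitz_on UNIV \<phi>"
    and W_compact: "compact W" "W \<noteq> {}"
    and W_invariant: "invariant_set (\<lambda>t. node_dynamics \<phi>) W"
    and W_iss: "input_to_state_stable (node_dynamics \<phi>) W"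
    and mu_pos: "\<mu> > 0"
    and spectrum: "\<forall>i\<in>{1..Nt}. \<forall>z. is_eigenvalue (laplacian (A i)) z \<and> z \<noteq> 0 \<longrightarrow> Re z \<ge> \<mu>"
    and T0_pos: "T0 > 0"
    and a_pos: "a > 0"
    and n0_pos: "n0 \<ge> 1"
    and P_pos_def: "sym_pos_def P"
    and riccati: "shift_mat ** P + P ** transpose shift_mat
        - (2 * \<mu>) *\<^sub>R (P ** transpose C_mat ** C_mat ** P) + a *\<^sub>R mat 1 = 0"
  shows "\<exists>\<tau>s>0. \<exists>gs>0. \<forall>\<tau>\<ge>\<tau>s. \<forall>g\<ge>gs. \<forall>(\<sigma> :: nat \<Rightarrow> nat) (\<Delta>T :: nat \<Rightarrow> real).
    (\<forall>i\<ge>1. \<sigma> i \<in> {1..Nt}) \<and>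
    (\<forall>i\<ge>1. \<Delta>T i \<ge> 0) \<and>
    (\<forall>i\<ge>1. odd i \<longrightarrow> connected_topology (A (\<sigma> i))) \<and>
    (\<forall>i\<ge>1. even i \<longrightarrow> \<not> connected_topology (A (\<sigma> i))) \<and>
    (\<forall>i\<ge>1. even i \<longrightarrow> \<Delta>T i \<le> T0) \<and>
    (\<forall>n i0. odd i0 \<longrightarrow> (\<Sum>m=0..n. \<Delta>T (i0 + 2 * m)) \<ge> \<tau> * (real n - real n0))
    \<longrightarrow>
      compact (sync_set W :: (real ^ 'd::{finite,linorder} ^ 'n) set) \<and>
      invariant_set (switched_network \<phi> (gain g P) A \<sigma> \<Delta>T) (sync_set W) \<and>
      globally_asymptotically_stable (switched_network \<phi> (gain g P) A \<sigma> \<Delta>T) (sync_set W)"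
proof -
  obtain L where lip: "L-lipschitz_on UNIV \<phi>" using lipschitz by blast
  \<comment> \<open>Any node can serve as the reference.\<close>
  define r :: 'n where "r = undefined"
  obtain \<tau>s gs where s: "\<tau>s > 0" "gs \<ge> 1"
    and error: "\<And>\<tau> g \<sigma> \<Delta>T. \<lbrakk>\<tau> \<ge> \<tau>s; g \<ge> gs; \<And>i. i \<ge> 1 \<Longrightarrow> \<sigma> i \<in> {1..Nt}; \<And>i. i \<ge> 1 \<Longrightarrow> \<Delta>T i \<ge> 0;
      \<And>i. i \<ge> 1 \<Longrightarrow> odd i \<Longrightarrow> connected_topology (A (\<sigma> i));
      \<And>i. i \<ge> 1 \<Longrightarrow> even i \<Longrightarrow> \<Delta>T i \<le> T0;
      \<And>n. (\<Sum>m=0..n. \<Delta>T (1 + 2 * m)) \<ge> \<tau> * (real n - real n0)\<rbrakk> \<Longrightarrow>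
      \<exists>M. \<forall>w. solution (switched_network \<phi> (gain g P) A \<sigma> \<Delta>T) w \<longrightarrow>
        (\<forall>t\<ge>0. norm (sync_error g r (w t)) \<le> M * norm (sync_error g r (w 0))) \<and>
        ((\<lambda>t. norm (sync_error g r (w t))) \<longlongrightarrow> 0) at_top"
    by (rule sync_error_decay[of Nt A L \<phi> \<mu> T0 a P n0 r])
      (use topologies lip spectrum T0_pos a_pos P_pos_def riccati in blast)+
  show ?thesis
  proof (rule exI[of _ \<tau>s], rule conjI[OF s(1)], rule exI[of _ gs], intro conjI allI impI)
    show "0 < gs" using s by simp
  next
    fix \<tau> g and \<sigma> :: "nat \<Rightarrow> nat" and \<Delta>T :: "nat \<Rightarrow> real"
    assume \<tau>: "\<tau>s \<le> \<tau>" and g: "gs \<le> g" and conds: "(\<forall>i\<ge>1. \<sigma> i \<in> {1..Nt}) \<and> (\<forall>i\<ge>1. \<Delta>T i \<ge> 0) \<and>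
      (\<forall>i\<ge>1. odd i \<longrightarrow> connected_topology (A (\<sigma> i))) \<and>
      (\<forall>i\<ge>1. even i \<longrightarrow> \<not> connected_topology (A (\<sigma> i))) \<and>
      (\<forall>i\<ge>1. even i \<longrightarrow> \<Delta>T i \<le> T0) \<and>
      (\<forall>n i0. odd i0 \<longrightarrow> (\<Sum>m=0..n. \<Delta>T (i0 + 2 * m)) \<ge> \<tau> * (real n - real n0))"
    have \<sigma>: "\<sigma> i \<in> {1..Nt}" and nonneg: "\<Delta>T i \<ge> 0" if "i \<ge> 1" for i :: nat using conds that by blast+
    have dwell_odd: "(\<Sum>m=0..n. \<Delta>T (i0 + 2 * m)) \<ge> \<tau> * (real n - real n0)" if "odd i0" for n i0
      using conds that by blast
    have dwell: "(\<Sum>m=0..n. \<Delta>T (1 + 2 * m)) \<ge> \<tau> * (real n - real n0)" for n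
      by (rule dwell_odd) simp
    have "\<tau> > 0" using s(1) \<tau> by simp
    note unbounded = switch_time_at_top[of \<Delta>T, OF nonneg this dwell]
    have conn: "connected_topology (A (\<sigma> i))" if "i \<ge> 1" "odd i" for i using conds that by blast
    have even_le: "\<Delta>T i \<le> T0" if "i \<ge> 1" "even i" for i using conds that by blast
    obtain M where "\<forall>w. solution (switched_network \<phi> (gain g P) A \<sigma> \<Delta>T) w \<longrightarrow>
        (\<forall>t\<ge>0. norm (sync_error g r (w t)) \<le> M * norm (sync_error g r (w 0))) \<and>
        ((\<lambda>t. norm (sync_error g r (w t))) \<longlongrightarrow> 0) at_top"
      using error[OF \<tau> g \<sigma> nonneg conn even_le dwell] ..
    note M = this[THEN spec, THEN mp]
    have g1: "g \<ge> 1" using s g by simp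
    note stable = switched_network_stable[OF W_compact W_invariant W_iss g1 \<sigma> nonneg unbounded M]
    show "compact (sync_set W :: (real ^ 'd::{finite,linorder} ^ 'n) set)"
      by (rule compact_sync_set[OF W_compact(1)])
    show "invariant_set (switched_network \<phi> (gain g P) A \<sigma> \<Delta>T) (sync_set W)"
      by (rule stable(1))
    show "globally_asymptotically_stable (switched_network \<phi> (gain g P) A \<sigma> \<Delta>T) (sync_set W)"
      by (rule stable(2))
  qed
qed

end
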